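(* Let $m$ be a string transduction. Then $m\in\mathcal{MSO}_{\mathrm{ed}}$ if and only if $m\in\bigcup_{k\ge1}\mathcal{NGSM}^k$ and $m$ is functional.
   Context: A 2gsm is $M=(Q,\Sigma_1,\Sigma_2,\delta,q_{in},q_f)$ with finite state set $Q$ and instructions $(p,\sigma,q_1,\alpha_1,\epsilon_1,q_0,\alpha_0,\epsilon_0)$, $p\neq q_f$, $\sigma\in\Sigma_1\cup\{\vdash,\dashv\}$, $\alpha_i\in\Sigma_2^*$, $\epsilon_i\in\{-1,0,+1\}$. On input $w$ the read-only tape is $\vdash w\dashv$ (positions $0..|w|+1$); start in $q_{in}$ at position 0; in state $p$ any instruction starting with $p$ may be executed: if the scanned symbol is $\sigma$, go to $q_1$, append $\alpha_1$ to the one-way output tape and move by $\epsilon_1$, else do the same with $(q_0,\alpha_0,\epsilon_0)$; the head may not leave the tape. $M$ realizes the relation of all $(w,z)$ such that some computation reaches $q_f$ having written $z$. $\mathcal{NGSM}$ is the family of transductions realized by 2gsm's, and $\mathcal{NGSM}^k$ the family of compositions of $k$ of them (composition $R_1\circ R_2=\{(a,c)\mid\exists b:(a,b)\in R_1,(b,c)\in R_2\}$). A relation $m$ is functional if $(w,z_1),(w,z_2)\in m$ imply $z_1=z_2$. Graphs are $(V,E,\mathrm{lab})$ with $E\subseteq V\times\Gamma\times V$, $\mathrm{lab}:V\to\Sigma$; monadic second-order logic on graphs has node and node-set variables and atomic formulas $\mathrm{lab}_\sigma(x)$, $\mathrm{edge}_\gamma(x,y)$, $x=y$, $x\in X$.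 An mso definable graph transduction is a partial function given by a closed domain formula $\varphi_{\mathrm{dom}}$, a finite copy set $C$, node formulas $\varphi^c_\sigma(x)$ and edge formulas $\varphi^{c_1,c_2}_\gamma(x,y)$; on input $g\models\varphi_{\mathrm{dom}}$ the output has nodes $(u,c)$ for which exactly one $\sigma$ satisfies $g\models\varphi^c_\sigma(u)$ (labelled $\sigma$) and edges $((u,c_1),\gamma,(v,c_2))$ between such nodes iff $g\models\varphi^{c_1,c_2}_\gamma(u,v)$. For $w$ of length $k$, $\mathrm{ed}(w)$ has $k+1$ unlabelled nodes forming a path whose edges are labelled by the letters of $w$; $\mathcal{MSO}_{\mathrm{ed}}$ is the family of string transductions $m$ such that $\{(\mathrm{ed}(w),\mathrm{ed}(z))\mid(w,z)\in m\}$ is an mso definable graph transduction. *)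

theory Defs
  imports Main
begin

datatype 'a tsym = LEnd | REnd | Sym 'a

text \<open>An instruction (p, sigma, q1, alpha1, eps1, q0, alpha0, eps0); states are naturals.\<close>
type_synonym ('a,'b) instr = "nat \<times> 'a tsym \<times> nat \<times> 'b list \<times> int \<times> nat \<times> 'b list \<times> int"

record ('a,'b) gsm =
  gstates :: "nat set"
  gin :: "'a set"
  gout :: "'b set"
  gdelta :: "('a,'b) instr set"
  ginit :: nat
  gfinal :: nat

definition wf_gsm :: "('a,'b) gsm \<Rightarrow> bool" where
  "wf_gsm M \<longleftrightarrow> finite (gstates M) \<and> finite (gin M) \<and> finite (gout M) \<and> finite (gdelta M)
     \<and> ginit M \<in> gstates M \<and> gfinal M \<in> gstates M
     \<and> (\<forall>(p,\<sigma>,q1,a1,e1,q0,a0,e0) \<in> gdelta M.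
          p \<in> gstates M \<and> p \<noteq> gfinal M
          \<and> \<sigma> \<in> {LEnd, REnd} \<union> Sym ` gin M
          \<and> q1 \<in> gstates M \<and> q0 \<in> gstates M
          \<and> a1 \<in> lists (gout M) \<and> a0 \<in> lists (gout M)
          \<and> e1 \<in> {-1,0,1} \<and> e0 \<in> {-1,0,1})"

definition tape :: "'a list \<Rightarrow> nat \<Rightarrow> 'a tsym" where
  "tape w i = (if i = 0 then LEnd else if i = Suc (length w) then REnd else Sym (w ! (i - 1)))"

inductive gsm_step :: "('a,'b) gsm \<Rightarrow> 'a list \<Rightarrow> nat \<times> nat \<times> 'b list \<Rightarrow> nat \<times> nat \<times> 'b list \<Rightarrow> bool"
  for M w where
  "(p,\<sigma>,q1,a1,e1,q0,a0,e0) \<in> gdelta M \<Longrightarrow>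
   (if tape w i = \<sigma> then (q,a,e) = (q1,a1,e1) else (q,a,e) = (q0,a0,e0)) \<Longrightarrow>
   0 \<le> int i + e \<Longrightarrow> int i + e \<le> int (length w) + 1 \<Longrightarrow>
   gsm_step M w (p,i,z) (q, nat (int i + e), z @ a)"

definition gsm_rel :: "('a,'b) gsm \<Rightarrow> ('a list \<times> 'b list) set" where
  "gsm_rel M = {(w,z). w \<in> lists (gin M) \<and>
       (\<exists>i. (gsm_step M w)\<^sup>*\<^sup>* (ginit M, 0, []) (gfinal M, i, z))}"

definition NGSM :: "('a list \<times> 'b list) set set" where
  "NGSM = {gsm_rel M | M. wf_gsm M}"

text \<open>Compositions; intermediate alphabets are finite sets of naturals.\<close>
fun nat_chain :: "nat \<Rightarrow> (nat list \<times> nat list) set set" where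
  "nat_chain 0 = {Id}"
| "nat_chain (Suc n) = {R O S | R S. R \<in> NGSM \<and> S \<in> nat_chain n}"

definition NGSMpow :: "nat \<Rightarrow> ('a list \<times> 'b list) set set" where
  "NGSMpow k = (if k = 0 then {} else if k = 1 then NGSM else
     {A O C O B | A C B. A \<in> (NGSM :: ('a list \<times> nat list) set set)
                        \<and> C \<in> nat_chain (k - 2)
                        \<and> B \<in> (NGSM :: (nat list \<times> 'b list) set set)})"

definition functional :: "('x \<times> 'y) set \<Rightarrow> bool" where
  "functional m \<longleftrightarrow> (\<forall>w z1 z2. (w,z1) \<in> m \<longrightarrow> (w,z2) \<in> m \<longrightarrow> z1 = z2)"

record ('v,'l,'g) graph =
  verts :: "'v set"
  edges :: "('v \<times> 'g \<times> 'v) set"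
  lab :: "'v \<Rightarrow> 'l"

definition graph_over :: "'l set \<Rightarrow> 'g set \<Rightarrow> ('v,'l,'g) graph \<Rightarrow> bool" where
  "graph_over \<Sigma> \<Gamma> G \<longleftrightarrow> finite (verts G) \<and> edges G \<subseteq> verts G \<times> \<Gamma> \<times> verts G
      \<and> lab G ` verts G \<subseteq> \<Sigma>"

definition graph_iso :: "('v,'l,'g) graph \<Rightarrow> ('w,'l,'g) graph \<Rightarrow> bool" where
  "graph_iso G H \<longleftrightarrow> (\<exists>f. bij_betw f (verts G) (verts H)
      \<and> (\<forall>u\<in>verts G. \<forall>v\<in>verts G. \<forall>\<gamma>. (u,\<gamma>,v) \<in> edges G \<longleftrightarrow> (f u,\<gamma>,f v) \<in> edges H)
      \<and> (\<forall>u\<in>verts G. lab H (f u) = lab G u))"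

text \<open>MSO formulas; node variables and node-set variables are numbered separately.\<close>
datatype ('l,'g) mso =
    FLab 'l nat
  | FEdge 'g nat nat
  | FEq nat nat
  | FIn nat nat
  | FNot "('l,'g) mso"
  | FAnd "('l,'g) mso" "('l,'g) mso"
  | FExN nat "('l,'g) mso"
  | FExS nat "('l,'g) mso"

fun sat :: "('v,'l,'g) graph \<Rightarrow> (nat \<Rightarrow> 'v) \<Rightarrow> (nat \<Rightarrow> 'v set) \<Rightarrow> ('l,'g) mso \<Rightarrow> bool" where
  "sat G nv sv (FLab \<sigma> x) = (lab G (nv x) = \<sigma>)"
| "sat G nv sv (FEdge \<gamma> x y) = ((nv x, \<gamma>, nv y) \<in> edges G)"
| "sat G nv sv (FEq x y) = (nv x = nv y)"
| "sat G nv sv (FIn x X) = (nv x \<in> sv X)"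
| "sat G nv sv (FNot \<phi>) = (\<not> sat G nv sv \<phi>)"
| "sat G nv sv (FAnd \<phi> \<psi>) = (sat G nv sv \<phi> \<and> sat G nv sv \<psi>)"
| "sat G nv sv (FExN x \<phi>) = (\<exists>u\<in>verts G. sat G (nv(x := u)) sv \<phi>)"
| "sat G nv sv (FExS X \<phi>) = (\<exists>U. U \<subseteq> verts G \<and> sat G nv (sv(X := U)) \<phi>)"

fun fvN :: "('l,'g) mso \<Rightarrow> nat set" where
  "fvN (FLab \<sigma> x) = {x}"
| "fvN (FEdge \<gamma> x y) = {x, y}"
| "fvN (FEq x y) = {x, y}"
| "fvN (FIn x X) = {x}"
| "fvN (FNot \<phi>) = fvN \<phi>"
| "fvN (FAnd \<phi> \<psi>) = fvN \<phi> \<union> fvN \<psi>"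
| "fvN (FExN x \<phi>) = fvN \<phi> - {x}"
| "fvN (FExS X \<phi>) = fvN \<phi>"

fun fvS :: "('l,'g) mso \<Rightarrow> nat set" where
  "fvS (FLab \<sigma> x) = {}"
| "fvS (FEdge \<gamma> x y) = {}"
| "fvS (FEq x y) = {}"
| "fvS (FIn x X) = {X}"
| "fvS (FNot \<phi>) = fvS \<phi>"
| "fvS (FAnd \<phi> \<psi>) = fvS \<phi> \<union> fvS \<psi>"
| "fvS (FExN x \<phi>) = fvS \<phi>"
| "fvS (FExS X \<phi>) = fvS \<phi> - {X}"

text \<open>An mso definable graph transduction: domain formula (closed), finite copy set C,
  output alphabets (node labels Sigma', edge labels Gamma'), node formulas with the single
  free node variable 0 (= x), and edge formulas with free node variables 0 (= x) and 1 (= y).\<close>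
record ('l,'g,'c,'l2,'g2) msot =
  tdom :: "('l,'g) mso"
  tcopies :: "'c set"
  tnlabs :: "'l2 set"
  telabs :: "'g2 set"
  tnode :: "'c \<Rightarrow> 'l2 \<Rightarrow> ('l,'g) mso"
  tedge :: "'c \<Rightarrow> 'c \<Rightarrow> 'g2 \<Rightarrow> ('l,'g) mso"

definition wf_msot :: "('l,'g,'c,'l2,'g2) msot \<Rightarrow> bool" where
  "wf_msot T \<longleftrightarrow> finite (tcopies T) \<and> finite (tnlabs T) \<and> finite (telabs T)
     \<and> fvN (tdom T) = {} \<and> fvS (tdom T) = {}
     \<and> (\<forall>c \<sigma>. fvN (tnode T c \<sigma>) \<subseteq> {0} \<and> fvS (tnode T c \<sigma>) = {})
     \<and> (\<forall>c1 c2 \<gamma>. fvN (tedge T c1 c2 \<gamma>) \<subseteq> {0, 1} \<and> fvS (tedge T c1 c2 \<gamma>) = {})"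

definition sat1 :: "('v,'l,'g) graph \<Rightarrow> ('l,'g) mso \<Rightarrow> 'v \<Rightarrow> bool" where
  "sat1 G \<phi> u = sat G (\<lambda>_. u) (\<lambda>_. {}) \<phi>"

definition sat2 :: "('v,'l,'g) graph \<Rightarrow> ('l,'g) mso \<Rightarrow> 'v \<Rightarrow> 'v \<Rightarrow> bool" where
  "sat2 G \<phi> u v = sat G ((\<lambda>_. u)(1 := v)) (\<lambda>_. {}) \<phi>"

definition out_verts :: "('l,'g,'c,'l2,'g2) msot \<Rightarrow> ('v,'l,'g) graph \<Rightarrow> ('v \<times> 'c) set" where
  "out_verts T G = {(u,c). u \<in> verts G \<and> c \<in> tcopies T \<and>
      (\<exists>!\<sigma>. \<sigma> \<in> tnlabs T \<and> sat1 G (tnode T c \<sigma>) u)}"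

definition apply_msot :: "('l,'g,'c,'l2,'g2) msot \<Rightarrow> ('v,'l,'g) graph \<Rightarrow> ('v \<times> 'c, 'l2, 'g2) graph option" where
  "apply_msot T G = (if sat G (\<lambda>_. undefined) (\<lambda>_. {}) (tdom T) then
     Some \<lparr> verts = out_verts T G,
            edges = {((u,c1),\<gamma>,(v,c2)). (u,c1) \<in> out_verts T G \<and> (v,c2) \<in> out_verts T G
                       \<and> \<gamma> \<in> telabs T \<and> sat2 G (tedge T c1 c2 \<gamma>) u v},
            lab = (\<lambda>(u,c). THE \<sigma>. \<sigma> \<in> tnlabs T \<and> sat1 G (tnode T c \<sigma>) u) \<rparr>
   else None)"

definition ed :: "'a list \<Rightarrow> (nat, unit, 'a) graph" where
  "ed w = \<lparr> verts = {0..length w}, edges = {(i, w ! i, Suc i) | i. i < length w}, lab = (\<lambda>_. ()) \<rparr>"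

text \<open>m (a transduction from Sigma1* to Sigma2*) is in MSO_ed iff the graph relation
  {(ed w, ed z) | (w,z) in m} (graphs up to isomorphism, over the alphabets
  (unit, Sigma1) for input and (unit, Sigma2) for output) is realized by an mso definable
  graph transduction.\<close>
definition MSO_ed :: "'a set \<Rightarrow> 'b set \<Rightarrow> ('a list \<times> 'b list) set \<Rightarrow> bool" where
  "MSO_ed \<Sigma>1 \<Sigma>2 m \<longleftrightarrow> (\<exists>T :: (unit, 'a, nat, unit, 'b) msot.
      wf_msot T \<and> tnlabs T = {()} \<and> telabs T = \<Sigma>2 \<and>
      (\<forall>(w,z) \<in> m. \<exists>H. apply_msot T (ed w) = Some H \<and> graph_iso H (ed z)) \<and>
      (\<forall>(G :: (nat, unit, 'a) graph) H. graph_over {()} \<Sigma>1 G \<longrightarrow> apply_msot T G = Some H \<longrightarrow>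
          (\<exists>(w,z) \<in> m. graph_iso G (ed w) \<and> graph_iso H (ed z))))"

end

theory Submission
  imports Defs "HOL-Library.Nat_Bijection"
begin

text \<open>Languages of marked words recognized by finite congruences mediate between the two sides.
  From left to right, one nondeterministic machine annotates every node with the classes of the
  parts of the word to its left and right, and a second one walks from output node to output node;
  whether a guessed target is correct can be decided from the classes. From right to left, an
  accepting computation of a machine can be replaced by a positional strategy (a choice of at most
  one step per configuration); the lexicographically least accepting strategy is MSO definable, so
  every machine has an MSO definable uniformizer. Uniformizing a composition from the last machine
  to the first, each time restricting the outputs to the (recognizable) domain of what follows,
  gives an MSO definable uniformizer, which is the whole relation if that is functional.\<close>

section \<open>Recognizable languages\<close>

text \<open>The obstacle is that a functional composition may consist of machines that are not
  functional: one input can have infinitely many outputs, and some of them may be dead ends for the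
  machines that follow. No factor can be translated by itself; what is translated is a choice of one
  usable output per input. Cutting loops out of an accepting computation changes its output, which
  is harmless because every usable output is an equally good choice. This is why strategies may be
  positional, so that they become annotations of the tape by a finite alphabet. Usability must be
  enforced before the choice is made; it becomes part of acceptance by keeping the class of the
  written word in the state. The order on strategies serves to make the annotation unique, so that
  all node and edge languages, each of which guesses the annotation anew, speak about the same
  computation.\<close>

definition fcong :: "('x list \<Rightarrow> 'y) \<Rightarrow> bool" where
  "fcong f \<longleftrightarrow> finite (range f) \<and>
     (\<forall>u u' v v'. f u = f u' \<longrightarrow> f v = f v' \<longrightarrow> f (u @ v) = f (u' @ v'))"

definition saturates :: "('x list \<Rightarrow> 'y) \<Rightarrow> 'x list set \<Rightarrow> bool" where
  "saturates f L \<longleftrightarrow> (\<forall>u v. f u = f v \<longrightarrow> (u \<in> L \<longleftrightarrow> v \<in> L))"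

text \<open>Recognizability by a finite monoid, with the monoid left implicit in the kernel of
  \<open>f\<close>. A definition cannot quantify over the type of the classes, so they are numbered;
  \<open>fcong_nat\<close> shows that this loses nothing. The alphabet may be infinite, which spares
  the constructions below from bounding their letters.\<close>

definition recog :: "'x list set \<Rightarrow> bool" where
  "recog L \<longleftrightarrow> (\<exists>f :: 'x list \<Rightarrow> nat. fcong f \<and> saturates f L)"

lemma fcong_nat:
  assumes "fcong f"
  obtains g :: "'x list \<Rightarrow> nat" where "fcong g" "\<And>u v. g u = g v \<longleftrightarrow> f u = f v"
proof -
  from assms have "finite (range f)" by (simp add: fcong_def)
  then obtain h :: "_ \<Rightarrow> nat" where h: "inj_on h (range f)"
    using finite_imp_inj_to_nat_seg by blast
  have eq: "(h \<circ> f) u = (h \<circ> f) v \<longleftrightarrow> f u = f v" for u v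
    using h by (auto simp: inj_on_def)
  have "range (h \<circ> f) = h ` range f" by auto
  then have "finite (range (h \<circ> f))" using \<open>finite (range f)\<close> by simp
  then have "fcong (h \<circ> f)" using assms eq unfolding fcong_def by blast
  then show thesis using that eq by blast
qed

lemma recogI:
  assumes "fcong f" "saturates f L"
  shows "recog L"
proof -
  obtain g :: "'a list \<Rightarrow> nat" where "fcong g" "\<And>u v. g u = g v \<longleftrightarrow> f u = f v"
    using fcong_nat[OF assms(1)] by metis
  then show ?thesis using assms(2) unfolding recog_def saturates_def by metis
qed

lemma fcongI:
  assumes "finite (range f)"
    "\<And>u u' v v'. f u = f u' \<Longrightarrow> f v = f v' \<Longrightarrow> f (u @ v) = f (u' @ v')"
  shows "fcong f"
  using assms unfolding fcong_def by blast

lemma saturatesI: "(\<And>u v. f u = f v \<Longrightarrow> u \<in> L \<longleftrightarrow> v \<in> L) \<Longrightarrow> saturates f L"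
  unfolding saturates_def by blast

lemma saturatesD: "saturates f L \<Longrightarrow> f u = f v \<Longrightarrow> u \<in> L \<longleftrightarrow> v \<in> L"
  unfolding saturates_def by blast

lemma fcong_append:
  "fcong f \<Longrightarrow> f u = f u' \<Longrightarrow> f v = f v' \<Longrightarrow> f (u @ v) = f (u' @ v')"
  unfolding fcong_def by blast

text \<open>The product of the individual congruences works. Its value is the graph of
  \<open>i \<mapsto> F i u\<close> over \<open>I\<close>, so that finiteness comes from a power set
  and nothing outside \<open>I\<close> matters.\<close>

lemma recog_common:
  assumes "finite I" "\<And>i. i \<in> I \<Longrightarrow> recog (L i)"
  obtains f :: "'x list \<Rightarrow> nat" where "fcong f" "\<And>i. i \<in> I \<Longrightarrow> saturates f (L i)"
proof -
  have "\<forall>i\<in>I. \<exists>f :: 'x list \<Rightarrow> nat. fcong f \<and> saturates f (L i)"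
    using assms(2) unfolding recog_def by blast
  then obtain F :: "'a \<Rightarrow> 'x list \<Rightarrow> nat"
    where F: "\<And>i. i \<in> I \<Longrightarrow> fcong (F i)" "\<And>i. i \<in> I \<Longrightarrow> saturates (F i) (L i)"
    by metis
  define g where "g u = (\<lambda>i. (i, F i u)) ` I" for u
  have geq: "g u = g v \<longleftrightarrow> (\<forall>i\<in>I. F i u = F i v)" for u v
  proof
    show "\<forall>i\<in>I. F i u = F i v" if "g u = g v"
    proof
      fix i assume "i \<in> I"
      then have "(i, F i u) \<in> g v" using that unfolding g_def by blast
      then show "F i u = F i v" unfolding g_def by auto
    qed
  qed (simp add: g_def)
  have "range g \<subseteq> Pow (Sigma I (\<lambda>i. range (F i)))" unfolding g_def by auto
  moreover have "finite (Sigma I (\<lambda>i. range (F i)))"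
    using assms(1) F(1) unfolding fcong_def by auto
  ultimately have "finite (range g)" using finite_subset by (metis finite_Pow_iff)
  moreover have "g (u @ v) = g (u' @ v')" if "g u = g u'" "g v = g v'" for u u' v v'
    using that F(1) fcong_append unfolding geq by metis
  ultimately have "fcong g" by (rule fcongI)
  then obtain f :: "'x list \<Rightarrow> nat" where f: "fcong f" "\<And>u v. f u = f v \<longleftrightarrow> g u = g v"
    using fcong_nat by metis
  have "saturates f (L i)" if "i \<in> I" for i
    using F(2)[OF that] that unfolding saturates_def f(2) geq by blast
  then show thesis using that f(1) by blast
qed

text \<open>The monoid behind a congruence: classes are multiplied through chosen representatives.
  Formulas and machines use \<open>mul\<close> to update a class while they read.\<close>

lemma fcong_mult:
  assumes "fcong f"
  obtains mul where "\<And>u v. f (u @ v) = mul (f u) (f v)"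
proof
  fix u v
  have "f (SOME u'. f u' = f u) = f u" "f (SOME v'. f v' = f v) = f v"
    by (rule someI[of _ u], rule refl) (rule someI[of _ v], rule refl)
  then show "f (u @ v) = (\<lambda>a b. f ((SOME u. f u = a) @ (SOME v. f v = b))) (f u) (f v)"
    using fcong_append[OF assms] by metis
qed

lemma recogE:
  assumes "recog L"
  obtains f :: "'x list \<Rightarrow> nat" where "fcong f" "saturates f L"
  using assms unfolding recog_def by blast

lemma recog_Not:
  assumes "recog {W. P W}"
  shows "recog {W. \<not> P W}"
proof -
  obtain f :: "'a list \<Rightarrow> nat" where f: "fcong f" "saturates f {W. P W}"
    using assms by (rule recogE)
  from f(1) show ?thesis
  proof (rule recogI, intro saturatesI)
    fix u v assume "f u = f v"
    from saturatesD[OF f(2) this] show "u \<in> {W. \<not> P W} \<longleftrightarrow> v \<in> {W. \<not> P W}" by simp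
  qed
qed

lemma recog_ball:
  assumes "finite I" "\<And>i. i \<in> I \<Longrightarrow> recog {W. P i W}"
  shows "recog {W. \<forall>i\<in>I. P i W}"
proof -
  obtain f :: "'b list \<Rightarrow> nat" where f: "fcong f" "\<And>i. i \<in> I \<Longrightarrow> saturates f {W. P i W}"
    using recog_common[of I "\<lambda>i. {W. P i W}"] assms by metis
  from f(1) show ?thesis
  proof (rule recogI, intro saturatesI)
    fix u v assume "f u = f v"
    from saturatesD[OF f(2) this] have "P i u \<longleftrightarrow> P i v" if "i \<in> I" for i
      using that by simp
    then show "u \<in> {W. \<forall>i\<in>I. P i W} \<longleftrightarrow> v \<in> {W. \<forall>i\<in>I. P i W}" by simp
  qed
qed

lemma recog_bex:
  assumes "finite I" "\<And>i. i \<in> I \<Longrightarrow> recog {W. P i W}"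
  shows "recog {W. \<exists>i\<in>I. P i W}"
  using recog_Not[OF recog_ball[of I "\<lambda>i W. \<not> P i W"]] assms recog_Not by auto

lemma recog_conj:
  assumes "recog {W. P W}" "recog {W. Q W}"
  shows "recog {W. P W \<and> Q W}"
proof -
  have "recog {W. \<forall>b\<in>{0, 1 :: nat}. (if b = 0 then P else Q) W}"
    by (rule recog_ball) (use assms in auto)
  then show ?thesis by simp
qed

lemma recog_const: "recog {W. P}"
  by (rule recogI[of "\<lambda>_. ()"]) (auto simp: fcong_def saturates_def)

lemma recog_vimage:
  assumes "recog L"
  shows "recog {W. map h W \<in> L}"
proof -
  from assms obtain f :: "_ \<Rightarrow> nat" where f: "fcong f" "saturates f L" by (rule recogE)
  have "range (\<lambda>W. f (map h W)) \<subseteq> range f" by auto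
  then have "finite (range (\<lambda>W. f (map h W)))"
    using f(1) finite_subset unfolding fcong_def by blast
  then have "fcong (\<lambda>W. f (map h W))"
    by (rule fcongI) (unfold map_append, rule fcong_append[OF f(1)])
  then show ?thesis
  proof (rule recogI, intro saturatesI)
    fix u v assume "f (map h u) = f (map h v)"
    from saturatesD[OF f(2) this]
    show "u \<in> {W. map h W \<in> L} \<longleftrightarrow> v \<in> {W. map h W \<in> L}" by simp
  qed
qed

text \<open>The subset construction for congruences: a word is mapped to the set of classes of its
  preimages. Since \<open>map h\<close> preserves length, preimages of a product are exactly
  products of preimages, which gives compatibility with concatenation.\<close>

lemma recog_image:
  assumes "recog L"
  shows "recog (map h ` L)"
proof -
  obtain f :: "'a list \<Rightarrow> nat" where f: "fcong f" "saturates f L"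
    using assms recog_def by blast
  define g where "g u = f ` {u'. map h u' = u}" for u
  have "range g \<subseteq> Pow (range f)" unfolding g_def by auto
  then have fin: "finite (range g)" using f(1) finite_subset unfolding fcong_def by blast
  have app: "g (u @ v) = {c. \<exists>u' v'. map h u' = u \<and> map h v' = v \<and> c = f (u' @ v')}" for u v
    unfolding g_def by (auto simp: map_eq_append_conv)
  have sub: "g (u @ v) \<subseteq> g (u' @ v')" if "g u = g u'" "g v = g v'" for u u' v v'
  proof
    fix c assume "c \<in> g (u @ v)"
    then obtain a b where ab: "map h a = u" "map h b = v" "c = f (a @ b)" unfolding app by auto
    have "f a \<in> g u'" "f b \<in> g v'" using ab that unfolding g_def by auto
    then obtain a' b' where "map h a' = u'" "map h b' = v'" "f a = f a'" "f b = f b'"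
      unfolding g_def by auto
    moreover have "c = f (a' @ b')"
      unfolding ab(3) by (rule fcong_append[OF f(1)]) (use calculation in simp_all)
    ultimately show "c \<in> g (u' @ v')" unfolding app by blast
  qed
  then have "fcong g" using fin by (intro fcongI equalityI sub) simp_all
  moreover have "u \<in> map h ` L \<longleftrightarrow> g u \<inter> f ` L \<noteq> {}" for u
  proof
    assume "g u \<inter> f ` L \<noteq> {}"
    then obtain u' v where "map h u' = u" "v \<in> L" "f u' = f v" unfolding g_def by auto
    then show "u \<in> map h ` L" using f(2) unfolding saturates_def by blast
  qed (auto simp: g_def)
  then have "saturates g (map h ` L)" unfolding saturates_def by auto
  ultimately show ?thesis by (rule recogI)
qed

text \<open>Guessing an additional track and then erasing it is a projection. Set quantifiers,
  reachability certificates and guessed strategies all enter recognizable languages in this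
  way.\<close>

lemma recog_ex_annot:
  assumes "recog {W. P W}"
  shows "recog {W. \<exists>ys. length ys = length W \<and> P (zip W ys)}"
proof -
  have "{W. \<exists>ys. length ys = length W \<and> P (zip W ys)} = map fst ` {W. P W}"
  proof (intro set_eqI iffI)
    fix W assume "W \<in> {W. \<exists>ys. length ys = length W \<and> P (zip W ys)}"
    then obtain ys where "length ys = length W" "P (zip W ys)" by auto
    then show "W \<in> map fst ` {W. P W}" by (intro image_eqI[of _ _ "zip W ys"]) auto
  next
    fix W assume "W \<in> map fst ` {W. P W}"
    then obtain V where "P V" "W = map fst V" by auto
    then show "W \<in> {W. \<exists>ys. length ys = length W \<and> P (zip W ys)}"
      by (auto intro!: exI[of _ "map snd V"] simp: zip_map_fst_snd)
  qed
  then show ?thesis using recog_image[OF assms] by simp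
qed

lemma recog_ex_letter: "recog {W. \<exists>x\<in>set W. P x}"
  by (rule recogI[of "\<lambda>W. \<exists>x\<in>set W. P x"])
    (auto simp: fcong_def saturates_def intro: finite_subset[OF subset_UNIV])

lemma recog_all_letter: "recog {W. \<forall>x\<in>set W. P x}"
  using recog_Not[OF recog_ex_letter[of "\<lambda>x. \<not> P x"]] by simp

text \<open>Concatenation creates one new neighbouring pair, so remembering the first and the last
  letter suffices. They are remembered only through the finite summaries \<open>r\<close> and
  \<open>l\<close>, because the alphabet itself may be infinite.\<close>

lemma recog_successively:
  assumes "finite (range l)" "finite (range r)" "\<And>x y. Q x y \<longleftrightarrow> Q' (l x) (r y)"
  shows "recog {W. successively Q W}"
proof -
  define f where "f W = (successively Q W, if W = [] then None else Some (r (hd W), l (last W)))" for W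
  have "range f \<subseteq> UNIV \<times> insert None (Some ` (range r \<times> range l))"
    unfolding f_def by (auto split: if_splits)
  then have "finite (range f)" by (rule finite_subset) (use assms in auto)
  moreover have "f (u @ v) = f (u' @ v')" if "f u = f u'" "f v = f v'" for u u' v v'
    using that unfolding f_def by (auto simp: successively_append_iff assms(3) split: if_splits)
  ultimately have "fcong f" by (rule fcongI)
  moreover have "saturates f {W. successively Q W}" unfolding saturates_def f_def by auto
  ultimately show ?thesis by (rule recogI)
qed

lemma recog_one: "recog {W. length (filter P W) = Suc 0}"
proof -
  \<comment> \<open>Capped counting: 2 stands for "at least two", which is stable under addition and
    keeps the range finite.\<close>
  define f where "f W = min 2 (length (filter P W))" for W
  have "range f \<subseteq> {..2}" unfolding f_def by auto
  then have "finite (range f)" by (rule finite_subset) auto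
  moreover have "f (u @ v) = f (u' @ v')" if "f u = f u'" "f v = f v'" for u u' v v'
    using that unfolding f_def by auto
  ultimately have "fcong f" by (rule fcongI)
  moreover have "saturates f {W. length (filter P W) = Suc 0}"
    unfolding saturates_def f_def by (auto simp: min_def split: if_splits)
  ultimately show ?thesis by (rule recogI)
qed

section \<open>Quantification over single positions\<close>

definition mark :: "('x \<Rightarrow> bool \<Rightarrow> 'y) \<Rightarrow> nat \<Rightarrow> 'x list \<Rightarrow> 'y list" where
  "mark h j W = map (\<lambda>k. h (W ! k) (k = j)) [0..<length W]"

text \<open>A position is a Boolean track with exactly one \<open>True\<close>;
  \<open>recog_one\<close> recognizes such tracks and \<open>recog_ex_annot\<close> quantifies over
  them.\<close>

lemma recog_ex_mark:
  assumes "recog L"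
  shows "recog {W. \<exists>j<length W. mark h j W \<in> L}"
proof -
  have one: "(length (filter id ms) = Suc 0) \<longleftrightarrow> (\<exists>j<length ms. ms = map (\<lambda>k. k = j) [0..<length ms])"
    for ms :: "bool list"
  proof
    assume "length (filter id ms) = Suc 0"
    then have "card {i. i < length ms \<and> ms ! i} = Suc 0" by (simp add: length_filter_conv_card)
    then obtain j where "{i. i < length ms \<and> ms ! i} = {j}" by (auto simp: card_Suc_eq)
    then have "j < length ms" "\<And>i. i < length ms \<Longrightarrow> ms ! i \<longleftrightarrow> i = j" by blast+
    then show "\<exists>j<length ms. ms = map (\<lambda>k. k = j) [0..<length ms]"
      by (intro exI[of _ j] conjI nth_equalityI) simp_all
  next
    assume "\<exists>j<length ms. ms = map (\<lambda>k. k = j) [0..<length ms]"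
    then obtain j where j: "j < length ms" "ms = map (\<lambda>k. k = j) [0..<length ms]" by blast
    have "ms ! k \<longleftrightarrow> k = j" if "k < length ms" for k
      by (subst j(2)) (use that in simp)
    then have "{i. i < length ms \<and> ms ! i} = {j}" using j(1) by auto
    then show "length (filter id ms) = Suc 0" by (simp add: length_filter_conv_card)
  qed
  have "recog {W. length (filter snd W) = Suc 0 \<and> map (case_prod h) W \<in> L}"
    by (intro recog_conj recog_one recog_vimage assms)
  from recog_ex_annot[OF this]
  have "recog {W. \<exists>ms. length ms = length W \<and> length (filter snd (zip W ms)) = Suc 0 \<and>
    map (case_prod h) (zip W ms) \<in> L}" .
  moreover have "(\<exists>ms. length ms = length W \<and> length (filter snd (zip W ms)) = Suc 0 \<and>
    map (case_prod h) (zip W ms) \<in> L) \<longleftrightarrow> (\<exists>j<length W. mark h j W \<in> L)" for W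
  proof -
    have f: "length (filter snd (zip W ms)) = length (filter id ms)" if "length ms = length W" for ms
    proof -
      have "filter id (map snd (zip W ms)) = map snd (filter snd (zip W ms))"
        by (simp add: filter_map)
      then show ?thesis using that by (metis length_map map_snd_zip)
    qed
    have e: "map (case_prod h) (zip W (map (\<lambda>k. k = j) [0..<length W])) = mark h j W" for j
      unfolding mark_def by (auto intro!: nth_equalityI)
    show ?thesis (is "?l = ?r")
    proof
      assume ?l
      then obtain ms where ms: "length ms = length W" "length (filter id ms) = Suc 0"
        "map (case_prod h) (zip W ms) \<in> L" using f by auto
      then obtain j where "j < length ms" "ms = map (\<lambda>k. k = j) [0..<length ms]" using one by blast
      then show ?r using e ms by metis
    next
      assume ?r
      then obtain j where j: "j < length W" "mark h j W \<in> L" by blast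
      let ?ms = "map (\<lambda>k. k = j) [0..<length W]"
      have "length (filter id ?ms) = Suc 0" unfolding one using j(1) by (intro exI[of _ j]) simp
      then show ?l using j(2) f[of ?ms] e by (intro exI[of _ ?ms]) auto
    qed
  qed
  ultimately show ?thesis by simp
qed

section \<open>Lexicographic order on words of equal length\<close>

fun lexless :: "nat list \<Rightarrow> nat list \<Rightarrow> bool" where
  "lexless (x # xs) (y # ys) \<longleftrightarrow> x < y \<or> x = y \<and> lexless xs ys"
| "lexless _ _ \<longleftrightarrow> False"

lemma lexless_append:
  "length xs = length ys \<Longrightarrow>
    lexless (xs @ xs') (ys @ ys') \<longleftrightarrow> lexless xs ys \<or> xs = ys \<and> lexless xs' ys'"
  by (induction xs ys rule: list_induct2) auto

lemma lexless_total: "length xs = length ys \<Longrightarrow> lexless xs ys \<or> xs = ys \<or> lexless ys xs"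
  by (induction xs ys rule: list_induct2) auto

lemma lexless_lenlex: "length xs = length ys \<Longrightarrow> lexless xs ys \<longleftrightarrow> (xs, ys) \<in> lenlex less_than"
  by (induction xs ys rule: list_induct2) (auto simp: Cons_lenlex_iff)

text \<open>Plain lexicographic order is well-founded only when the length is fixed; there it agrees
  with the length-lexicographic order, whose well-foundedness is available.\<close>

lemma lexless_minimal:
  assumes "xs \<in> A" "length xs = n"
  obtains ys where "ys \<in> A" "length ys = n"
    "\<And>zs. zs \<in> A \<Longrightarrow> length zs = n \<Longrightarrow> \<not> lexless zs ys"
proof -
  have "wf (lenlex less_than)" by (simp add: wf_lenlex)
  then obtain ys where "ys \<in> {ys \<in> A. length ys = n}"
    "\<And>zs. (zs, ys) \<in> lenlex less_than \<Longrightarrow> zs \<notin> {ys \<in> A. length ys = n}"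
    using wfE_min[of "lenlex less_than" xs "{ys \<in> A. length ys = n}"] assms by blast
  then show thesis using that[of ys] lexless_lenlex by (metis (lifting) mem_Collect_eq)
qed

text \<open>By \<open>lexless_append\<close>, equality and strict order of the two tracks are all
  that has to be remembered, even though the letters are arbitrary numbers.\<close>

lemma recog_lexless: "recog {W. lexless (map fst W) (map snd W)}"
proof -
  define f where "f W = (map fst W = map snd W, lexless (map fst W) (map snd W))" for W :: "(nat \<times> nat) list"
  have "finite (range f)" by (rule finite_subset[OF subset_UNIV]) simp
  moreover have "f (u @ v) = f (u' @ v')" if "f u = f u'" "f v = f v'" for u u' v v'
    using that unfolding f_def by (simp add: lexless_append)
  ultimately have "fcong f" by (rule fcongI)
  moreover have "saturates f {W. lexless (map fst W) (map snd W)}"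
    unfolding saturates_def f_def by simp
  ultimately show ?thesis by (rule recogI)
qed

section \<open>Regularity of MSO on string graphs\<close>

definition setN :: "nat \<Rightarrow> 'a \<times> nat set \<times> nat set \<Rightarrow> bool \<Rightarrow> 'a \<times> nat set \<times> nat set" where
  "setN x l b = (case l of (a, N, S) \<Rightarrow> (a, if b then insert x N else N - {x}, S))"

definition setS :: "nat \<Rightarrow> 'a \<times> nat set \<times> nat set \<Rightarrow> bool \<Rightarrow> 'a \<times> nat set \<times> nat set" where
  "setS X l b = (case l of (a, N, S) \<Rightarrow> (a, N, if b then insert X S else S - {X}))"

text \<open>A letter describes a node: the label of its outgoing edge (\<open>None\<close> at the
  last node), the node variables placed there, and the set variables containing it. There is only
  one node label, hence the trivial label test. The edge language is a complement because
  \<open>successively\<close> is universal over neighbours while the atom claims that one pair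
  exists.\<close>

fun lang :: "(unit, 'a) mso \<Rightarrow> ('a option \<times> nat set \<times> nat set) list set" where
  "lang (FLab \<sigma> x) = {W. True}"
| "lang (FEdge \<gamma> x y) = {W. \<not> successively
     (\<lambda>l l'. \<not> (fst l = Some \<gamma> \<and> x \<in> fst (snd l) \<and> y \<in> fst (snd l'))) W}"
| "lang (FEq x y) = {W. \<exists>l\<in>set W. x \<in> fst (snd l) \<and> y \<in> fst (snd l)}"
| "lang (FIn x X) = {W. \<exists>l\<in>set W. x \<in> fst (snd l) \<and> X \<in> snd (snd l)}"
| "lang (FNot \<phi>) = {W. \<not> W \<in> lang \<phi>}"
| "lang (FAnd \<phi> \<psi>) = {W. W \<in> lang \<phi> \<and> W \<in> lang \<psi>}"
| "lang (FExN x \<phi>) = {W. \<exists>j<length W. mark (setN x) j W \<in> lang \<phi>}"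
| "lang (FExS X \<phi>) =
     {W. \<exists>ms. length ms = length W \<and> map (case_prod (setS X)) (zip W ms) \<in> lang \<phi>}"

lemma recog_lang: "recog (lang \<phi>)"
proof (induction \<phi>)
  case (FLab \<sigma> x)
  show ?case unfolding lang.simps by (rule recog_const)
next
  case (FEdge \<gamma> x y)
  have "recog {W. successively
     (\<lambda>l l'. \<not> (fst l = Some \<gamma> \<and> x \<in> fst (snd l) \<and> y \<in> fst (snd l'))) W}"
    by (rule recog_successively[where Q' = "\<lambda>a b. \<not> (a \<and> b)"
          and l = "\<lambda>l. fst l = Some \<gamma> \<and> x \<in> fst (snd l)" and r = "\<lambda>l. y \<in> fst (snd l)"])
      (auto intro: finite_subset[OF subset_UNIV])
  then show ?case unfolding lang.simps by (rule recog_Not)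
next
  case (FExS X \<phi>)
  have "recog {W. map (case_prod (setS X)) W \<in> lang \<phi>}" by (rule recog_vimage[OF FExS])
  from recog_ex_annot[OF this] show ?case by simp
qed (simp_all add: recog_const recog_ex_letter recog_Not recog_conj recog_ex_mark)

definition node_word :: "'a list \<Rightarrow> 'a option list" where
  "node_word w = map Some w @ [None]"

lemma length_node_word [simp]: "length (node_word w) = Suc (length w)"
  by (simp add: node_word_def)

lemma nth_node_word: "k \<le> length w \<Longrightarrow> node_word w ! k = (if k < length w then Some (w ! k) else None)"
  by (auto simp: node_word_def nth_append)

definition enc :: "'a list \<Rightarrow> (nat \<Rightarrow> nat) \<Rightarrow> (nat \<Rightarrow> nat set) \<Rightarrow> ('a option \<times> nat set \<times> nat set) list" where
  "enc w nv sv = map (\<lambda>k. (node_word w ! k, {x. nv x = k}, {X. k \<in> sv X})) [0..<Suc (length w)]"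

lemma length_enc [simp]: "length (enc w nv sv) = Suc (length w)"
  by (simp add: enc_def)

lemma nth_enc: "k \<le> length w \<Longrightarrow> enc w nv sv ! k = (node_word w ! k, {x. nv x = k}, {X. k \<in> sv X})"
  by (simp add: enc_def del: upt_Suc)

lemma set_enc:
  "set (enc w nv sv) = (\<lambda>k. (node_word w ! k, {x. nv x = k}, {X. k \<in> sv X})) ` {..length w}"
  by (simp add: enc_def atLeast0LessThan lessThan_Suc_atMost del: upt_Suc)

lemma mark_enc: "mark (setN x) j (enc w nv sv) = enc w (nv(x := j)) sv"
  unfolding mark_def by (rule nth_equalityI) (auto simp: nth_enc setN_def simp del: upt_Suc)

lemma annot_enc:
  assumes "length ms = Suc (length w)"
  shows "map (case_prod (setS X)) (zip (enc w nv sv) ms)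
    = enc w nv (sv(X := {k. k \<le> length w \<and> ms ! k}))"
  by (rule nth_equalityI) (use assms in \<open>auto simp: nth_enc setS_def\<close>)

lemma successively_nth:
  "successively P xs \<longleftrightarrow> (\<forall>i. Suc i < length xs \<longrightarrow> P (xs ! i) (xs ! Suc i))"
  by (simp add: successively_conv_nth)

text \<open>Quantifiers match operations on encodings: a node quantifier moves one variable
  (\<open>mark_enc\<close>), a set quantifier re-annotates all positions (\<open>annot_enc\<close>).
  Every node variable occupies exactly one position, which makes the atoms existential statements
  about letters.\<close>

lemma sat_ed:
  assumes "\<And>x. nv x \<le> length w"
  shows "sat (ed w) nv sv \<phi> \<longleftrightarrow> enc w nv sv \<in> lang \<phi>"
  using assms
proof (induction \<phi> arbitrary: nv sv)
  case (FEdge \<gamma> x y)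
  then show ?case
    by (auto simp: ed_def successively_nth nth_enc nth_node_word)
next
  case (FEq x y)
  then show ?case by (auto simp: set_enc)
next
  case (FIn x X)
  then show ?case by (auto simp: set_enc)
next
  case (FExN x \<phi>)
  have "sat (ed w) (nv(x := u)) sv \<phi> \<longleftrightarrow> mark (setN x) u (enc w nv sv) \<in> lang \<phi>" if "u \<le> length w" for u
    unfolding mark_enc by (rule FExN.IH) (use FExN.prems that in auto)
  then show ?case by (auto simp: ed_def less_Suc_eq_le)
next
  case (FExS X \<phi>)
  have IH: "sat (ed w) nv sv' \<phi> \<longleftrightarrow> enc w nv sv' \<in> lang \<phi>" for sv'
    by (rule FExS.IH[OF FExS.prems])
  show ?case (is "?l \<longleftrightarrow> ?r")
  proof
    assume ?l
    then obtain U where U: "U \<subseteq> {0..length w}" "enc w nv (sv(X := U)) \<in> lang \<phi>"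
      unfolding sat.simps IH by (auto simp: ed_def)
    let ?ms = "map (\<lambda>k. k \<in> U) [0..<Suc (length w)]"
    have "{k. k \<le> length w \<and> ?ms ! k} = U" using U(1) by (auto simp del: upt_Suc)
    then show ?r using U(2) annot_enc[of ?ms w X nv sv] by (auto intro!: exI[of _ ?ms] simp del: upt_Suc)
  next
    assume ?r
    then obtain ms where "length ms = Suc (length w)"
      "map (case_prod (setS X)) (zip (enc w nv sv) ms) \<in> lang \<phi>" by auto
    then have "{k. k \<le> length w \<and> ms ! k} \<subseteq> verts (ed w)"
      "sat (ed w) nv (sv(X := {k. k \<le> length w \<and> ms ! k})) \<phi>"
      unfolding IH by (auto simp: annot_enc ed_def)
    then show ?l by auto
  qed
qed (auto simp: ed_def)

definition marked :: "'x list \<Rightarrow> nat \<Rightarrow> nat \<Rightarrow> ('x \<times> bool \<times> bool) list" where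
  "marked W i j = map (\<lambda>k. (W ! k, k = i, k = j)) [0..<length W]"

lemma length_marked [simp]: "length (marked W i j) = length W"
  by (simp add: marked_def)

lemma nth_marked [simp]: "k < length W \<Longrightarrow> marked W i j ! k = (W ! k, k = i, k = j)"
  by (simp add: marked_def)

lemma recog_formula:
  fixes \<phi> :: "(unit, 'a) mso"
  obtains L where "recog L"
    "\<And>w u v. u \<le> length w \<Longrightarrow> v \<le> length w \<Longrightarrow>
      sat2 (ed w) \<phi> u v \<longleftrightarrow> marked (node_word w) u v \<in> L"
proof
  \<comment> \<open>In \<open>sat2\<close> all node variables except 1 have the value
    \<open>u\<close>, so the first mark is translated into the whole set
    \<open>- {1}\<close>.\<close>
  define h :: "'a option \<times> bool \<times> bool \<Rightarrow> 'a option \<times> nat set \<times> nat set"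
    where "h = (\<lambda>(a, b1, b2). (a, (if b1 then - {1} else {}) \<union> (if b2 then {1} else {}), {}))"
  show "recog {W. map h W \<in> lang \<phi>}" by (rule recog_vimage[OF recog_lang])
  fix w :: "'a list" and u v assume uv: "u \<le> length w" "v \<le> length w"
  have "map h (marked (node_word w) u v) = enc w ((\<lambda>_. u)(1 := v)) (\<lambda>_. {})"
    by (rule nth_equalityI) (auto simp: nth_enc h_def)
  then show "sat2 (ed w) \<phi> u v \<longleftrightarrow> marked (node_word w) u v \<in> {W. map h W \<in> lang \<phi>}"
    unfolding sat2_def using sat_ed[of "(\<lambda>_. u)(1 := v)" w] uv by simp
qed

section \<open>Invariance of MSO under isomorphism\<close>

lemma sat_cong:
  assumes "\<And>x. x \<in> fvN \<phi> \<Longrightarrow> nv x = nv' x" "\<And>X. X \<in> fvS \<phi> \<Longrightarrow> sv X = sv' X"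
  shows "sat G nv sv \<phi> \<longleftrightarrow> sat G nv' sv' \<phi>"
  using assms
proof (induction \<phi> arbitrary: nv nv' sv sv')
  case (FNot \<phi>)
  have "sat G nv sv \<phi> \<longleftrightarrow> sat G nv' sv' \<phi>"
    by (rule FNot.IH) (use FNot.prems in auto)
  then show ?case by simp
next
  case (FAnd \<phi>1 \<phi>2)
  have "sat G nv sv \<phi>1 \<longleftrightarrow> sat G nv' sv' \<phi>1"
    by (rule FAnd.IH(1)) (use FAnd.prems in auto)
  moreover have "sat G nv sv \<phi>2 \<longleftrightarrow> sat G nv' sv' \<phi>2"
    by (rule FAnd.IH(2)) (use FAnd.prems in auto)
  ultimately show ?case by simp
next
  case (FExN x \<phi>)
  have "sat G (nv(x := u)) sv \<phi> \<longleftrightarrow> sat G (nv'(x := u)) sv' \<phi>" for u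
    by (rule FExN.IH) (use FExN.prems in auto)
  then show ?case by simp
next
  case (FExS X \<phi>)
  have "sat G nv (sv(X := U)) \<phi> \<longleftrightarrow> sat G nv' (sv'(X := U)) \<phi>" for U
    by (rule FExS.IH) (use FExS.prems in auto)
  then show ?case by simp
qed auto

definition iso_by :: "('v \<Rightarrow> 'w) \<Rightarrow> ('v,'l,'g) graph \<Rightarrow> ('w,'l,'g) graph \<Rightarrow> bool" where
  "iso_by f G H \<longleftrightarrow> bij_betw f (verts G) (verts H)
      \<and> (\<forall>u\<in>verts G. \<forall>v\<in>verts G. \<forall>\<gamma>. (u,\<gamma>,v) \<in> edges G \<longleftrightarrow> (f u,\<gamma>,f v) \<in> edges H)
      \<and> (\<forall>u\<in>verts G. lab H (f u) = lab G u)"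

lemma graph_iso_iff: "graph_iso G H \<longleftrightarrow> (\<exists>f. iso_by f G H)"
  unfolding graph_iso_def iso_by_def by simp

lemma graph_iso_sym:
  assumes "graph_iso G H"
  shows "graph_iso H G"
proof -
  obtain f where f: "iso_by f G H" using assms graph_iso_iff by blast
  define g where "g = the_inv_into (verts G) f"
  have bij: "bij_betw f (verts G) (verts H)" using f unfolding iso_by_def by simp
  have g: "bij_betw g (verts H) (verts G)"
    unfolding g_def by (rule bij_betw_the_inv_into[OF bij])
  have fg: "f (g v) = v" "g v \<in> verts G" if "v \<in> verts H" for v
    using that bij g unfolding g_def
    by (auto simp: bij_betw_def f_the_inv_into_f)
  have "iso_by g H G" unfolding iso_by_def
    using g f fg unfolding iso_by_def by metis
  then show ?thesis using graph_iso_iff by blast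
qed

lemma graph_iso_trans:
  assumes "graph_iso G H" "graph_iso H K"
  shows "graph_iso G K"
proof -
  obtain f g where fg: "iso_by f G H" "iso_by g H K"
    using assms unfolding graph_iso_iff by blast
  have "f u \<in> verts H" if "u \<in> verts G" for u
    using fg(1) that unfolding iso_by_def bij_betw_def by blast
  then have "iso_by (g \<circ> f) G K"
    using fg bij_betw_trans unfolding iso_by_def by auto
  then show ?thesis using graph_iso_iff by blast
qed

lemma sat_iso:
  assumes "iso_by f G H" "\<And>x. x \<in> fvN \<phi> \<Longrightarrow> nv x \<in> verts G" "\<And>X. X \<in> fvS \<phi> \<Longrightarrow> sv X \<subseteq> verts G"
  shows "sat G nv sv \<phi> \<longleftrightarrow> sat H (f \<circ> nv) (\<lambda>X. f ` sv X) \<phi>"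
  using assms(2,3)
proof (induction \<phi> arbitrary: nv sv)
  case (FLab l x)
  then show ?case using assms(1) by (auto simp: iso_by_def)
next
  case (FEdge g x y)
  then show ?case using assms(1) by (auto simp: iso_by_def)
next
  case (FEq x y)
  then show ?case using assms(1) by (auto simp: iso_by_def bij_betw_def inj_on_def)
next
  case (FIn x X)
  then show ?case using assms(1) by (auto simp: iso_by_def bij_betw_def inj_on_def)
next
  case (FExN x \<phi>)
  have im: "f ` verts G = verts H" using assms(1) by (auto simp: iso_by_def bij_betw_def)
  have "sat G (nv(x := u)) sv \<phi> \<longleftrightarrow> sat H (f \<circ> (nv(x := u))) (\<lambda>X. f ` sv X) \<phi>"
    if "u \<in> verts G" for u
    by (rule FExN.IH) (use FExN.prems that in auto)
  then have "sat G nv sv (FExN x \<phi>) \<longleftrightarrow>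
      (\<exists>u\<in>verts G. sat H ((f \<circ> nv)(x := f u)) (\<lambda>X. f ` sv X) \<phi>)" by (simp add: fun_upd_comp)
  also have "\<dots> \<longleftrightarrow> (\<exists>v\<in>f ` verts G. sat H ((f \<circ> nv)(x := v)) (\<lambda>X. f ` sv X) \<phi>)" by blast
  finally show ?case unfolding im by (simp add: comp_def)
next
  case (FExS X \<phi>)
  have im: "f ` verts G = verts H" using assms(1) by (auto simp: iso_by_def bij_betw_def)
  have "sat G nv (sv(X := U)) \<phi> \<longleftrightarrow> sat H (f \<circ> nv) (\<lambda>Y. f ` (sv(X := U)) Y) \<phi>"
    if "U \<subseteq> verts G" for U
    by (rule FExS.IH) (use FExS.prems that in auto)
  moreover have "(\<lambda>Y. f ` (sv(X := U)) Y) = (\<lambda>Y. f ` sv Y)(X := f ` U)" for U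
    by (rule ext) simp
  ultimately have "sat G nv sv (FExS X \<phi>) \<longleftrightarrow>
      (\<exists>U. U \<subseteq> verts G \<and> sat H (f \<circ> nv) ((\<lambda>Y. f ` sv Y)(X := f ` U)) \<phi>)" by auto
  also have "\<dots> \<longleftrightarrow> sat H (f \<circ> nv) (\<lambda>X. f ` sv X) (FExS X \<phi>)"
    unfolding sat.simps im[symmetric] by (metis subset_image_iff)
  finally show ?case .
qed auto

lemma sat1_iso:
  assumes "iso_by f G H" "fvN \<phi> \<subseteq> {0}" "fvS \<phi> = {}" "u \<in> verts G"
  shows "sat1 H \<phi> (f u) \<longleftrightarrow> sat1 G \<phi> u"
  using sat_iso[OF assms(1), of \<phi> "\<lambda>_. u" "\<lambda>_. {}"] assms(2-4) by (simp add: sat1_def comp_def)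

lemma sat2_iso:
  assumes "iso_by f G H" "fvS \<phi> = {}" "u \<in> verts G" "v \<in> verts G"
  shows "sat2 H \<phi> (f u) (f v) \<longleftrightarrow> sat2 G \<phi> u v"
  using sat_iso[OF assms(1), of \<phi> "(\<lambda>_. u)(1 := v)" "\<lambda>_. {}"] assms(2-4)
  by (simp add: sat2_def fun_upd_comp) (simp add: comp_def)

lemma sat_closed_iso:
  assumes "graph_iso G H" "fvN \<phi> = {}" "fvS \<phi> = {}"
  shows "sat H nv sv \<phi> \<longleftrightarrow> sat G nv' sv' \<phi>"
proof -
  obtain f where "iso_by f G H" using assms(1) graph_iso_iff by blast
  then have "sat G nv' sv' \<phi> \<longleftrightarrow> sat H (f \<circ> nv') (\<lambda>X. f ` sv' X) \<phi>"
    by (rule sat_iso) (simp_all add: assms)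
  also have "\<dots> \<longleftrightarrow> sat H nv sv \<phi>" by (rule sat_cong) (simp_all add: assms)
  finally show ?thesis by simp
qed

text \<open>Edges force \<open>f (Suc i) = Suc (f i)\<close>, so \<open>f\<close> is a shift by
  \<open>f 0\<close>. Both paths have equally many nodes, hence the shift is 0 and the labels agree
  position by position.\<close>

lemma ed_iso_inj:
  assumes "graph_iso (ed w) (ed z)"
  shows "w = z"
proof -
  obtain f where f: "iso_by f (ed w) (ed z)" using assms graph_iso_iff by blast
  have bij: "bij_betw f {0..length w} {0..length z}" using f by (simp add: iso_by_def ed_def)
  have len: "length w = length z" using bij_betw_same_card[OF bij] by simp
  have E0: "(u, \<gamma>, v) \<in> edges (ed w) \<longleftrightarrow> (f u, \<gamma>, f v) \<in> edges (ed z)"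
    if "u \<in> verts (ed w)" "v \<in> verts (ed w)" for u v \<gamma>
    using f that unfolding iso_by_def by blast
  have E: "(\<exists>i<length w. u = i \<and> \<gamma> = w ! i \<and> v = Suc i) \<longleftrightarrow>
      (\<exists>i<length w. f u = i \<and> \<gamma> = z ! i \<and> f v = Suc i)"
    if "u \<le> length w" "v \<le> length w" for u v \<gamma>
    using E0[of u v \<gamma>] that len by (simp add: ed_def conj_commute conj_left_commute)
  have step: "f (Suc i) = Suc (f i) \<and> w ! i = z ! f i" if "i < length w" for i
    using E[of i "Suc i" "w ! i"] that by auto
  have fi: "f i = f 0 + i" if "i \<le> length w" for i
    using that by (induction i) (use step in auto)
  have "f (length w) \<le> length w" using bij_betwE[OF bij] len by simp
  then have "f 0 = 0" using fi[of "length w"] by simp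
  then have "w ! i = z ! i" if "i < length w" for i
    using step[OF that] fi[of i] that by simp
  then show ?thesis using len by (simp add: list_eq_iff_nth_eq)
qed

text \<open>The output of a transduction lives on pairs of a node and a copy, whereas
  \<open>MSO_ed\<close> speaks about graphs on numbers. Transport along \<open>f\<close> on nodes,
  with copies fixed, allows an intermediate graph to be replaced by the isomorphic
  \<open>ed b\<close>.\<close>

lemma apply_msot_iso:
  assumes "wf_msot T" "graph_iso G G'" "apply_msot T G = Some H"
  obtains H' where "apply_msot T G' = Some H'" "graph_iso H H'"
proof -
  obtain f where f: "iso_by f G G'" using assms(2) graph_iso_iff by blast
  have cl: "fvN (tdom T) = {}" "fvS (tdom T) = {}" using assms(1) by (auto simp: wf_msot_def)
  from assms(3) have "sat G (\<lambda>_. undefined) (\<lambda>_. {}) (tdom T)"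
    by (auto simp: apply_msot_def split: if_splits)
  then have dom: "sat G' (\<lambda>_. undefined) (\<lambda>_. {}) (tdom T)"
    using sat_closed_iso[OF assms(2) cl] by blast
  then obtain H' where H': "apply_msot T G' = Some H'" by (simp add: apply_msot_def)
  define F where "F = map_prod f (id :: 'c \<Rightarrow> 'c)"
  have bij: "bij_betw f (verts G) (verts G')" using f by (simp add: iso_by_def)
  have s1: "sat1 G' (tnode T c \<sigma>) (f u) \<longleftrightarrow> sat1 G (tnode T c \<sigma>) u" if "u \<in> verts G" for u c \<sigma>
    by (rule sat1_iso[OF f]) (use assms(1) that in \<open>auto simp: wf_msot_def\<close>)
  have s2: "sat2 G' (tedge T c c' \<gamma>) (f u) (f v) \<longleftrightarrow> sat2 G (tedge T c c' \<gamma>) u v"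
    if "u \<in> verts G" "v \<in> verts G" for u v c c' \<gamma>
    by (rule sat2_iso[OF f]) (use assms(1) that in \<open>auto simp: wf_msot_def\<close>)
  have ov: "(f u, c) \<in> out_verts T G' \<longleftrightarrow> (u, c) \<in> out_verts T G" if "u \<in> verts G" for u c
    using that s1 bij_betwE[OF bij] by (auto simp: out_verts_def)
  have sub: "(u, c) \<in> out_verts T G \<Longrightarrow> u \<in> verts G" for u c
    by (auto simp: out_verts_def)
  have sub': "(u, c) \<in> out_verts T G' \<Longrightarrow> u \<in> verts G'" for u c
    by (auto simp: out_verts_def)
  have "bij_betw F (out_verts T G) (out_verts T G')"
  proof (rule bij_betw_imageI)
    show "inj_on F (out_verts T G)"
      using bij sub unfolding F_def inj_on_def bij_betw_def by force
    show "F ` out_verts T G = out_verts T G'"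
    proof (intro equalityI subsetI)
      fix p assume "p \<in> F ` out_verts T G"
      then show "p \<in> out_verts T G'" using ov sub unfolding F_def by force
    next
      fix p assume p: "p \<in> out_verts T G'"
      obtain v c where pv: "p = (v, c)" by fastforce
      then have "v \<in> verts G'" using p sub' by auto
      then obtain u where "u \<in> verts G" "v = f u" using bij by (auto simp: bij_betw_def)
      then show "p \<in> F ` out_verts T G" using p pv ov
        unfolding F_def by (auto intro!: image_eqI[of _ _ "(u, c)"])
    qed
  qed
  moreover have "verts H = out_verts T G" "verts H' = out_verts T G'"
    and "edges H = {((u,c1),\<gamma>,(v,c2)). (u,c1) \<in> out_verts T G \<and> (v,c2) \<in> out_verts T G
           \<and> \<gamma> \<in> telabs T \<and> sat2 G (tedge T c1 c2 \<gamma>) u v}"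
    and "edges H' = {((u,c1),\<gamma>,(v,c2)). (u,c1) \<in> out_verts T G' \<and> (v,c2) \<in> out_verts T G'
           \<and> \<gamma> \<in> telabs T \<and> sat2 G' (tedge T c1 c2 \<gamma>) u v}"
    and "lab H = (\<lambda>(u,c). THE \<sigma>. \<sigma> \<in> tnlabs T \<and> sat1 G (tnode T c \<sigma>) u)"
    and "lab H' = (\<lambda>(u,c). THE \<sigma>. \<sigma> \<in> tnlabs T \<and> sat1 G' (tnode T c \<sigma>) u)"
    using assms(3) H' by (auto simp: apply_msot_def split: if_splits)
  ultimately have "iso_by F H H'"
    using s1 s2 ov sub unfolding iso_by_def F_def by (auto 0 3 dest: sub)
  then show thesis using that H' graph_iso_iff by blast
qed

section \<open>Composition of MSO definable string transductions\<close>

definition FFalse :: "('l,'g) mso" where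
  "FFalse = FExN 0 (FNot (FEq 0 0))"

lemma sat_FFalse [simp]: "\<not> sat G nv sv FFalse"
  by (simp add: FFalse_def)

lemma fv_FFalse [simp]: "fvN FFalse = {}" "fvS FFalse = {}"
  by (auto simp: FFalse_def)

definition FOr :: "('l,'g) mso \<Rightarrow> ('l,'g) mso \<Rightarrow> ('l,'g) mso" where
  "FOr \<phi> \<psi> = FNot (FAnd (FNot \<phi>) (FNot \<psi>))"

lemma sat_FOr [simp]: "sat G nv sv (FOr \<phi> \<psi>) \<longleftrightarrow> sat G nv sv \<phi> \<or> sat G nv sv \<psi>"
  by (simp add: FOr_def)

lemma fv_FOr [simp]: "fvN (FOr \<phi> \<psi>) = fvN \<phi> \<union> fvN \<psi>" "fvS (FOr \<phi> \<psi>) = fvS \<phi> \<union> fvS \<psi>"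
  by (auto simp: FOr_def)

fun FOrs :: "('l,'g) mso list \<Rightarrow> ('l,'g) mso" where
  "FOrs [] = FFalse"
| "FOrs (\<phi> # \<phi>s) = FOr \<phi> (FOrs \<phi>s)"

lemma sat_FOrs [simp]: "sat G nv sv (FOrs \<phi>s) \<longleftrightarrow> (\<exists>\<phi>\<in>set \<phi>s. sat G nv sv \<phi>)"
  by (induction \<phi>s) auto

lemma fv_FOrs [simp]: "fvN (FOrs \<phi>s) = \<Union> (fvN ` set \<phi>s)" "fvS (FOrs \<phi>s) = \<Union> (fvS ` set \<phi>s)"
  by (induction \<phi>s) auto

fun FExSs :: "nat list \<Rightarrow> ('l,'g) mso \<Rightarrow> ('l,'g) mso" where
  "FExSs [] \<phi> = \<phi>"
| "FExSs (X # Xs) \<phi> = FExS X (FExSs Xs \<phi>)"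

lemma fv_FExSs [simp]: "fvN (FExSs Xs \<phi>) = fvN \<phi>" "fvS (FExSs Xs \<phi>) = fvS \<phi> - set Xs"
  by (induction Xs) auto

text \<open>Viewing a block of set quantifiers as the choice of one assignment removes any
  dependence on the order of the variables.\<close>

lemma sat_FExSs:
  "sat G nv sv (FExSs Xs \<phi>) \<longleftrightarrow>
    (\<exists>sv'. (\<forall>X. X \<in> set Xs \<longrightarrow> sv' X \<subseteq> verts G) \<and> (\<forall>X. X \<notin> set Xs \<longrightarrow> sv' X = sv X) \<and> sat G nv sv' \<phi>)"
proof (induction Xs arbitrary: sv)
  case Nil
  have "(\<forall>X. sv' X = sv X) \<longleftrightarrow> sv' = sv" for sv' by auto
  then show ?case by simp
next
  case (Cons X Xs)
  show ?case (is "?l \<longleftrightarrow> ?r")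
  proof
    assume ?l
    then obtain U where U: "U \<subseteq> verts G" "sat G nv (sv(X := U)) (FExSs Xs \<phi>)" by auto
    from U(2)[unfolded Cons.IH] obtain sv' where sv': "\<forall>Y. Y \<in> set Xs \<longrightarrow> sv' Y \<subseteq> verts G"
      "\<forall>Y. Y \<notin> set Xs \<longrightarrow> sv' Y = (sv(X := U)) Y" "sat G nv sv' \<phi>"
      by (elim exE conjE) (rule that)
    have "sv' X \<subseteq> verts G"
      using sv'(1)[rule_format, of X] sv'(2)[rule_format, of X] U(1) by (cases "X \<in> set Xs") simp_all
    moreover have "sv' Y = sv Y" if "Y \<notin> set (X # Xs)" for Y
      using that sv'(2) by simp
    ultimately have "(\<forall>Y. Y \<in> set (X # Xs) \<longrightarrow> sv' Y \<subseteq> verts G) \<and>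
        (\<forall>Y. Y \<notin> set (X # Xs) \<longrightarrow> sv' Y = sv Y) \<and> sat G nv sv' \<phi>"
      using sv'(1,3) by simp
    then show ?r by blast
  next
    assume ?r
    then obtain sv' where sv': "\<forall>Y. Y \<in> set (X # Xs) \<longrightarrow> sv' Y \<subseteq> verts G"
      "\<forall>Y. Y \<notin> set (X # Xs) \<longrightarrow> sv' Y = sv Y" "sat G nv sv' \<phi>" by blast
    have "sat G nv (sv(X := sv' X)) (FExSs Xs \<phi>)"
      unfolding Cons.IH using sv' by (intro exI[of _ sv'] conjI allI impI) simp_all
    then show ?l using sv'(1) by auto
  qed
qed

text \<open>Substitution without renaming: variable 0 is bound again and equated with
  \<open>x\<close>. This is correct only if \<open>x\<close> is not captured by the new binder,
  which is why translated variables start at 2.\<close>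

definition sub1 :: "('l,'g) mso \<Rightarrow> nat \<Rightarrow> ('l,'g) mso" where
  "sub1 \<psi> x = FExN 0 (FAnd (FEq 0 x) \<psi>)"

definition sub2 :: "('l,'g) mso \<Rightarrow> nat \<Rightarrow> nat \<Rightarrow> ('l,'g) mso" where
  "sub2 \<psi> x y = FExN 0 (FExN 1 (FAnd (FEq 0 x) (FAnd (FEq 1 y) \<psi>)))"

lemma sat_sub1:
  assumes "fvN \<psi> \<subseteq> {0}" "fvS \<psi> = {}" "0 < x" "nv x \<in> verts G"
  shows "sat G nv sv (sub1 \<psi> x) \<longleftrightarrow> sat1 G \<psi> (nv x)"
proof -
  have "sat G (nv(0 := nv x)) sv \<psi> \<longleftrightarrow> sat1 G \<psi> (nv x)"
    unfolding sat1_def by (rule sat_cong) (use assms in auto)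
  then show ?thesis using assms(3,4) by (auto simp: sub1_def)
qed

lemma sat_sub2:
  assumes "fvN \<psi> \<subseteq> {0, 1}" "fvS \<psi> = {}" "1 < x" "1 < y" "nv x \<in> verts G" "nv y \<in> verts G"
  shows "sat G nv sv (sub2 \<psi> x y) \<longleftrightarrow> sat2 G \<psi> (nv x) (nv y)"
proof -
  have "sat G (nv(0 := nv x, 1 := nv y)) sv \<psi> \<longleftrightarrow> sat2 G \<psi> (nv x) (nv y)"
    unfolding sat2_def by (rule sat_cong) (use assms in auto)
  then show ?thesis using assms(3-) by (auto simp: sub2_def)
qed

text \<open>A node variable \<open>x\<close> of the output graph becomes \<open>x + 2\<close> together with its copy \<open>\<kappa> x\<close>;
  the variables 0 and 1 stay reserved for the formulas of the transduction. A set variable \<open>X\<close>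
  becomes one set variable per copy.\<close>
fun backward :: "(unit,'a,nat,unit,'b) msot \<Rightarrow> (nat \<Rightarrow> nat) \<Rightarrow> (unit,'b) mso \<Rightarrow> (unit,'a) mso" where
  "backward T \<kappa> (FLab \<sigma> x) = FNot FFalse"
| "backward T \<kappa> (FEdge \<gamma> x y) =
     (if \<gamma> \<in> telabs T then sub2 (tedge T (\<kappa> x) (\<kappa> y) \<gamma>) (x + 2) (y + 2) else FFalse)"
| "backward T \<kappa> (FEq x y) = (if \<kappa> x = \<kappa> y then FEq (x + 2) (y + 2) else FFalse)"
| "backward T \<kappa> (FIn x X) = FIn (x + 2) (prod_encode (X, \<kappa> x))"
| "backward T \<kappa> (FNot \<phi>) = FNot (backward T \<kappa> \<phi>)"
| "backward T \<kappa> (FAnd \<phi> \<psi>) = FAnd (backward T \<kappa> \<phi>) (backward T \<kappa> \<psi>)"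
| "backward T \<kappa> (FExN x \<phi>) = FOrs (map (\<lambda>c. FExN (x + 2)
     (FAnd (sub1 (tnode T c ()) (x + 2)) (backward T (\<kappa>(x := c)) \<phi>))) (sorted_list_of_set (tcopies T)))"
| "backward T \<kappa> (FExS X \<phi>) =
     FExSs (map (\<lambda>c. prod_encode (X, c)) (sorted_list_of_set (tcopies T))) (backward T \<kappa> \<phi>)"

lemma fvN_backward:
  assumes "wf_msot T"
  shows "fvN (backward T \<kappa> \<phi>) \<subseteq> (\<lambda>x. x + 2) ` fvN \<phi>"
proof (induction \<phi> arbitrary: \<kappa>)
  case (FEdge \<gamma> x y)
  have "fvN (tedge T (\<kappa> x) (\<kappa> y) \<gamma>) \<subseteq> {0, 1}" using assms by (auto simp: wf_msot_def)
  then show ?case by (auto simp: sub2_def)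
next
  case (FExN x \<phi>)
  have "fvN (tnode T c ()) \<subseteq> {0}" for c using assms by (auto simp: wf_msot_def)
  then have "fvN (sub1 (tnode T c ()) (x + 2)) \<subseteq> {x + 2}" for c by (auto simp: sub1_def)
  then show ?case using FExN by fastforce
next
  case (FAnd \<phi>1 \<phi>2)
  then show ?case by (simp add: image_Un) blast
qed auto

text \<open>If \<open>\<kappa>\<close> sends free node variables to actual copies, membership atoms
  mention only codes of actual copies, and those are precisely the codes bound in the translation of
  a set quantifier. Hence formulas without free set variables stay so.\<close>

lemma fvS_backward:
  assumes "wf_msot T" "\<kappa> ` fvN \<phi> \<subseteq> tcopies T"
  shows "fvS (backward T \<kappa> \<phi>) \<subseteq> {prod_encode (X, c) | X c. X \<in> fvS \<phi> \<and> c \<in> tcopies T}"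
  using assms(2)
proof (induction \<phi> arbitrary: \<kappa>)
  case (FEdge \<gamma> x y)
  have "fvS (tedge T (\<kappa> x) (\<kappa> y) \<gamma>) = {}" using assms by (auto simp: wf_msot_def)
  then show ?case by (auto simp: sub2_def)
next
  case (FAnd \<phi>1 \<phi>2)
  have "\<kappa> ` fvN \<phi>1 \<subseteq> tcopies T" "\<kappa> ` fvN \<phi>2 \<subseteq> tcopies T" using FAnd.prems by auto
  from FAnd.IH(1)[OF this(1)] FAnd.IH(2)[OF this(2)] show ?case unfolding backward.simps fvS.simps by blast
next
  case (FExN x \<phi>)
  have fin: "finite (tcopies T)" using assms by (auto simp: wf_msot_def)
  have "fvS (sub1 (tnode T c ()) (x + 2)) = {}" for c
    using assms by (auto simp: wf_msot_def sub1_def)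
  moreover have "fvS (backward T (\<kappa>(x := c)) \<phi>) \<subseteq> {prod_encode (X, c) | X c. X \<in> fvS \<phi> \<and> c \<in> tcopies T}"
    if "c \<in> tcopies T" for c
    by (rule FExN.IH) (use FExN.prems that in auto)
  ultimately have "fvS (FAnd (sub1 (tnode T c ()) (x + 2)) (backward T (\<kappa>(x := c)) \<phi>))
      \<subseteq> {prod_encode (X, c) | X c. X \<in> fvS \<phi> \<and> c \<in> tcopies T}" if "c \<in> tcopies T" for c
    using that by simp
  then show ?case using fin unfolding backward.simps fv_FOrs by (simp add: UN_subset_iff)
next
  case (FExS X \<phi>)
  have fin: "finite (tcopies T)" using assms by (auto simp: wf_msot_def)
  have sub: "fvS (backward T \<kappa> \<phi>) \<subseteq> {prod_encode (X, c) | X c. X \<in> fvS \<phi> \<and> c \<in> tcopies T}"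
    by (rule FExS.IH) (use FExS.prems in auto)
  show ?case
  proof
    fix x assume "x \<in> fvS (backward T \<kappa> (FExS X \<phi>))"
    then have x: "x \<in> fvS (backward T \<kappa> \<phi>)" "x \<notin> (\<lambda>c. prod_encode (X, c)) ` tcopies T"
      using fin by auto
    then obtain X' c where "x = prod_encode (X', c)" "X' \<in> fvS \<phi>" "c \<in> tcopies T"
      using sub by blast
    moreover have "X' \<noteq> X" using x(2) calculation by auto
    ultimately show "x \<in> {prod_encode (X', c) | X' c. X' \<in> fvS (FExS X \<phi>) \<and> c \<in> tcopies T}"
      by auto
  qed
qed auto

text \<open>A set of output nodes is a family of input sets, one slice per copy. The slices have to
  agree with the set only on actual nodes of \<open>H\<close>, because a slice may contain an input
  node whose copy was not created.\<close>

lemma sat_backward: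
  assumes T: "wf_msot T" "tnlabs T = {()}" "apply_msot T G = Some H"
    and "\<And>x. x \<in> fvN \<phi> \<Longrightarrow> (nv' (x + 2), \<kappa> x) \<in> verts H \<and> nv x = (nv' (x + 2), \<kappa> x)"
    and "\<And>X u c. X \<in> fvS \<phi> \<Longrightarrow> (u, c) \<in> verts H \<Longrightarrow>
           (u, c) \<in> sv X \<longleftrightarrow> u \<in> sv' (prod_encode (X, c))"
  shows "sat H nv sv \<phi> \<longleftrightarrow> sat G nv' sv' (backward T \<kappa> \<phi>)"
  using assms(4,5)
proof (induction \<phi> arbitrary: nv sv nv' sv' \<kappa>)
  case (FEdge \<gamma> x y)
  have fv: "fvN (tedge T (\<kappa> x) (\<kappa> y) \<gamma>) \<subseteq> {0, 1}" "fvS (tedge T (\<kappa> x) (\<kappa> y) \<gamma>) = {}"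
    using T by (auto simp: wf_msot_def)
  have xy: "(nv' (x + 2), \<kappa> x) \<in> verts H" "(nv' (y + 2), \<kappa> y) \<in> verts H"
    "nv x = (nv' (x + 2), \<kappa> x)" "nv y = (nv' (y + 2), \<kappa> y)" using FEdge.prems(1) by simp_all
  have vH: "verts H = out_verts T G" using T(3) by (auto simp: apply_msot_def split: if_splits)
  then have v: "nv' (x + 2) \<in> verts G" "nv' (y + 2) \<in> verts G"
    using xy by (auto simp: out_verts_def)
  have "(nv x, \<gamma>, nv y) \<in> edges H \<longleftrightarrow>
      \<gamma> \<in> telabs T \<and> sat2 G (tedge T (\<kappa> x) (\<kappa> y) \<gamma>) (nv' (x + 2)) (nv' (y + 2))"
    using T(3) xy(1,2) unfolding xy(3,4) vH by (auto simp: apply_msot_def split: if_splits)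
  moreover have "sat G nv' sv' (sub2 (tedge T (\<kappa> x) (\<kappa> y) \<gamma>) (x + 2) (y + 2)) \<longleftrightarrow>
      sat2 G (tedge T (\<kappa> x) (\<kappa> y) \<gamma>) (nv' (x + 2)) (nv' (y + 2))"
    by (rule sat_sub2) (use fv v in simp_all)
  ultimately show ?case by simp
next
  case (FAnd \<phi>1 \<phi>2)
  have "sat H nv sv \<phi>1 \<longleftrightarrow> sat G nv' sv' (backward T \<kappa> \<phi>1)"
    by (rule FAnd.IH) (use FAnd.prems in simp_all)
  moreover have "sat H nv sv \<phi>2 \<longleftrightarrow> sat G nv' sv' (backward T \<kappa> \<phi>2)"
    by (rule FAnd.IH) (use FAnd.prems in simp_all)
  ultimately show ?case by simp
next
  case (FNot \<phi>)
  have "sat H nv sv \<phi> \<longleftrightarrow> sat G nv' sv' (backward T \<kappa> \<phi>)"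
    by (rule FNot.IH) (use FNot.prems in simp_all)
  then show ?case by simp
next
  case (FExN x \<phi>)
  have fin: "finite (tcopies T)" using T by (auto simp: wf_msot_def)
  have fv: "fvN (tnode T c ()) \<subseteq> {0}" "fvS (tnode T c ()) = {}" for c
    using T by (auto simp: wf_msot_def)
  have vH: "(u, c) \<in> verts H \<longleftrightarrow> u \<in> verts G \<and> c \<in> tcopies T \<and> sat1 G (tnode T c ()) u" for u c
    using T(2,3) by (auto simp: apply_msot_def out_verts_def split: if_splits)
  have "sat H (nv(x := (u, c))) sv \<phi> \<longleftrightarrow> sat G (nv'(x + 2 := u)) sv' (backward T (\<kappa>(x := c)) \<phi>)"
    if "(u, c) \<in> verts H" for u c
    by (rule FExN.IH) (use FExN.prems that in auto)
  moreover have "sat G (nv'(x + 2 := u)) sv' (sub1 (tnode T c ()) (x + 2)) \<longleftrightarrow> sat1 G (tnode T c ()) u"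
    if "u \<in> verts G" for u c
    using sat_sub1[of "tnode T c ()" "x + 2" "nv'(x + 2 := u)" G sv'] fv that by simp
  ultimately show ?case using fin by (auto simp: vH Bex_def)
next
  case (FExS X \<phi>)
  have fin: "finite (tcopies T)" using T by (auto simp: wf_msot_def)
  have vH: "(u, c) \<in> verts H \<Longrightarrow> u \<in> verts G \<and> c \<in> tcopies T" for u c
    using T(2,3) by (auto simp: apply_msot_def out_verts_def split: if_splits)
  let ?Xs = "map (\<lambda>c. prod_encode (X, c)) (sorted_list_of_set (tcopies T))"
  show ?case (is "?l \<longleftrightarrow> ?r")
  proof
    assume ?l
    then obtain U where U: "U \<subseteq> verts H" "sat H nv (sv(X := U)) \<phi>" by auto
    \<comment> \<open>The codes of \<open>X\<close> with an actual copy receive the slices of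
      \<open>U\<close>; every other code keeps its old value.\<close>
    define sv'' where "sv'' Y = (case prod_decode Y of (X', c) \<Rightarrow>
      if X' = X \<and> c \<in> tcopies T then {u. (u, c) \<in> U} else sv' Y)" for Y
    have "sat G nv' sv'' (backward T \<kappa> \<phi>)"
    proof (subst FExS.IH[symmetric])
      show "sat H nv (sv(X := U)) \<phi>" by fact
      show "(u, c) \<in> (sv(X := U)) Y \<longleftrightarrow> u \<in> sv'' (prod_encode (Y, c))"
        if "Y \<in> fvS \<phi>" "(u, c) \<in> verts H" for Y u c
        using FExS.prems(2)[of Y u c] that vH by (auto simp: sv''_def)
    qed (use FExS.prems(1) in simp_all)
    moreover have "Y \<in> set ?Xs \<longrightarrow> sv'' Y \<subseteq> verts G" for Y
      using U(1) vH fin by (auto simp: sv''_def)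
    moreover have "Y \<notin> set ?Xs \<longrightarrow> sv'' Y = sv' Y" for Y
    proof -
      obtain X' c where Y: "Y = prod_encode (X', c)" by (metis prod_decode_inverse surj_pair)
      then show ?thesis using fin by (auto simp: sv''_def)
    qed
    ultimately show ?r unfolding backward.simps sat_FExSs by blast
  next
    assume ?r
    then obtain sv'' where sv'': "\<forall>Y. Y \<in> set ?Xs \<longrightarrow> sv'' Y \<subseteq> verts G"
      "\<forall>Y. Y \<notin> set ?Xs \<longrightarrow> sv'' Y = sv' Y" "sat G nv' sv'' (backward T \<kappa> \<phi>)"
      unfolding backward.simps sat_FExSs by blast
    \<comment> \<open>Conversely the slices are glued and cut down to the nodes that exist in
      \<open>H\<close>.\<close>
    define U where "U = {(u, c) \<in> verts H. u \<in> sv'' (prod_encode (X, c))}"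
    have eq: "sv'' (prod_encode (Y, c)) = sv' (prod_encode (Y, c))" if "Y \<noteq> X" for Y c
      using sv''(2)[rule_format, of "prod_encode (Y, c)"] that
      by (simp add: image_iff prod_encode_eq)
    have "sat H nv (sv(X := U)) \<phi>"
    proof (subst FExS.IH)
      show "sat G nv' sv'' (backward T \<kappa> \<phi>)" by fact
      show "(u, c) \<in> (sv(X := U)) Y \<longleftrightarrow> u \<in> sv'' (prod_encode (Y, c))"
        if "Y \<in> fvS \<phi>" "(u, c) \<in> verts H" for Y u c
        using FExS.prems(2)[of Y u c] that eq by (auto simp: U_def)
    qed (use FExS.prems(1) in simp_all)
    moreover have "U \<subseteq> verts H" by (auto simp: U_def)
    ultimately show ?l by auto
  qed
qed auto

text \<open>\<open>backward\<close> shifts the free variables 0 and 1 to 2 and 3, so these are bound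
  and equated with the originals. A pair of copies is coded as one number. Answering
  \<open>FFalse\<close> outside the copies of \<open>T1\<close> keeps set variables from becoming
  free at any index, as \<open>wf_msot\<close> demands for all of them.\<close>

definition comp_msot ::
  "(unit,'a,nat,unit,'b) msot \<Rightarrow> (unit,'b,nat,unit,'c) msot \<Rightarrow> (unit,'a,nat,unit,'c) msot" where
  "comp_msot T1 T2 = \<lparr>
     tdom = FAnd (tdom T1) (backward T1 (\<lambda>_. 0) (tdom T2)),
     tcopies = prod_encode ` (tcopies T1 \<times> tcopies T2),
     tnlabs = {()},
     telabs = telabs T2,
     tnode = (\<lambda>c _. case prod_decode c of (c1, c2) \<Rightarrow>
       if c1 \<in> tcopies T1 then FAnd (tnode T1 c1 ())
         (FExN 2 (FAnd (FEq 2 0) (backward T1 (\<lambda>_. c1) (tnode T2 c2 ())))) else FFalse),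
     tedge = (\<lambda>c d \<gamma>. case (prod_decode c, prod_decode d) of ((c1, c2), (d1, d2)) \<Rightarrow>
       if c1 \<in> tcopies T1 \<and> d1 \<in> tcopies T1 then FExN 2 (FAnd (FEq 2 0) (FExN 3 (FAnd (FEq 3 1)
         (backward T1 ((\<lambda>_. c1)(1 := d1)) (tedge T2 c2 d2 \<gamma>))))) else FFalse)\<rparr>"

lemma wf_comp_msot:
  assumes "wf_msot T1" "wf_msot T2"
  shows "wf_msot (comp_msot T1 T2)"
proof -
  have n: "fvN (backward T1 \<kappa> \<phi>) \<subseteq> (\<lambda>x. x + 2) ` fvN \<phi>" for \<kappa> and \<phi> :: "(unit, 'b) mso"
    by (rule fvN_backward[OF assms(1)])
  have s: "fvS (backward T1 \<kappa> \<phi>) = {}" if "fvS \<phi> = {}" "\<kappa> ` fvN \<phi> \<subseteq> tcopies T1"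
    for \<kappa> and \<phi> :: "(unit, 'b) mso"
    using fvS_backward[OF assms(1) that(2)] that(1) by simp
  have T1: "fvN (tdom T1) = {}" "fvS (tdom T1) = {}" "fvN (tnode T1 c \<sigma>) \<subseteq> {0}" "fvS (tnode T1 c \<sigma>) = {}"
    for c \<sigma> using assms(1) by (simp_all add: wf_msot_def)
  have T2: "fvN (tdom T2) = {}" "fvS (tdom T2) = {}" "fvN (tnode T2 c \<sigma>) \<subseteq> {0}" "fvS (tnode T2 c \<sigma>) = {}"
    "fvN (tedge T2 c d \<gamma>) \<subseteq> {0, 1}" "fvS (tedge T2 c d \<gamma>) = {}"
    for c d \<sigma> \<gamma> using assms(2) by (simp_all add: wf_msot_def)
  have n1: "fvN (backward T1 \<kappa> (tnode T2 c \<sigma>)) \<subseteq> {2}" for \<kappa> c \<sigma>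
    using subset_trans[OF n image_mono[OF T2(3)]] by (simp add: numeral_2_eq_2)
  have n2: "fvN (backward T1 \<kappa> (tedge T2 c d \<gamma>)) \<subseteq> {2, 3}" for \<kappa> c d \<gamma>
    using subset_trans[OF n image_mono[OF T2(5)]] by (simp add: numeral_3_eq_3 numeral_2_eq_2)
  have s1: "fvS (backward T1 (\<lambda>_. c1) (tnode T2 c \<sigma>)) = {}" if "c1 \<in> tcopies T1" for c1 c \<sigma>
    by (rule s) (use T2 that in auto)
  have s2: "fvS (backward T1 ((\<lambda>_. c1)(1 := d1)) (tedge T2 c d \<gamma>)) = {}"
    if "c1 \<in> tcopies T1" "d1 \<in> tcopies T1" for c1 d1 c d \<gamma>
    by (rule s) (use T2 that in auto)
  have d: "fvN (backward T1 \<kappa> (tdom T2)) = {}" "fvS (backward T1 \<kappa> (tdom T2)) = {}" for \<kappa>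
    using n[of \<kappa> "tdom T2"] s[of "tdom T2" \<kappa>] T2 by auto
  show ?thesis
    unfolding wf_msot_def
  proof (intro conjI allI)
    show "finite (tcopies (comp_msot T1 T2))" "finite (telabs (comp_msot T1 T2))"
      using assms by (auto simp: comp_msot_def wf_msot_def)
    show "fvN (tnode (comp_msot T1 T2) c \<sigma>) \<subseteq> {0}" for c \<sigma>
      using n1 T1(3) unfolding comp_msot_def by (auto split: prod.split)
    show "fvS (tnode (comp_msot T1 T2) c \<sigma>) = {}" for c \<sigma>
      using s1 T1(4) unfolding comp_msot_def by (simp split: prod.split)
    show "fvN (tedge (comp_msot T1 T2) c d \<gamma>) \<subseteq> {0, 1}" for c d \<gamma>
      using n2[of "(\<lambda>_. fst (prod_decode c))(1 := fst (prod_decode d))" "snd (prod_decode c)"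
          "snd (prod_decode d)" \<gamma>]
      unfolding comp_msot_def by (auto split: prod.split)
    show "fvS (tedge (comp_msot T1 T2) c d \<gamma>) = {}" for c d \<gamma>
      using s2 unfolding comp_msot_def by (simp split: prod.split)
  qed (use d T1 in \<open>auto simp: comp_msot_def\<close>)
qed

lemma apply_msot_verts:
  assumes "apply_msot T G = Some H" "tnlabs T = {()}"
  shows "(u, c) \<in> verts H \<longleftrightarrow> u \<in> verts G \<and> c \<in> tcopies T \<and> sat1 G (tnode T c ()) u"
  using assms by (auto simp: apply_msot_def out_verts_def split: if_splits)

lemma apply_msot_edges:
  assumes "apply_msot T G = Some H"
  shows "((u, c), \<gamma>, (v, d)) \<in> edges H \<longleftrightarrow> (u, c) \<in> verts H \<and> (v, d) \<in> verts H
    \<and> \<gamma> \<in> telabs T \<and> sat2 G (tedge T c d \<gamma>) u v"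
  using assms by (auto simp: apply_msot_def split: if_splits)

text \<open>Both graphs have the same nodes up to regrouping of the copies,
  \<open>(u, prod_encode (c1, c2))\<close> against \<open>((u, c1), c2)\<close>; all formulas agree
  by \<open>sat_backward\<close>.\<close>

lemma apply_comp_msot:
  fixes G :: "('v, unit, 'a) graph" and T1 :: "(unit, 'a, nat, unit, 'b) msot"
    and T2 :: "(unit, 'b, nat, unit, 'c) msot"
  assumes T1: "wf_msot T1" "tnlabs T1 = {()}" and T2: "wf_msot T2" "tnlabs T2 = {()}"
    and H1: "apply_msot T1 G = Some H1"
  shows "apply_msot (comp_msot T1 T2) G = None \<longleftrightarrow> apply_msot T2 H1 = None"
    and "apply_msot (comp_msot T1 T2) G = Some H \<Longrightarrow> apply_msot T2 H1 = Some H2 \<Longrightarrow> graph_iso H H2"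
proof -
  let ?T = "comp_msot T1 T2"
  have T2fv: "fvN (tdom T2) = {}" "fvS (tdom T2) = {}" "fvN (tnode T2 c \<sigma>) \<subseteq> {0}" "fvS (tnode T2 c \<sigma>) = {}"
    "fvN (tedge T2 c d \<gamma>) \<subseteq> {0, 1}" "fvS (tedge T2 c d \<gamma>) = {}"
    for c d \<sigma> \<gamma> using T2(1) by (simp_all add: wf_msot_def)
  have T1fv: "fvN (tnode T1 c \<sigma>) \<subseteq> {0}" "fvS (tnode T1 c \<sigma>) = {}"
    for c \<sigma> using T1(1) by (simp_all add: wf_msot_def)
  have d1: "sat G (\<lambda>_. undefined) (\<lambda>_. {}) (tdom T1)"
    using H1 by (simp add: apply_msot_def split: if_splits)
  have "sat H1 (\<lambda>_. undefined) (\<lambda>_. {}) (tdom T2) \<longleftrightarrow>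
      sat G (\<lambda>_. undefined) (\<lambda>_. {}) (backward T1 (\<lambda>_. 0) (tdom T2))"
    by (rule sat_backward[OF T1 H1]) (simp_all add: T2fv)
  with d1 show "apply_msot ?T G = None \<longleftrightarrow> apply_msot T2 H1 = None"
    by (simp add: apply_msot_def comp_msot_def)
  assume H: "apply_msot ?T G = Some H" and H2: "apply_msot T2 H1 = Some H2"
  have labs: "tnlabs ?T = {()}" by (simp add: comp_msot_def)
  note v1 = apply_msot_verts[OF H1 T1(2)] and v2 = apply_msot_verts[OF H2 T2(2)]
    and v = apply_msot_verts[OF H labs]
  have node: "sat1 G (tnode ?T (prod_encode (c1, c2)) ()) u \<longleftrightarrow> (u, c1) \<in> verts H1 \<and> sat1 H1 (tnode T2 c2 ()) (u, c1)"
    if "u \<in> verts G" "c1 \<in> tcopies T1" for u c1 c2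
  proof -
    have "sat1 H1 (tnode T2 c2 ()) (u, c1) \<longleftrightarrow>
        sat G ((\<lambda>_. u)(2 := u)) (\<lambda>_. {}) (backward T1 (\<lambda>_. c1) (tnode T2 c2 ()))"
      if "(u, c1) \<in> verts H1" unfolding sat1_def
      by (rule sat_backward[OF T1 H1]) (use T2fv(3)[of c2 "()"] that in \<open>auto simp: T2fv(4)\<close>)
    moreover have "(u, c1) \<in> verts H1 \<longleftrightarrow> sat1 G (tnode T1 c1 ()) u" using v1 that by simp
    ultimately show ?thesis using that by (auto simp: comp_msot_def sat1_def)
  qed
  have edge: "sat2 G (tedge ?T (prod_encode (c1, c2)) (prod_encode (e1, e2)) \<gamma>) u v \<longleftrightarrow>
      sat2 H1 (tedge T2 c2 e2 \<gamma>) (u, c1) (v, e1)"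
    if "(u, c1) \<in> verts H1" "(v, e1) \<in> verts H1" for u v c1 c2 e1 e2 \<gamma>
  proof -
    have "sat2 H1 (tedge T2 c2 e2 \<gamma>) (u, c1) (v, e1) \<longleftrightarrow>
        sat G ((\<lambda>_. u)(1 := v, 2 := u, 3 := v)) (\<lambda>_. {}) (backward T1 ((\<lambda>_. c1)(1 := e1)) (tedge T2 c2 e2 \<gamma>))"
      unfolding sat2_def
      by (rule sat_backward[OF T1 H1]) (use T2fv(5)[of c2 e2 \<gamma>] that in \<open>auto simp: T2fv(6)\<close>)
    then show ?thesis using that v1 by (auto simp: comp_msot_def sat2_def)
  qed
  have vH: "(u, c) \<in> verts H \<longleftrightarrow> ((u, fst (prod_decode c)), snd (prod_decode c)) \<in> verts H2" for u c
  proof -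
    obtain c1 c2 where c: "c = prod_encode (c1, c2)" by (metis prod_decode_inverse surj_pair)
    show ?thesis unfolding c v v2 using node[of u c1 c2] v1 by (auto simp: comp_msot_def)
  qed
  define f where "f = (\<lambda>(u :: 'v, c). ((u, fst (prod_decode c)), snd (prod_decode c)))"
  have "bij_betw f (verts H) (verts H2)"
    unfolding f_def
    by (rule bij_betw_byWitness[where f' = "\<lambda>((u, c1), c2). (u, prod_encode (c1, c2))"]) (auto simp: vH)
  moreover have "(p, \<gamma>, q) \<in> edges H \<longleftrightarrow> (f p, \<gamma>, f q) \<in> edges H2" if "p \<in> verts H" "q \<in> verts H" for p q \<gamma>
  proof -
    obtain u c1 c2 v e1 e2 where pq: "p = (u, prod_encode (c1, c2))" "q = (v, prod_encode (e1, e2))"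
      by (metis prod_decode_inverse surj_pair)
    then have "((u, c1), c2) \<in> verts H2" "((v, e1), e2) \<in> verts H2" using that vH by auto
    then show ?thesis using that edge[of u c1 v e1 c2 e2 \<gamma>]
      unfolding pq f_def by (auto simp: apply_msot_edges[OF H] apply_msot_edges[OF H2] v2 comp_msot_def)
  qed
  ultimately show "graph_iso H H2" unfolding graph_iso_def by auto
qed

lemma MSO_ed_functional:
  assumes "MSO_ed \<Sigma>1 \<Sigma>2 m"
  shows "functional m"
proof -
  obtain T :: "(unit, 'a, nat, unit, 'b) msot" where
    T: "\<And>w z. (w, z) \<in> m \<Longrightarrow> \<exists>H. apply_msot T (ed w) = Some H \<and> graph_iso H (ed z)"
    using assms unfolding MSO_ed_def by fast
  show ?thesis unfolding functional_def
  proof (intro allI impI)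
    fix w z1 z2 assume "(w, z1) \<in> m" "(w, z2) \<in> m"
    then have "\<exists>H :: (nat \<times> nat, unit, 'b) graph. graph_iso H (ed z1) \<and> graph_iso H (ed z2)"
      using T[of w z1] T[of w z2] by auto
    then show "z1 = z2" using graph_iso_sym graph_iso_trans ed_iso_inj by metis
  qed
qed

lemma graph_over_ed: "w \<in> lists \<Sigma> \<Longrightarrow> graph_over {()} \<Sigma> (ed w)"
  by (auto simp: graph_over_def ed_def in_lists_conv_set)

text \<open>The behaviour of the second transduction is prescribed only on graphs over
  \<open>\<Sigma>2\<close>. The bound on \<open>m1\<close> makes the intermediate
  \<open>ed b\<close> such a graph, and isomorphism invariance carries the result over from the
  actual output of the first transduction.\<close>

theorem MSO_ed_comp:
  assumes m1: "MSO_ed \<Sigma>1 \<Sigma>2 m1" and m2: "MSO_ed \<Sigma>2 \<Sigma>3 m2"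
    and sub: "m1 \<subseteq> lists \<Sigma>1 \<times> lists \<Sigma>2"
  shows "MSO_ed \<Sigma>1 \<Sigma>3 (m1 O m2)"
proof -
  obtain T1 :: "(unit, 'a, nat, unit, 'b) msot" where T1: "wf_msot T1" "tnlabs T1 = {()}"
    and T1m: "\<And>w b. (w, b) \<in> m1 \<Longrightarrow> \<exists>H. apply_msot T1 (ed w) = Some H \<and> graph_iso H (ed b)"
    and T1o: "\<And>(G :: (nat, unit, 'a) graph) H. graph_over {()} \<Sigma>1 G \<Longrightarrow> apply_msot T1 G = Some H \<Longrightarrow>
          \<exists>(w,b) \<in> m1. graph_iso G (ed w) \<and> graph_iso H (ed b)"
    using m1 unfolding MSO_ed_def by fast
  obtain T2 :: "(unit, 'b, nat, unit, 'c) msot" where T2: "wf_msot T2" "tnlabs T2 = {()}" "telabs T2 = \<Sigma>3"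
    and T2m: "\<And>b z. (b, z) \<in> m2 \<Longrightarrow> \<exists>H. apply_msot T2 (ed b) = Some H \<and> graph_iso H (ed z)"
    and T2o: "\<And>(G :: (nat, unit, 'b) graph) H. graph_over {()} \<Sigma>2 G \<Longrightarrow> apply_msot T2 G = Some H \<Longrightarrow>
          \<exists>(b,z) \<in> m2. graph_iso G (ed b) \<and> graph_iso H (ed z)"
    using m2 unfolding MSO_ed_def by fast
  let ?T = "comp_msot T1 T2"
  note none = apply_comp_msot(1)[OF T1 T2(1,2)] and some = apply_comp_msot(2)[OF T1 T2(1,2)]
  have A: "\<exists>H. apply_msot ?T (ed w) = Some H \<and> graph_iso H (ed z)" if wz: "(w, z) \<in> m1 O m2" for w z
  proof -
    obtain b where b: "(w, b) \<in> m1" "(b, z) \<in> m2" using wz by auto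
    obtain H1 where H1: "apply_msot T1 (ed w) = Some H1" "graph_iso H1 (ed b)" using T1m b by blast
    obtain H2 where H2: "apply_msot T2 (ed b) = Some H2" "graph_iso H2 (ed z)" using T2m b by blast
    obtain H2' where H2': "apply_msot T2 H1 = Some H2'" "graph_iso H2 H2'"
      using apply_msot_iso[OF T2(1) graph_iso_sym[OF H1(2)] H2(1)] by blast
    then obtain H where H: "apply_msot ?T (ed w) = Some H" using none[OF H1(1)] by fastforce
    have "graph_iso H (ed z)"
      using some[OF H1(1) H H2'(1)] graph_iso_sym[OF H2'(2)] H2(2) by (rule graph_iso_trans[OF _ graph_iso_trans])
    with H show ?thesis by blast
  qed
  have B: "\<exists>(w,z) \<in> m1 O m2. graph_iso G (ed w) \<and> graph_iso H (ed z)"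
    if G: "graph_over {()} \<Sigma>1 G" "apply_msot ?T G = Some H" for G :: "(nat, unit, 'a) graph" and H
  proof -
    obtain H1 where H1: "apply_msot T1 G = Some H1"
      using G(2) by (auto simp: apply_msot_def comp_msot_def split: if_splits)
    obtain w b where wb: "(w, b) \<in> m1" "graph_iso G (ed w)" "graph_iso H1 (ed b)"
      using T1o[OF G(1) H1] by blast
    obtain H2 where H2: "apply_msot T2 H1 = Some H2" using none[OF H1] G(2) by fastforce
    obtain H2' where H2': "apply_msot T2 (ed b) = Some H2'" "graph_iso H2 H2'"
      using apply_msot_iso[OF T2(1) wb(3) H2] by blast
    have "b \<in> lists \<Sigma>2" using wb(1) sub by auto
    then obtain b' z where z: "(b', z) \<in> m2" "graph_iso (ed b) (ed b')" "graph_iso H2' (ed z)"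
      using T2o[OF graph_over_ed H2'(1)] by blast
    have "b = b'" using ed_iso_inj z(2) by blast
    moreover have "graph_iso H (ed z)"
      using some[OF H1 G(2) H2] H2'(2) z(3) by (rule graph_iso_trans[OF _ graph_iso_trans])
    ultimately show ?thesis using wb(1,2) z(1) by blast
  qed
  show ?thesis unfolding MSO_ed_def
  proof (intro exI[of _ ?T] conjI ballI allI impI)
    show "wf_msot ?T" "tnlabs ?T = {()}" "telabs ?T = \<Sigma>3"
      using wf_comp_msot[OF T1(1) T2(1)] T2(3) by (simp_all add: comp_msot_def)
    fix p assume "p \<in> m1 O m2"
    then show "case p of (w, z) \<Rightarrow> \<exists>H. apply_msot ?T (ed w) = Some H \<and> graph_iso H (ed z)"
      using A[of "fst p" "snd p"] by (simp only: prod.collapse case_prod_unfold)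
  qed (rule B)
qed

section \<open>MSO formulas from recognizable languages\<close>

definition tape_word :: "'a list \<Rightarrow> 'a tsym list" where
  "tape_word w = map (tape w) [0..<length w + 2]"

lemma length_tape_word [simp]: "length (tape_word w) = length w + 2"
  by (simp add: tape_word_def)

lemma nth_tape_word [simp]: "i < length w + 2 \<Longrightarrow> tape_word w ! i = tape w i"
  by (simp add: tape_word_def del: upt_Suc)

text \<open>\<open>ed w\<close> has one node less than the tape of \<open>w\<close>: node \<open>u\<close> stands for the
  tape position \<open>u + 1\<close>, and with the flag set node 0 stands for the left end marker.\<close>
definition tpos :: "bool \<Rightarrow> nat \<Rightarrow> nat" where
  "tpos b u = (if b then 0 else Suc u)"

text \<open>Whether node \<open>s\<close> carries the mark belonging to argument \<open>x\<close>.
  With \<open>b\<close> set, the marked position is the left end marker, which is represented by no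
  \<open>s\<close>, so the mark is absent everywhere.\<close>

definition FMark :: "bool \<Rightarrow> nat \<Rightarrow> nat \<Rightarrow> bool \<Rightarrow> ('l,'g) mso" where
  "FMark b x s m = (if b then (if m then FFalse else FNot FFalse)
     else (if m then FEq s x else FNot (FEq s x)))"

lemma sat_FMark [simp]: "sat G nv sv (FMark b x s m) \<longleftrightarrow> (\<not> b \<and> nv s = nv x) = m"
  by (auto simp: FMark_def)

lemma fv_FMark: "fvN (FMark b x s m) \<subseteq> {x, s}" "fvS (FMark b x s m) = {}"
  by (auto simp: FMark_def)

definition FFirst :: "'g list \<Rightarrow> nat \<Rightarrow> nat \<Rightarrow> ('l,'g) mso" where
  "FFirst gs y s = FNot (FOrs (map (\<lambda>\<gamma>. FExN y (FEdge \<gamma> y s)) gs))"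

definition FLast :: "'g list \<Rightarrow> nat \<Rightarrow> nat \<Rightarrow> ('l,'g) mso" where
  "FLast gs y s = FNot (FOrs (map (\<lambda>\<gamma>. FExN y (FEdge \<gamma> s y)) gs))"

lemma sat_FFirst:
  assumes "w \<in> lists (set gs)" "y \<noteq> s" "nv s \<le> length w"
  shows "sat (ed w) nv sv (FFirst gs y s) \<longleftrightarrow> nv s = 0"
proof -
  have "sat (ed w) nv sv (FFirst gs y s) \<longleftrightarrow> \<not> (\<exists>\<gamma>\<in>set gs. \<exists>i. i < length w \<and> \<gamma> = w ! i \<and> nv s = Suc i)"
    using assms(2,3) by (fastforce simp: FFirst_def ed_def)
  also have "\<dots> \<longleftrightarrow> nv s = 0"
  proof (cases "nv s")
    case (Suc i)
    then have "w ! i \<in> set gs" using assms(1,3) nth_mem[of i w] by (auto simp: in_lists_conv_set)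
    then show ?thesis using Suc assms(3) by auto
  qed simp
  finally show ?thesis .
qed

lemma sat_FLast:
  assumes "w \<in> lists (set gs)" "y \<noteq> s" "nv s \<le> length w"
  shows "sat (ed w) nv sv (FLast gs y s) \<longleftrightarrow> nv s = length w"
proof -
  have "sat (ed w) nv sv (FLast gs y s) \<longleftrightarrow> \<not> (\<exists>\<gamma>\<in>set gs. nv s < length w \<and> \<gamma> = w ! nv s)"
    using assms(2) by (auto simp: FLast_def ed_def)
  also have "\<dots> \<longleftrightarrow> nv s = length w"
    using assms(1,3) nth_mem[of "nv s" w] by (fastforce simp: in_lists_conv_set)
  finally show ?thesis .
qed

lemma fv_FFirst: "fvN (FFirst gs y s) \<subseteq> {s}" "fvS (FFirst gs y s) = {}"
  by (auto simp: FFirst_def)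

lemma fv_FLast: "fvN (FLast gs y s) \<subseteq> {s}" "fvS (FLast gs y s) = {}"
  by (auto simp: FLast_def)

text \<open>Runs of the automaton whose states are the classes of the congruence: the class of the
  part of the tape to the left of a node lies in every family of sets that contains the initial
  class and is closed under the transitions.\<close>
lemma formula_of_recog:
  fixes L :: "('a tsym \<times> bool \<times> bool) list set"
  assumes "finite \<Sigma>" "recog L"
  shows "\<exists>\<phi> :: (unit, 'a) mso. fvN \<phi> \<subseteq> {0, 1} \<and> fvS \<phi> = {} \<and>
    (\<forall>w\<in>lists \<Sigma>. \<forall>u\<le>length w. \<forall>v\<le>length w.
       sat2 (ed w) \<phi> u v \<longleftrightarrow> marked (tape_word w) (tpos b1 u) (tpos b2 v) \<in> L)"
proof -
  obtain f :: "('a tsym \<times> bool \<times> bool) list \<Rightarrow> nat" where f: "fcong f" "saturates f L"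
    using assms(2) by (rule recogE)
  obtain mul where mul: "\<And>u v. f (u @ v) = mul (f u) (f v)" by (rule fcong_mult[OF f(1)]) (rule that)
  obtain gs where gs: "set gs = \<Sigma>" using assms(1) finite_list by blast
  have "finite (range f)" using f(1) by (simp add: fcong_def)
  then obtain R where R: "set R = range f" by (meson finite_list)
  \<comment> \<open>No node reads the left end marker, so node 0 starts in the class of that single
    letter. Class numbers are used directly as set variables, and \<open>R\<close> lists them
    all.\<close>
  define init :: "(unit, 'a) mso" where
    "init = FNot (FExN 2 (FAnd (FFirst gs 4 2) (FNot (FIn 2 (f [(LEnd, b1, b2)])))))"
  define body :: "'a \<times> nat \<times> bool \<times> bool \<Rightarrow> (unit, 'a) mso" where "body = (\<lambda>(\<gamma>, c, m1, m2).
      FExN 2 (FExN 3 (FAnd (FEdge \<gamma> 2 3) (FAnd (FIn 2 c) (FAnd (FMark b1 0 2 m1) (FAnd (FMark b2 1 2 m2)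
        (FNot (FIn 3 (mul c (f [(Sym \<gamma>, m1, m2)]))))))))))"
  define step where "step = FNot (FOrs (map body (List.product gs (List.product R (List.product [True, False] [True, False])))))"
  \<comment> \<open>The last node stands for the right end marker, whose own letter is not yet part
    of the class stored there; it is multiplied in before acceptance is tested.\<close>
  define fin :: "(unit, 'a) mso" where "fin = FOrs (map (\<lambda>(c, m1, m2).
      FExN 2 (FAnd (FLast gs 4 2) (FAnd (FIn 2 c) (FAnd (FMark b1 0 2 m1) (FMark b2 1 2 m2)))))
      (filter (\<lambda>(c, m1, m2). mul c (f [(REnd, m1, m2)]) \<in> f ` L)
        (List.product R (List.product [True, False] [True, False]))))"
  \<comment> \<open>Quantifying over all closed families makes it unnecessary to express that a
    family gives exactly one class to each node.\<close>
  define \<phi> where "\<phi> = FNot (FExSs R (FAnd (FAnd init step) (FNot fin)))"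
  have mulR: "mul c (f x) \<in> set R" if "c \<in> set R" for c x
    using that R mul by (metis rangeE rangeI)
  have "fvN init \<subseteq> {}" by (auto simp: init_def dest!: subsetD[OF fv_FFirst(1)])
  moreover have "fvN step \<subseteq> {0, 1}" by (auto simp: step_def body_def dest!: subsetD[OF fv_FMark(1)])
  moreover have "fvN fin \<subseteq> {0, 1}"
    by (auto simp: fin_def dest!: subsetD[OF fv_FMark(1)] subsetD[OF fv_FLast(1)])
  ultimately have "fvN \<phi> \<subseteq> {0, 1}" by (auto simp: \<phi>_def)
  moreover have "fvS \<phi> = {}"
  proof -
    have "fvS init \<subseteq> set R" using R by (auto simp: init_def fv_FFirst(2))
    moreover have "fvS step \<subseteq> set R" using mulR by (auto simp: step_def body_def fv_FMark(2))
    moreover have "fvS fin \<subseteq> set R" by (auto simp: fin_def fv_FMark(2) fv_FLast(2))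
    ultimately show ?thesis by (auto simp: \<phi>_def)
  qed
  moreover have "sat2 (ed w) \<phi> u v \<longleftrightarrow> marked (tape_word w) (tpos b1 u) (tpos b2 v) \<in> L"
    if w: "w \<in> lists \<Sigma>" and u: "u \<le> length w" and v: "v \<le> length w" for w u v
  proof -
    let ?W = "marked (tape_word w) (tpos b1 u) (tpos b2 v)"
    define n where "n = length w"
    have lenW: "length ?W = n + 2" by (simp add: n_def)
    \<comment> \<open>Node \<open>i\<close> is tape position \<open>i + 1\<close>, so the first
      \<open>i + 1\<close> letters are those strictly to its left.\<close>
    define q where "q i = f (take (Suc i) ?W)" for i
    define m1 where "m1 i \<longleftrightarrow> \<not> b1 \<and> i = u" for i
    define m2 where "m2 i \<longleftrightarrow> \<not> b2 \<and> i = v" for i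
    have q0: "q 0 = f [(LEnd, b1, b2)]"
      using lenW by (simp add: q_def take_Suc_conv_app_nth tape_def tpos_def)
    have nthW: "?W ! Suc i = (tape w (Suc i), m1 i, m2 i)" if "i \<le> n" for i
      using that by (auto simp: n_def tpos_def m1_def m2_def)
    have qS: "q (Suc i) = mul (q i) (f [(Sym (w ! i), m1 i, m2 i)])" if "i < n" for i
    proof -
      have "take (Suc (Suc i)) ?W = take (Suc i) ?W @ [?W ! Suc i]"
        by (rule take_Suc_conv_app_nth) (use that lenW in simp)
      then show ?thesis using that nthW[of i] by (simp add: q_def mul tape_def n_def)
    qed
    have qn: "f ?W = mul (q n) (f [(REnd, m1 n, m2 n)])"
    proof -
      have "take (Suc (Suc n)) ?W = take (Suc n) ?W @ [?W ! Suc n]"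
        by (rule take_Suc_conv_app_nth) (use lenW in simp)
      moreover have "take (Suc (Suc n)) ?W = ?W" using lenW by simp
      moreover have "?W ! Suc n = (REnd, m1 n, m2 n)" using nthW[of n] by (simp add: tape_def n_def)
      ultimately have "f ?W = f (take (Suc n) ?W @ [(REnd, m1 n, m2 n)])" by metis
      then show ?thesis by (simp only: mul q_def)
    qed
    have qR: "q i \<in> set R" for i by (simp add: q_def R)
    let ?nv = "(\<lambda>_. u)(1 := v)"
    have sinit: "sat (ed w) ?nv sv init \<longleftrightarrow> 0 \<in> sv (q 0)" for sv
    proof -
      have "sat (ed w) (?nv(2 := s)) sv (FFirst gs 4 2) \<longleftrightarrow> s = 0" if "s \<le> n" for s
        using sat_FFirst[of w gs 4 2 "?nv(2 := s)"] w gs that by (simp add: n_def)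
      then show ?thesis by (auto simp: init_def q0 ed_def n_def)
    qed
    have sstep: "sat (ed w) ?nv sv step \<longleftrightarrow> (\<forall>i<n. \<forall>c\<in>set R. i \<in> sv c \<longrightarrow>
        Suc i \<in> sv (mul c (f [(Sym (w ! i), m1 i, m2 i)])))" for sv
    proof -
      have b: "sat (ed w) ?nv sv (body (\<gamma>, c, m1', m2')) \<longleftrightarrow> (\<exists>i<n. w ! i = \<gamma> \<and> i \<in> sv c \<and>
          m1 i = m1' \<and> m2 i = m2' \<and> Suc i \<notin> sv (mul c (f [(Sym \<gamma>, m1', m2')])))" for \<gamma> c m1' m2'
      proof -
        have "sat (ed w) ?nv sv (body (\<gamma>, c, m1', m2')) \<longleftrightarrow> (\<exists>s\<in>{0..n}. \<exists>t\<in>{0..n}.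
          (\<exists>i. s = i \<and> \<gamma> = w ! i \<and> t = Suc i \<and> i < n) \<and> s \<in> sv c \<and> m1 s = m1' \<and> m2 s = m2' \<and>
            t \<notin> sv (mul c (f [(Sym \<gamma>, m1', m2')])))"
          by (simp add: body_def ed_def n_def m1_def m2_def)
        also have "\<dots> \<longleftrightarrow> (\<exists>i<n. w ! i = \<gamma> \<and> i \<in> sv c \<and>
          m1 i = m1' \<and> m2 i = m2' \<and> Suc i \<notin> sv (mul c (f [(Sym \<gamma>, m1', m2')])))"
          by fastforce
        finally show ?thesis .
      qed
      have "w ! i \<in> set gs" if "i < n" for i
        using that w gs by (auto simp: n_def in_lists_conv_set)
      moreover have "sat (ed w) ?nv sv step \<longleftrightarrow> (\<forall>\<gamma> c m1' m2'. \<gamma> \<in> set gs \<longrightarrow> c \<in> set R \<longrightarrow>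
          \<not> sat (ed w) ?nv sv (body (\<gamma>, c, m1', m2')))"
      proof -
        have "set (List.product gs (List.product R (List.product [True, False] [True, False])))
            = set gs \<times> set R \<times> UNIV" by (auto simp: UNIV_bool)
        then show ?thesis unfolding step_def sat.simps sat_FOrs set_map by auto
      qed
      ultimately show ?thesis unfolding b by blast
    qed
    have sfin: "sat (ed w) ?nv sv fin \<longleftrightarrow>
        (\<exists>c\<in>set R. n \<in> sv c \<and> mul c (f [(REnd, m1 n, m2 n)]) \<in> f ` L)" for sv
    proof -
      have "sat (ed w) (?nv(2 := s)) sv (FLast gs 4 2) \<longleftrightarrow> s = n" if "s \<le> n" for s
        using sat_FLast[of w gs 4 2 "?nv(2 := s)"] w gs that by (simp add: n_def)
      then show ?thesis by (fastforce simp: fin_def ed_def n_def m1_def m2_def)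
    qed
    have acc: "?W \<in> L \<longleftrightarrow> f ?W \<in> f ` L" using saturatesD[OF f(2)] by blast
    show ?thesis
    proof
      assume "sat2 (ed w) \<phi> u v"
      then have "\<not> sat (ed w) ?nv (\<lambda>_. {}) (FExSs R (FAnd (FAnd init step) (FNot fin)))"
        by (simp add: sat2_def \<phi>_def)
      \<comment> \<open>The family given by the actual run is admissible, so the formula forces it
        to satisfy \<open>fin\<close>.\<close>
      moreover define sv where "sv c = {i. i \<le> n \<and> c \<in> set R \<and> q i = c}" for c
      have "sv c \<subseteq> verts (ed w)" "c \<notin> set R \<Longrightarrow> sv c = {}" for c by (auto simp: sv_def ed_def n_def)
      moreover have "sat (ed w) ?nv sv init" unfolding sinit by (simp add: sv_def qR)
      moreover have "sat (ed w) ?nv sv step" unfolding sstep by (auto simp: sv_def qS mulR)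
      ultimately have "sat (ed w) ?nv sv fin" unfolding sat_FExSs sat.simps by blast
      then show "?W \<in> L" unfolding sfin acc qn by (auto simp: sv_def)
    next
      assume W: "?W \<in> L"
      have "sat (ed w) ?nv sv fin" if "sat (ed w) ?nv sv init" "sat (ed w) ?nv sv step" for sv
      proof -
        \<comment> \<open>Every admissible family contains the actual run, which is
          accepting.\<close>
        have "i \<in> sv (q i)" if "i \<le> n" for i
          using that
        proof (induction i)
          case 0
          then show ?case using \<open>sat (ed w) ?nv sv init\<close> sinit by blast
        next
          case (Suc i)
          then show ?case using \<open>sat (ed w) ?nv sv step\<close> qR qS unfolding sstep by simp
        qed
        then show ?thesis using W qR unfolding sfin acc qn by blast
      qed
      then show "sat2 (ed w) \<phi> u v" unfolding sat2_def \<phi>_def sat.simps sat_FExSs by blast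
    qed
  qed
  ultimately show ?thesis by blast
qed


section \<open>String graphs characterized in MSO\<close>

definition FString :: "'g list \<Rightarrow> ('l,'g) mso" where
  "FString gs = FExN 0 (FAnd (FNot (FOrs (map (\<lambda>\<gamma>. FExN 1 (FEdge \<gamma> 1 0)) gs)))
     (FAnd (FNot (FOrs (map (\<lambda>(\<gamma>, \<gamma>'). FExN 1 (FExN 2 (FExN 3 (FAnd (FEdge \<gamma> 1 2) (FAnd (FEdge \<gamma>' 1 3)
        (if \<gamma> = \<gamma>' then FNot (FEq 2 3) else FNot FFalse)))))) (List.product gs gs))))
     (FAnd (FNot (FOrs (map (\<lambda>(\<gamma>, \<gamma>'). FExN 1 (FExN 2 (FExN 3 (FAnd (FEdge \<gamma> 2 1) (FAnd (FEdge \<gamma>' 3 1)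
        (FNot (FEq 2 3))))))) (List.product gs gs))))
     (FNot (FExS 0 (FAnd (FIn 0 0) (FAnd (FExN 1 (FNot (FIn 1 0)))
        (FNot (FOrs (map (\<lambda>\<gamma>. FExN 1 (FExN 2 (FAnd (FEdge \<gamma> 1 2) (FAnd (FIn 1 0) (FNot (FIn 2 0))))))  gs))))))))))"

lemma fv_FString [simp]: "fvN (FString gs) = {}" "fvS (FString gs) = {}"
  by (auto simp: FString_def split: if_splits)

text \<open>These are axioms for a labelled directed path: a source, at most one outgoing edge, at
  most one predecessor, and induction from the source. They are needed in domain formulas because
  \<open>MSO_ed\<close> quantifies over all graphs and tolerates outputs on string graphs only.
  Since all edge labels of \<open>G\<close> occur in \<open>gs\<close>, finite disjunctions cover
  every label.\<close>

lemma sat_FString: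
  assumes "graph_over S (set gs) G"
  shows "sat G nv sv (FString gs) \<longleftrightarrow> (\<exists>s\<in>verts G.
    (\<forall>t \<gamma>. (t, \<gamma>, s) \<notin> edges G) \<and>
    (\<forall>a \<gamma> b \<gamma>' c. (a, \<gamma>, b) \<in> edges G \<longrightarrow> (a, \<gamma>', c) \<in> edges G \<longrightarrow> \<gamma> = \<gamma>' \<and> b = c) \<and>
    (\<forall>a \<gamma> b \<gamma>' c. (b, \<gamma>, a) \<in> edges G \<longrightarrow> (c, \<gamma>', a) \<in> edges G \<longrightarrow> b = c) \<and>
    (\<forall>X \<subseteq> verts G. s \<in> X \<longrightarrow> (\<forall>a \<gamma> b. (a, \<gamma>, b) \<in> edges G \<longrightarrow> a \<in> X \<longrightarrow> b \<in> X) \<longrightarrow> X = verts G))"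
proof -
  have E: "(a, \<gamma>, b) \<in> edges G \<Longrightarrow> a \<in> verts G \<and> \<gamma> \<in> set gs \<and> b \<in> verts G" for a \<gamma> b
    using assms by (auto simp: graph_over_def)
  have A: "sat G nv sv (FNot (FOrs (map (\<lambda>\<gamma>. FExN 1 (FEdge \<gamma> 1 0)) gs)))
      \<longleftrightarrow> (\<forall>t \<gamma>. (t, \<gamma>, nv 0) \<notin> edges G)" for nv sv
    using E by fastforce
  have B: "sat G nv sv (FNot (FOrs (map (\<lambda>(\<gamma>, \<gamma>'). FExN 1 (FExN 2 (FExN 3 (FAnd (FEdge \<gamma> 1 2) (FAnd (FEdge \<gamma>' 1 3)
        (if \<gamma> = \<gamma>' then FNot (FEq 2 3) else FNot FFalse)))))) (List.product gs gs))))
      \<longleftrightarrow> (\<forall>a \<gamma> b \<gamma>' c. (a, \<gamma>, b) \<in> edges G \<longrightarrow> (a, \<gamma>', c) \<in> edges G \<longrightarrow> \<gamma> = \<gamma>' \<and> b = c)" (is "?l \<longleftrightarrow> ?r") for nv sv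
  proof -
    have "?l \<longleftrightarrow> (\<forall>\<gamma>\<in>set gs. \<forall>\<gamma>'\<in>set gs. \<forall>a\<in>verts G. \<forall>b\<in>verts G. \<forall>c\<in>verts G.
        (a, \<gamma>, b) \<in> edges G \<longrightarrow> (a, \<gamma>', c) \<in> edges G \<longrightarrow> \<gamma> = \<gamma>' \<and> b = c)"
    proof -
      have "sat G nv sv (if \<gamma> = \<gamma>' then FNot (FEq 2 3) else FNot FFalse) \<longleftrightarrow> (\<gamma> = \<gamma>' \<longrightarrow> nv 2 \<noteq> nv 3)"
        for nv \<gamma> \<gamma>' by simp
      then show ?thesis by (simp add: Ball_def) blast
    qed
    then show ?thesis using E by blast
  qed
  have C: "sat G nv sv (FNot (FOrs (map (\<lambda>(\<gamma>, \<gamma>'). FExN 1 (FExN 2 (FExN 3 (FAnd (FEdge \<gamma> 2 1) (FAnd (FEdge \<gamma>' 3 1)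
        (FNot (FEq 2 3))))))) (List.product gs gs))))
      \<longleftrightarrow> (\<forall>a \<gamma> b \<gamma>' c. (b, \<gamma>, a) \<in> edges G \<longrightarrow> (c, \<gamma>', a) \<in> edges G \<longrightarrow> b = c)" (is "?l \<longleftrightarrow> ?r") for nv sv
  proof -
    have "?l \<longleftrightarrow> (\<forall>\<gamma>\<in>set gs. \<forall>\<gamma>'\<in>set gs. \<forall>a\<in>verts G. \<forall>b\<in>verts G. \<forall>c\<in>verts G.
        (b, \<gamma>, a) \<in> edges G \<longrightarrow> (c, \<gamma>', a) \<in> edges G \<longrightarrow> b = c)"
      by auto
    then show ?thesis using E by blast
  qed
  have D: "sat G nv sv (FNot (FExS 0 (FAnd (FIn 0 0) (FAnd (FExN 1 (FNot (FIn 1 0)))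
        (FNot (FOrs (map (\<lambda>\<gamma>. FExN 1 (FExN 2 (FAnd (FEdge \<gamma> 1 2) (FAnd (FIn 1 0) (FNot (FIn 2 0)))))) gs)))))))
      \<longleftrightarrow> (\<forall>X \<subseteq> verts G. nv 0 \<in> X \<longrightarrow> (\<forall>a \<gamma> b. (a, \<gamma>, b) \<in> edges G \<longrightarrow> a \<in> X \<longrightarrow> b \<in> X) \<longrightarrow> X = verts G)"
    (is "?l \<longleftrightarrow> ?r") for nv sv
  proof -
    have "?l \<longleftrightarrow> \<not> (\<exists>X\<subseteq>verts G. nv 0 \<in> X \<and> (\<exists>u\<in>verts G. u \<notin> X) \<and>
        \<not> (\<exists>\<gamma>\<in>set gs. \<exists>a\<in>verts G. \<exists>b\<in>verts G. (a, \<gamma>, b) \<in> edges G \<and> a \<in> X \<and> b \<notin> X))"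
      by simp
    also have "\<dots> \<longleftrightarrow> \<not> (\<exists>X\<subseteq>verts G. nv 0 \<in> X \<and> X \<noteq> verts G \<and>
        (\<forall>a \<gamma> b. (a, \<gamma>, b) \<in> edges G \<longrightarrow> a \<in> X \<longrightarrow> b \<in> X))"
    proof -
      have q1: "(\<exists>u\<in>verts G. u \<notin> X) \<longleftrightarrow> X \<noteq> verts G" if "X \<subseteq> verts G" for X using that by blast
      have q2: "\<not> (\<exists>\<gamma>\<in>set gs. \<exists>a\<in>verts G. \<exists>b\<in>verts G. (a, \<gamma>, b) \<in> edges G \<and> a \<in> X \<and> b \<notin> X)
          \<longleftrightarrow> (\<forall>a \<gamma> b. (a, \<gamma>, b) \<in> edges G \<longrightarrow> a \<in> X \<longrightarrow> b \<in> X)" for X using E by blast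
      show ?thesis by (intro arg_cong[where f = Not] ex_cong1 conj_cong refl q1 q2)
    qed
    also have "\<dots> \<longleftrightarrow> ?r" by blast
    finally show ?thesis .
  qed
  show ?thesis unfolding FString_def sat.simps(7)[of G nv sv 0] sat.simps(6) A B C D by simp
qed

lemma sat_FString_ed:
  assumes "w \<in> lists (set gs)"
  shows "sat (ed w) nv sv (FString gs)"
proof -
  have "X = verts (ed w)" if X: "X \<subseteq> verts (ed w)" "0 \<in> X"
    "\<forall>a \<gamma> b. (a, \<gamma>, b) \<in> edges (ed w) \<longrightarrow> a \<in> X \<longrightarrow> b \<in> X" for X
  proof -
    have "i \<in> X" if "i \<le> length w" for i
      using that
    proof (induction i)
      case (Suc i)
      then have "(i, w ! i, Suc i) \<in> edges (ed w)" by (simp add: ed_def)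
      then show ?case using X(3) Suc by auto
    qed (use X in simp)
    then show ?thesis using X(1) by (auto simp: ed_def)
  qed
  then show ?thesis
    unfolding sat_FString[OF graph_over_ed[OF assms]] by (intro bexI[of _ 0]) (auto simp: ed_def)
qed

text \<open>A maximal path from the source is closed under edges, hence it is the whole graph.\<close>
lemma FString_ed_iso:
  assumes G: "graph_over {()} (set gs) G" and sat: "sat G nv sv (FString gs)"
  obtains w where "w \<in> lists (set gs)" "graph_iso G (ed w)"
proof -
  obtain s where s: "s \<in> verts G"
    and A: "\<And>t \<gamma>. (t, \<gamma>, s) \<notin> edges G"
    and B: "\<And>a \<gamma> b \<gamma>' c. (a, \<gamma>, b) \<in> edges G \<Longrightarrow> (a, \<gamma>', c) \<in> edges G \<Longrightarrow> \<gamma> = \<gamma>' \<and> b = c"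
    and C: "\<And>a \<gamma> b \<gamma>' c. (b, \<gamma>, a) \<in> edges G \<Longrightarrow> (c, \<gamma>', a) \<in> edges G \<Longrightarrow> b = c"
    and D: "\<And>X. X \<subseteq> verts G \<Longrightarrow> s \<in> X \<Longrightarrow> (\<forall>a \<gamma> b. (a, \<gamma>, b) \<in> edges G \<longrightarrow> a \<in> X \<longrightarrow> b \<in> X) \<Longrightarrow> X = verts G"
    using sat unfolding sat_FString[OF G] by (elim bexE conjE) (rule that; blast)
  have E: "(a, \<gamma>, b) \<in> edges G \<Longrightarrow> a \<in> verts G \<and> \<gamma> \<in> set gs \<and> b \<in> verts G" for a \<gamma> b
    using G unfolding graph_over_def by blast
  define path where "path vs w \<longleftrightarrow> length vs = Suc (length w) \<and> vs ! 0 = s \<and> distinct vs \<and> set vs \<subseteq> verts G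
    \<and> (\<forall>i<length w. (vs ! i, w ! i, vs ! Suc i) \<in> edges G)" for vs w
  have fin: "finite (verts G)" using G unfolding graph_over_def by blast
  have bound: "length w < Suc (card (verts G))" if "path vs w" for vs w
    using that card_mono[OF fin, of "set vs"] by (simp add: path_def distinct_card)
  have "path [s] []" using s by (simp add: path_def)
  then have ex: "\<exists>vs. path vs w" if "w = []" for w using that by blast
  obtain vs w where pw: "path vs w" and max: "\<And>vs' w'. path vs' w' \<Longrightarrow> length w' \<le> length w"
  proof -
    have "\<exists>w. (\<exists>vs. path vs w) \<and> (\<forall>w'. (\<exists>vs. path vs w') \<longrightarrow> length w' \<le> length w)"
      by (rule ex_has_greatest_nat[of "\<lambda>w. \<exists>vs. path vs w" "[]" length "Suc (card (verts G))"])
        (use ex bound in blast)+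
    then show thesis using that by blast
  qed
  have len: "length vs = Suc (length w)" and v0: "vs ! 0 = s" and dist: "distinct vs"
    and sub: "set vs \<subseteq> verts G" and step: "\<And>i. i < length w \<Longrightarrow> (vs ! i, w ! i, vs ! Suc i) \<in> edges G"
    using pw by (auto simp: path_def)
  have succ: "i < length w \<and> \<gamma> = w ! i \<and> b = vs ! Suc i" if i: "i \<le> length w" and e: "(vs ! i, \<gamma>, b) \<in> edges G" for i \<gamma> b
  proof (cases "i < length w")
    case True
    then show ?thesis using B[OF e step] by simp
  next
    case False
    then have i: "i = length w" using i by simp
    \<comment> \<open>If the target were on the path, the source would have an incoming edge or some
      path node would have two predecessors. Otherwise the path could be extended, against
      maximality.\<close>
    have "b \<notin> set vs"
    proof
      assume "b \<in> set vs"
      then obtain j where j: "j \<le> length w" "b = vs ! j" using len by (auto simp: in_set_conv_nth less_Suc_eq_le)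
      show False
      proof (cases j)
        case 0
        then show False using e j v0 A by simp
      next
        case (Suc k)
        then have "vs ! k = vs ! i" using C[OF step[of k]] e j by simp
        then show False using dist len i Suc j(1) by (simp add: nth_eq_iff_index_eq)
      qed
    qed
    then have "path (vs @ [b]) (w @ [\<gamma>])"
      using len v0 dist sub step e E[OF e] i by (auto simp: path_def nth_append less_Suc_eq)
    then show ?thesis using max by fastforce
  qed
  have all: "set vs = verts G"
  proof (rule D[OF sub])
    show "s \<in> set vs" using v0 len by (metis nth_mem zero_less_Suc)
    show "\<forall>a \<gamma> b. (a, \<gamma>, b) \<in> edges G \<longrightarrow> a \<in> set vs \<longrightarrow> b \<in> set vs"
    proof (intro allI impI)
      fix a \<gamma> b assume e: "(a, \<gamma>, b) \<in> edges G" and "a \<in> set vs"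
      then obtain i where i: "i \<le> length w" "a = vs ! i"
        using len by (auto simp: in_set_conv_nth less_Suc_eq_le)
      have "Suc i < length vs" "b = vs ! Suc i" using succ[OF i(1)] e i(2) len by auto
      then show "b \<in> set vs" by simp
    qed
  qed
  have "bij_betw (nth vs) {0..length w} (verts G)"
    using bij_betw_nth[OF dist, of "{0..length w}" "verts G"] all len by (simp add: atLeast0AtMost lessThan_Suc_atMost)
  moreover have "(u, \<gamma>, v) \<in> edges (ed w) \<longleftrightarrow> (vs ! u, \<gamma>, vs ! v) \<in> edges G"
    if "u \<le> length w" "v \<le> length w" for u \<gamma> v
    using that succ[of u \<gamma> "vs ! v"] step[of u] dist len by (auto simp: ed_def nth_eq_iff_index_eq)
  ultimately have "graph_iso (ed w) G"
    unfolding graph_iso_def by (intro exI[of _ "nth vs"]) (auto simp: ed_def)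
  moreover have "w \<in> lists (set gs)" 
  proof -
    have "x \<in> set gs" if "x \<in> set w" for x
      using that step E by (metis in_set_conv_nth)
    then show ?thesis by auto
  qed
  ultimately show thesis using that graph_iso_sym by blast
qed

section \<open>Transductions given by recognizable node and edge languages\<close>

lemma sat1_diag:
  assumes "u \<in> verts G"
  shows "sat1 G (FExN 1 (FAnd (FEq 1 0) \<phi>)) u \<longleftrightarrow> sat2 G \<phi> u u"
  using assms by (auto simp: sat1_def sat2_def)

text \<open>Here the output nodes are configurations, that is, pairs of a tape position and a state.
  The left end marker has no node of its own, so each state yields two copies; the flagged one
  exists at node 0 only and represents position 0.\<close>

theorem MSO_ed_of_recog:
  fixes m :: "('a list \<times> 'b list) set" and K :: "'s set"
  assumes fin: "finite \<Sigma>1" "finite \<Sigma>2" "finite K" and m: "m \<subseteq> lists \<Sigma>1 \<times> lists \<Sigma>2"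
    and D: "recog D" "\<And>w. w \<in> lists \<Sigma>1 \<Longrightarrow> w \<in> Domain m \<longleftrightarrow> tape_word w \<in> D"
    and N: "\<And>s. recog (N s)" and E: "\<And>s s' b. recog (E s s' b)"
    and out: "\<And>w z. (w, z) \<in> m \<Longrightarrow> \<exists>vs. distinct vs \<and> length vs = Suc (length z) \<and>
      set vs = {(i, s). i < length w + 2 \<and> s \<in> K \<and> marked (tape_word w) i i \<in> N s} \<and>
      (\<forall>i s j s' b. (i, s) \<in> set vs \<longrightarrow> (j, s') \<in> set vs \<longrightarrow> b \<in> \<Sigma>2 \<longrightarrow>
         (marked (tape_word w) i j \<in> E s s' b \<longleftrightarrow>
           (\<exists>k<length z. vs ! k = (i, s) \<and> vs ! Suc k = (j, s') \<and> z ! k = b)))"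
  shows "MSO_ed \<Sigma>1 \<Sigma>2 m"
proof -
  obtain gs where gs: "set gs = \<Sigma>1" using fin(1) by (meson finite_list)
  have finK: "finite (K \<times> (UNIV :: bool set))" using fin(3) by simp
  obtain kc :: "'s \<times> bool \<Rightarrow> nat" where kc: "inj_on kc (K \<times> UNIV)"
    using finite_imp_inj_to_nat_seg[OF finK] by blast
  define C where "C = kc ` (K \<times> UNIV)"
  define dec where "dec = the_inv_into (K \<times> UNIV) kc"
  have dec: "dec (kc (s, b)) = (s, b)" if "s \<in> K" for s b
    unfolding dec_def by (rule the_inv_into_f_f[OF kc]) (use that in simp)
  have F: "\<exists>\<phi> :: (unit, 'a) mso. fvN \<phi> \<subseteq> {0, 1} \<and> fvS \<phi> = {} \<and>
    (\<forall>w\<in>lists \<Sigma>1. \<forall>u\<le>length w. \<forall>v\<le>length w.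
       sat2 (ed w) \<phi> u v \<longleftrightarrow> marked (tape_word w) (tpos b1 u) (tpos b2 v) \<in> L)" if "recog L" for L b1 b2
    by (rule formula_of_recog[OF fin(1) that])
  have "\<forall>s b. \<exists>\<phi> :: (unit, 'a) mso. fvN \<phi> \<subseteq> {0, 1} \<and> fvS \<phi> = {} \<and>
    (\<forall>w\<in>lists \<Sigma>1. \<forall>u\<le>length w. \<forall>v\<le>length w.
       sat2 (ed w) \<phi> u v \<longleftrightarrow> marked (tape_word w) (tpos b u) (tpos b v) \<in> N s)"
    using F[OF N] by blast
  then obtain FN where FN: "\<And>s b. fvN (FN s b) \<subseteq> {0, 1}" "\<And>s b. fvS (FN s b :: (unit, 'a) mso) = {}"
    "\<And>s b w u v. w \<in> lists \<Sigma>1 \<Longrightarrow> u \<le> length w \<Longrightarrow> v \<le> length w \<Longrightarrow>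
       sat2 (ed w) (FN s b) u v \<longleftrightarrow> marked (tape_word w) (tpos b u) (tpos b v) \<in> N s"
    by metis
  have "\<forall>s s' b1 b2 b. \<exists>\<phi> :: (unit, 'a) mso. fvN \<phi> \<subseteq> {0, 1} \<and> fvS \<phi> = {} \<and>
    (\<forall>w\<in>lists \<Sigma>1. \<forall>u\<le>length w. \<forall>v\<le>length w.
       sat2 (ed w) \<phi> u v \<longleftrightarrow> marked (tape_word w) (tpos b1 u) (tpos b2 v) \<in> E s s' b)"
    using F[OF E] by blast
  then obtain FE where FE: "\<And>s s' b1 b2 b. fvN (FE s s' b1 b2 b) \<subseteq> {0, 1}"
    "\<And>s s' b1 b2 b. fvS (FE s s' b1 b2 b :: (unit, 'a) mso) = {}"
    "\<And>s s' b1 b2 b w u v. w \<in> lists \<Sigma>1 \<Longrightarrow> u \<le> length w \<Longrightarrow> v \<le> length w \<Longrightarrow>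
       sat2 (ed w) (FE s s' b1 b2 b) u v \<longleftrightarrow> marked (tape_word w) (tpos b1 u) (tpos b2 v) \<in> E s s' b"
    by metis
  \<comment> \<open>Marks are erased before the test, so any pair of nodes can witness the two
    quantifiers that close the domain formula.\<close>
  have "recog {W. map fst W \<in> D}" by (rule recog_vimage[OF D(1)])
  then obtain FD :: "(unit, 'a) mso" where FD: "fvN FD \<subseteq> {0, 1}" "fvS FD = {}"
    "\<And>w u v. w \<in> lists \<Sigma>1 \<Longrightarrow> u \<le> length w \<Longrightarrow> v \<le> length w \<Longrightarrow>
       sat2 (ed w) FD u v \<longleftrightarrow> marked (tape_word w) (tpos False u) (tpos False v) \<in> {W. map fst W \<in> D}"
    using F[of "{W. map fst W \<in> D}" False False] by blast
  have FD': "sat2 (ed w) FD u v \<longleftrightarrow> tape_word w \<in> D" if "w \<in> lists \<Sigma>1" "u \<le> length w" "v \<le> length w" for w u v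
  proof -
    have "map fst (marked (tape_word w) i j) = tape_word w" for i j
      by (rule nth_equalityI) auto
    then show ?thesis using FD(3)[OF that] by simp
  qed
  define T :: "(unit, 'a, nat, unit, 'b) msot" where "T = \<lparr>
     tdom = FAnd (FString gs) (FExN 0 (FExN 1 FD)),
     tcopies = C, tnlabs = {()}, telabs = \<Sigma>2,
     tnode = (\<lambda>c _. case dec c of (s, b) \<Rightarrow>
        FAnd (if b then FFirst gs 1 0 else FNot FFalse) (FExN 1 (FAnd (FEq 1 0) (FN s b)))),
     tedge = (\<lambda>c d \<gamma>. case (dec c, dec d) of ((s, b), (s', b')) \<Rightarrow> FE s s' b b' \<gamma>)\<rparr>"
  have labs: "tnlabs T = {()}" by (simp add: T_def)
  have wf: "wf_msot T" unfolding wf_msot_def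
  proof (intro conjI allI)
    show "finite (tcopies T)" "finite (tnlabs T)" "finite (telabs T)"
      using fin finK by (simp_all add: T_def C_def)
    show "fvN (tdom T) = {}" "fvS (tdom T) = {}" using FD(1,2) by (auto simp: T_def)
    show "fvN (tnode T c \<sigma>) \<subseteq> {0}" for c \<sigma>
      using FN(1)[of "fst (dec c)" "snd (dec c)"] fv_FFirst(1)[of gs 1 0]
      by (auto simp: T_def split: prod.split)
    show "fvS (tnode T c \<sigma>) = {}" for c \<sigma>
      using FN(2)[of "fst (dec c)" "snd (dec c)"] fv_FFirst(2)[of gs 1 0]
      by (auto simp: T_def split: prod.split)
    show "fvN (tedge T c d \<gamma>) \<subseteq> {0, 1}" for c d \<gamma>
      using FE(1) by (simp add: T_def split: prod.split)
    show "fvS (tedge T c d \<gamma>) = {}" for c d \<gamma>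
      using FE(2) by (simp add: T_def split: prod.split)
  qed
  have node: "sat1 (ed w) (tnode T (kc (s, b)) ()) u \<longleftrightarrow>
      (b \<longrightarrow> u = 0) \<and> marked (tape_word w) (tpos b u) (tpos b u) \<in> N s"
    if "w \<in> lists \<Sigma>1" "u \<le> length w" "s \<in> K" for w u s b
  proof -
    have n1: "sat1 (ed w) (FFirst gs 1 0) u \<longleftrightarrow> u = 0"
      unfolding sat1_def using sat_FFirst[of w gs 1 0 "\<lambda>_. u"] that gs by simp
    have n2: "sat1 (ed w) (FExN 1 (FAnd (FEq 1 0) (FN s b))) u \<longleftrightarrow> sat2 (ed w) (FN s b) u u"
      by (rule sat1_diag) (use that in \<open>simp add: ed_def\<close>)
    have n3: "sat1 (ed w) (FAnd \<phi> \<psi>) u \<longleftrightarrow> sat1 (ed w) \<phi> u \<and> sat1 (ed w) \<psi> u"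
      for \<phi> \<psi> :: "(unit, 'a) mso" by (simp add: sat1_def)
    have n4: "sat1 (ed w) (if b then FFirst gs 1 0 else FNot FFalse) u \<longleftrightarrow> (b \<longrightarrow> u = 0)"
      using n1 by (cases b) (simp_all add: sat1_def)
    have "tnode T (kc (s, b)) () = FAnd (if b then FFirst gs 1 0 else FNot FFalse)
        (FExN 1 (FAnd (FEq 1 0) (FN s b)))"
      unfolding T_def by (simp add: dec[OF that(3)])
    then show ?thesis by (simp only: n3 n4 n2 FN(3)[OF that(1,2,2)])
  qed
  have dom: "apply_msot T (ed w) \<noteq> None \<longleftrightarrow> w \<in> Domain m" if "w \<in> lists \<Sigma>1" for w
  proof -
    have "sat (ed w) nv sv (FString gs)" for nv sv
      by (rule sat_FString_ed) (use that gs in simp)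
    moreover have "sat (ed w) (nv(0 := u, Suc 0 := v)) sv FD \<longleftrightarrow> w \<in> Domain m"
      if "u \<le> length w" "v \<le> length w" for nv sv u v
    proof -
      have "sat (ed w) (nv(0 := u, Suc 0 := v)) sv FD \<longleftrightarrow> sat2 (ed w) FD u v"
        unfolding sat2_def by (rule sat_cong) (use FD in auto)
      then show ?thesis using FD'[OF \<open>w \<in> lists \<Sigma>1\<close> that] D(2)[OF \<open>w \<in> lists \<Sigma>1\<close>] by simp
    qed
    ultimately show ?thesis by (auto simp: apply_msot_def T_def ed_def)
  qed
  have main: "graph_iso H (ed z)" if wz: "(w, z) \<in> m" and H: "apply_msot T (ed w) = Some H" for w z H
  proof -
    have w: "w \<in> lists \<Sigma>1" and z: "z \<in> lists \<Sigma>2" using wz m by auto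
    obtain vs where vs: "distinct vs" "length vs = Suc (length z)"
      "set vs = {(i, s). i < length w + 2 \<and> s \<in> K \<and> marked (tape_word w) i i \<in> N s}"
      and ev: "\<And>i s j s' b. (i, s) \<in> set vs \<Longrightarrow> (j, s') \<in> set vs \<Longrightarrow> b \<in> \<Sigma>2 \<Longrightarrow>
         marked (tape_word w) i j \<in> E s s' b \<longleftrightarrow>
           (\<exists>k<length z. vs ! k = (i, s) \<and> vs ! Suc k = (j, s') \<and> z ! k = b)"
      using out[OF wz] by blast
    \<comment> \<open>The bijection from configurations to pairs of a node and a copy, inverse to
      \<open>tpos\<close> on the position.\<close>
    define g where "g = (\<lambda>(i :: nat, s). if i = 0 then (0, kc (s, True)) else (i - 1, kc (s, False)))"
    have kcinj: "kc (s, b) = kc (s', b') \<longleftrightarrow> s = s' \<and> b = b'" if "s \<in> K" "s' \<in> K" for s s' b b'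
      using kc that by (auto simp: inj_on_def)
    have g_inj: "inj_on g (set vs)"
      using vs(3) kcinj by (auto simp: inj_on_def g_def)
    have vertsH: "verts H = g ` set vs"
    proof (intro set_eqI iffI)
      fix p assume p: "p \<in> verts H"
      obtain u c where uc: "p = (u, c)" by fastforce
      have u: "u \<le> length w" and c: "c \<in> C" and n: "sat1 (ed w) (tnode T c ()) u"
        using p uc apply_msot_verts[OF H labs] by (auto simp: ed_def T_def)
      obtain s b where s: "s \<in> K" "c = kc (s, b)" using c by (auto simp: C_def)
      have "b \<longrightarrow> u = 0" "marked (tape_word w) (tpos b u) (tpos b u) \<in> N s"
        using node[OF w u s(1)] n s(2) by auto
      then have "(tpos b u, s) \<in> set vs" "g (tpos b u, s) = p"
        using vs(3) u s uc by (auto simp: tpos_def g_def)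
      then show "p \<in> g ` set vs" by force
    next
      fix p assume "p \<in> g ` set vs"
      then obtain i s where isv: "p = g (i, s)" "i < length w + 2" "s \<in> K" "marked (tape_word w) i i \<in> N s"
        using vs(3) by auto
      show "p \<in> verts H"
      proof (cases "i = 0")
        case True
        then show ?thesis using isv node[OF w, of 0 s True]
          by (auto simp: g_def apply_msot_verts[OF H labs] tpos_def ed_def T_def C_def)
      next
        case False
        then show ?thesis using isv node[OF w, of "i - 1" s False]
          by (auto simp: g_def apply_msot_verts[OF H labs] tpos_def ed_def T_def C_def)
      qed
    qed
    have edgeH: "(g (i, s), \<gamma>, g (j, s')) \<in> edges H \<longleftrightarrow> \<gamma> \<in> \<Sigma>2 \<and> marked (tape_word w) i j \<in> E s s' \<gamma>"
      if isv: "(i, s) \<in> set vs" "(j, s') \<in> set vs" for i s j s' \<gamma>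
    proof -
      define u v b b' where "u = i - 1" and "v = j - 1" and "b \<longleftrightarrow> i = 0" and "b' \<longleftrightarrow> j = 0"
      have bounds: "u \<le> length w" "v \<le> length w" "s \<in> K" "s' \<in> K"
        using isv vs(3) by (auto simp: u_def v_def)
      have t: "tpos b u = i" "tpos b' v = j" by (auto simp: tpos_def u_def v_def b_def b'_def)
      have gg: "g (i, s) = (u, kc (s, b))" "g (j, s') = (v, kc (s', b'))"
        by (auto simp: g_def u_def v_def b_def b'_def)
      have "g (i, s) \<in> verts H" "g (j, s') \<in> verts H" using isv vertsH by auto
      then have "(g (i, s), \<gamma>, g (j, s')) \<in> edges H \<longleftrightarrow> \<gamma> \<in> \<Sigma>2 \<and> sat2 (ed w) (FE s s' b b' \<gamma>) u v"
        unfolding gg apply_msot_edges[OF H] using bounds by (simp add: T_def dec)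
      then show ?thesis using FE(3)[OF w bounds(1,2)] t by simp
    qed
    have "bij_betw (nth vs) {0..length z} (set vs)"
      using bij_betw_nth[OF vs(1), of "{0..length z}" "set vs"] vs(2)
      by (simp add: atLeast0AtMost lessThan_Suc_atMost)
    moreover have "bij_betw g (set vs) (verts H)"
      using g_inj vertsH by (simp add: bij_betw_def)
    ultimately have bij: "bij_betw (g \<circ> nth vs) {0..length z} (verts H)"
      by (rule bij_betw_trans)
    have "(x, \<gamma>, y) \<in> edges (ed z) \<longleftrightarrow> ((g \<circ> nth vs) x, \<gamma>, (g \<circ> nth vs) y) \<in> edges H"
      if xy: "x \<le> length z" "y \<le> length z" for x \<gamma> y
    proof -
      obtain i s j s' where isv: "vs ! x = (i, s)" "vs ! y = (j, s')" by fastforce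
      have mem: "(i, s) \<in> set vs" "(j, s') \<in> set vs"
        using isv xy vs(2) nth_mem[of x vs] nth_mem[of y vs] by auto
      have "((g \<circ> nth vs) x, \<gamma>, (g \<circ> nth vs) y) \<in> edges H \<longleftrightarrow>
          \<gamma> \<in> \<Sigma>2 \<and> (\<exists>k<length z. vs ! k = (i, s) \<and> vs ! Suc k = (j, s') \<and> z ! k = \<gamma>)"
        using edgeH[OF mem] ev[OF mem] isv by auto
      also have "\<dots> \<longleftrightarrow> \<gamma> \<in> \<Sigma>2 \<and> (\<exists>k<length z. k = x \<and> Suc k = y \<and> z ! k = \<gamma>)"
      proof -
        have "vs ! k = (i, s) \<longleftrightarrow> k = x" "vs ! Suc k = (j, s') \<longleftrightarrow> Suc k = y" if "k < length z" for k
          using isv xy that vs(1,2) nth_eq_iff_index_eq[of vs k x] nth_eq_iff_index_eq[of vs "Suc k" y] by auto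
        then show ?thesis by blast
      qed
      also have "\<dots> \<longleftrightarrow> (x, \<gamma>, y) \<in> edges (ed z)"
        using z by (auto simp: ed_def in_lists_conv_set)
      finally show ?thesis by simp
    qed
    then have "graph_iso (ed z) H"
      unfolding graph_iso_def using bij by (intro exI[of _ "g \<circ> nth vs"]) (auto simp: ed_def)
    then show ?thesis by (rule graph_iso_sym)
  qed
  have A: "\<exists>H. apply_msot T (ed w) = Some H \<and> graph_iso H (ed z)" if "(w, z) \<in> m" for w z
  proof -
    have "w \<in> lists \<Sigma>1" "w \<in> Domain m" using that m by auto
    then obtain H where "apply_msot T (ed w) = Some H" using dom by blast
    then show ?thesis using main[OF that] by blast
  qed
  have B: "\<exists>(w, z)\<in>m. graph_iso G (ed w) \<and> graph_iso H (ed z)"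
    if G: "graph_over {()} \<Sigma>1 G" and H: "apply_msot T G = Some H" for G :: "(nat, unit, 'a) graph" and H
  proof -
    have "sat G (\<lambda>_. undefined) (\<lambda>_. {}) (FString gs)"
      using H by (simp add: apply_msot_def T_def split: if_splits)
    then obtain w where w: "w \<in> lists \<Sigma>1" "graph_iso G (ed w)"
      using FString_ed_iso[of gs G] G gs by blast
    obtain H' where H': "apply_msot T (ed w) = Some H'" "graph_iso H H'"
      using apply_msot_iso[OF wf w(2) H] by blast
    then obtain z where z: "(w, z) \<in> m" using dom[OF w(1)] by auto
    show ?thesis using z w(2) graph_iso_trans[OF H'(2) main[OF z H'(1)]] by blast
  qed
  show ?thesis unfolding MSO_ed_def
  proof (intro exI[of _ T] conjI ballI allI impI)
    show "wf_msot T" "tnlabs T = {()}" "telabs T = \<Sigma>2" using wf by (simp_all add: T_def)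
    fix p assume "p \<in> m"
    then show "case p of (w, z) \<Rightarrow> \<exists>H. apply_msot T (ed w) = Some H \<and> graph_iso H (ed z)"
      using A[of "fst p" "snd p"] by (simp only: prod.collapse case_prod_unfold)
  qed (rule B)
qed

section \<open>Reachability in two-way systems\<close>

definition cstep :: "('x \<Rightarrow> ('s \<times> 's \<times> int) set) \<Rightarrow> 'x list \<Rightarrow> nat \<times> 's \<Rightarrow> nat \<times> 's \<Rightarrow> bool" where
  "cstep st W = (\<lambda>(i, s) (j, t). i < length W \<and> j < length W \<and>
     (\<exists>e. (s, t, e) \<in> st (W ! i) \<and> int j = int i + e))"

text \<open>Non-reachability is witnessed by an annotation of the positions with sets of states that is
  closed under the steps; closedness is a condition on neighbouring letters.\<close>
lemma recog_reach:
  fixes st :: "'x \<Rightarrow> ('s \<times> 's \<times> int) set"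
  assumes S: "finite S" and st: "\<And>x. st x \<subseteq> S \<times> S \<times> {-1, 0, 1}" and src: "\<And>x. src x \<subseteq> S"
  shows "recog {W. \<exists>i s j t. i < length W \<and> s \<in> src (W ! i) \<and> j < length W \<and> t \<in> tgt (W ! j) \<and>
    (cstep st W)\<^sup>*\<^sup>* (i, s) (j, t)}"
proof -
  define move where "move e x X = {t. \<exists>s\<in>X. (s, t, e) \<in> st x}" for e x X
  \<comment> \<open>Steps that do not move are checked within a letter, together with the inclusion
    of sources and the exclusion of targets; moving steps are left to \<open>adj\<close>.\<close>
  define local where "local = (\<lambda>(x, X). X \<subseteq> S \<and> src x \<subseteq> X \<and> X \<inter> tgt x = {} \<and> move 0 x X \<subseteq> X)"
  define adj where "adj = (\<lambda>(x, X) (y, Y). move 1 x X \<subseteq> Y \<and> move (-1) y Y \<subseteq> X)"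
  have moveS: "move e x X \<subseteq> S" for e x X using st by (auto simp: move_def)
  have "recog {V. successively adj V}"
  \<comment> \<open>An annotation may be any set, so the summaries intersect it with
    \<open>S\<close> to become finite. Inclusions are unaffected because moves only lead to states
    in \<open>S\<close>.\<close>
  proof (rule recog_successively[where l = "\<lambda>(x, X). (X \<inter> S, move 1 x X)"
        and r = "\<lambda>(y, Y). (Y \<inter> S, move (-1) y Y)" and Q' = "\<lambda>(X, A) (Y, B). A \<subseteq> Y \<and> B \<subseteq> X"])
    have "range (\<lambda>(x, X). (X \<inter> S, move 1 x X)) \<subseteq> Pow S \<times> Pow S" using moveS by auto
    then show "finite (range (\<lambda>(x, X). (X \<inter> S, move 1 x X)))"
      by (rule finite_subset) (use S in simp)
    have "range (\<lambda>(x, X). (X \<inter> S, move (-1) x X)) \<subseteq> Pow S \<times> Pow S" using moveS by auto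
    then show "finite (range (\<lambda>(x, X). (X \<inter> S, move (-1) x X)))"
      by (rule finite_subset) (use S in simp)
    show "adj p q = (case case p of (x, X) \<Rightarrow> (X \<inter> S, move 1 x X) of (X, A) \<Rightarrow>
      \<lambda>(Y, B). A \<subseteq> Y \<and> B \<subseteq> X) (case q of (y, Y) \<Rightarrow> (Y \<inter> S, move (-1) y Y))" for p q
      using moveS by (auto simp: adj_def split: prod.splits)
  qed
  then have "recog {V. (\<forall>p\<in>set V. local p) \<and> successively adj V}"
    by (intro recog_conj recog_all_letter)
  from recog_Not[OF recog_ex_annot[OF this]]
  have rec: "recog {W. \<not> (\<exists>Xs. length Xs = length W \<and> (\<forall>p\<in>set (zip W Xs). local p) \<and> successively adj (zip W Xs))}" .
  have eq: "(\<exists>Xs. length Xs = length W \<and> (\<forall>p\<in>set (zip W Xs). local p) \<and> successively adj (zip W Xs)) \<longleftrightarrow>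
    (\<exists>Xs. length Xs = length W \<and> (\<forall>i<length W. local (W ! i, Xs ! i)) \<and>
      (\<forall>i. Suc i < length W \<longrightarrow> adj (W ! i, Xs ! i) (W ! Suc i, Xs ! Suc i)))" for W
    by (intro ex_cong1 conj_cong refl) (auto simp: successively_nth set_zip)
  have "(\<exists>i s j t. i < length W \<and> s \<in> src (W ! i) \<and> j < length W \<and> t \<in> tgt (W ! j) \<and>
      (cstep st W)\<^sup>*\<^sup>* (i, s) (j, t)) \<longleftrightarrow>
    \<not> (\<exists>Xs. length Xs = length W \<and> (\<forall>i<length W. local (W ! i, Xs ! i)) \<and>
      (\<forall>i. Suc i < length W \<longrightarrow> adj (W ! i, Xs ! i) (W ! Suc i, Xs ! Suc i)))" (is "?l \<longleftrightarrow> \<not> ?r") for W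
  proof
    assume ?l
    then obtain i s j t where a: "i < length W" "s \<in> src (W ! i)" "j < length W" "t \<in> tgt (W ! j)"
      "(cstep st W)\<^sup>*\<^sup>* (i, s) (j, t)" by blast
    show "\<not> ?r"
    proof
      assume ?r
      then obtain Xs where Xs: "\<And>i. i < length W \<Longrightarrow> local (W ! i, Xs ! i)"
        "\<And>i. Suc i < length W \<Longrightarrow> adj (W ! i, Xs ! i) (W ! Suc i, Xs ! Suc i)" by blast
      have "snd \<kappa> \<in> Xs ! fst \<kappa>" if "(cstep st W)\<^sup>*\<^sup>* (i, s) \<kappa>" for \<kappa>
        using that
      proof (induction rule: rtranclp_induct)
        case base
        then show ?case using Xs(1)[OF a(1)] a(2) by (auto simp: local_def)
      next
        case (step \<kappa> \<kappa>')
        obtain k x k' x' where k: "\<kappa> = (k, x)" "\<kappa>' = (k', x')" by fastforce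
        then obtain e where e: "k < length W" "k' < length W" "(x, x', e) \<in> st (W ! k)" "int k' = int k + e"
          using step(2) by (auto simp: cstep_def)
        have x: "x \<in> Xs ! k" using step(3) k by simp
        consider "e = 0" | "e = 1" | "e = -1" using st[of "W ! k"] e(3) by blast
        then have "x' \<in> Xs ! k'"
        proof cases
          case 1
          then show ?thesis using e x Xs(1)[OF e(1)] by (auto simp: local_def move_def)
        next
          case 2
          then have k': "k' = Suc k" using e by simp
          have "adj (W ! k, Xs ! k) (W ! Suc k, Xs ! Suc k)" using e(2) k' Xs(2) by simp
          then show ?thesis unfolding k' using 2 e(3) x by (auto simp: adj_def move_def)
        next
          case 3
          then have k: "k = Suc k'" using e by simp
          have "adj (W ! k', Xs ! k') (W ! Suc k', Xs ! Suc k')" using e(1) k Xs(2) by simp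
          then show ?thesis using 3 e(3) x unfolding k by (auto simp: adj_def move_def)
        qed
        then show ?case using k by simp
      qed
      from this[OF a(5)] show False using Xs(1)[OF a(3)] a(4) by (auto simp: local_def)
    qed
  next
    assume nr: "\<not> ?r"
    \<comment> \<open>The least closed annotation consists of what is actually reachable. If no
      target is reachable, it is a certificate.\<close>
    define X where "X k = {x. \<exists>i s. i < length W \<and> s \<in> src (W ! i) \<and> (cstep st W)\<^sup>*\<^sup>* (i, s) (k, x)}" for k
    have XS: "X k \<subseteq> S" for k
    proof
      fix x assume "x \<in> X k"
      then obtain i s where isv: "s \<in> src (W ! i)" "(cstep st W)\<^sup>*\<^sup>* (i, s) (k, x)" by (auto simp: X_def)
      show "x \<in> S"
        using isv(2)
      proof (cases rule: rtranclp.cases)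
        case rtrancl_refl
        then show ?thesis using isv(1) src by auto
      next
        case (rtrancl_into_rtrancl b)
        then show ?thesis using st by (fastforce simp: cstep_def split: prod.splits)
      qed
    qed
    have Xcl: "x' \<in> X k'" if "x \<in> X k" "cstep st W (k, x) (k', x')" for k x k' x'
      using that unfolding X_def by (auto intro: rtranclp.rtrancl_into_rtrancl)
    have XSrc: "src (W ! k) \<subseteq> X k" if "k < length W" for k
      using that unfolding X_def by blast
    show ?l
    proof (rule ccontr)
      assume nl: "\<not> ?l"
      have "X k \<inter> tgt (W ! k) = {}" if "k < length W" for k
        using nl that unfolding X_def by blast
      then have "local (W ! i, map X [0..<length W] ! i)" if "i < length W" for i
        using that XS XSrc Xcl[of _ i i] by (auto simp: local_def move_def cstep_def)
      moreover have "adj (W ! i, map X [0..<length W] ! i) (W ! Suc i, map X [0..<length W] ! Suc i)"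
        if "Suc i < length W" for i
        using that Xcl[of _ i "Suc i"] Xcl[of _ "Suc i" i] by (force simp: adj_def move_def cstep_def)
      moreover have "length (map X [0..<length W]) = length W" by simp
      ultimately show False using nr by blast
    qed
  qed
  then show ?thesis using rec unfolding eq by simp
qed

section \<open>Output positions of a deterministic run\<close>

inductive run :: "('k \<Rightarrow> 'b option \<Rightarrow> 'k \<Rightarrow> bool) \<Rightarrow> 'k \<Rightarrow> 'b list \<Rightarrow> 'k \<Rightarrow> bool" for step where
  run_refl: "run step k [] k"
| run_silent: "step k None k' \<Longrightarrow> run step k' z k'' \<Longrightarrow> run step k z k''"
| run_emit: "step k (Some b) k' \<Longrightarrow> run step k' z k'' \<Longrightarrow> run step k (b # z) k''"

text \<open>This turns a run into a string graph. Its nodes are the emitting configurations together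
  with the final one, which supplies the extra node of a path with \<open>length z\<close> edges; an
  edge is one emission followed by silent steps. Nodes are distinct because a repeated configuration
  would make a deterministic run infinite.\<close>

lemma run_visible:
  fixes step :: "'k \<Rightarrow> 'b option \<Rightarrow> 'k \<Rightarrow> bool"
  assumes det: "\<And>k o1 k1 o2 k2. step k o1 k1 \<Longrightarrow> step k o2 k2 \<Longrightarrow> o1 = o2 \<and> k1 = k2"
    and fin: "\<And>k o1 k1. k \<in> F \<Longrightarrow> \<not> step k o1 k1"
    and "run step k z k'" "k' \<in> F"
  defines "vis x \<equiv> x \<in> F \<or> (\<exists>b y. step x (Some b) y)"
    and "silent x y \<equiv> step x None y" and "reach \<equiv> (\<lambda>x y. \<exists>ob. step x ob y)\<^sup>*\<^sup>*"
  shows "\<exists>vs. distinct vs \<and> length vs = Suc (length z) \<and> set vs = {x. reach k x \<and> vis x} \<and>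
    silent\<^sup>*\<^sup>* k (hd vs) \<and> (\<forall>x y b. x \<in> set vs \<longrightarrow> y \<in> set vs \<longrightarrow>
      ((\<exists>x'. step x (Some b) x' \<and> silent\<^sup>*\<^sup>* x' y) \<longleftrightarrow> (\<exists>i<length z. vs ! i = x \<and> vs ! Suc i = y \<and> z ! i = b)))"
  using assms(3,4)
proof (induction rule: run.induct)
  case (run_refl k)
  have "{x. reach k x \<and> vis x} = {k}"
    unfolding reach_def using fin[OF run_refl] run_refl by (auto simp: vis_def elim: converse_rtranclpE)
  then show ?case using fin[OF run_refl] by (intro exI[of _ "[k]"]) auto
next
  case (run_silent k k1 z k2)
  then obtain vs where vs: "distinct vs" "length vs = Suc (length z)" "set vs = {x. reach k1 x \<and> vis x}"
    "silent\<^sup>*\<^sup>* k1 (hd vs)" "\<forall>x y b. x \<in> set vs \<longrightarrow> y \<in> set vs \<longrightarrow>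
      ((\<exists>x'. step x (Some b) x' \<and> silent\<^sup>*\<^sup>* x' y) \<longleftrightarrow> (\<exists>i<length z. vs ! i = x \<and> vs ! Suc i = y \<and> z ! i = b))"
    by blast
  have "\<not> vis k" using det[OF run_silent(1)] fin run_silent(1) unfolding vis_def by blast
  have "reach k x \<longleftrightarrow> x = k \<or> reach k1 x" for x
  proof
    assume "reach k x"
    then show "x = k \<or> reach k1 x" unfolding reach_def
      by (cases rule: converse_rtranclpE) (use det[OF run_silent(1)] in blast)+
  next
    assume "x = k \<or> reach k1 x"
    then show "reach k x" unfolding reach_def
      using run_silent(1) by (auto intro: converse_rtranclp_into_rtranclp)
  qed
  then have "set vs = {x. reach k x \<and> vis x}" using vs(3) \<open>\<not> vis k\<close> by auto
  moreover have "silent\<^sup>*\<^sup>* k (hd vs)"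
    using run_silent(1) vs(4) by (auto simp: silent_def intro: converse_rtranclp_into_rtranclp)
  ultimately show ?case using vs by blast
next
  case (run_emit k b0 k1 z k2)
  then obtain vs where vs: "distinct vs" "length vs = Suc (length z)" "set vs = {x. reach k1 x \<and> vis x}"
    "silent\<^sup>*\<^sup>* k1 (hd vs)" and ed: "\<And>x y b. x \<in> set vs \<Longrightarrow> y \<in> set vs \<Longrightarrow>
      (\<exists>x'. step x (Some b) x' \<and> silent\<^sup>*\<^sup>* x' y) \<longleftrightarrow> (\<exists>i<length z. vs ! i = x \<and> vs ! Suc i = y \<and> z ! i = b)"
    by blast
  have rk: "reach k x \<longleftrightarrow> x = k \<or> reach k1 x" for x
  proof
    assume "reach k x"
    then show "x = k \<or> reach k1 x" unfolding reach_def
      by (cases rule: converse_rtranclpE) (use det[OF run_emit(1)] in blast)+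
  next
    assume "x = k \<or> reach k1 x"
    then show "reach k x" unfolding reach_def
      using run_emit(1) by (auto intro: converse_rtranclp_into_rtranclp)
  qed
  \<comment> \<open>The configuration \<open>k\<close> cannot recur, as the run from it is finite and deterministic.\<close>
  have fin_run: "\<exists>n. ((\<lambda>x y. \<exists>ob. step x ob y) ^^ n) x k' \<and> k' \<in> F" if "run step x z' k'" "k' \<in> F" for x z' k'
  proof -
    from that(1) have "reach x k'" unfolding reach_def
      by (induction rule: run.induct) (auto intro: converse_rtranclp_into_rtranclp)
    then show ?thesis using that(2) unfolding reach_def by (auto dest: rtranclp_imp_relpowp)
  qed
  have nocycle: "\<not> reach k1 k"
  proof
    assume "reach k1 k"
    let ?R = "\<lambda>x y. \<exists>ob. step x ob y"
    \<comment> \<open>If \<open>k1\<close> led back to \<open>k\<close>, determinism would put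
      everything reachable from \<open>k1\<close> on a cycle; all of it would have successors, so
      nothing there could be in \<open>F\<close>.\<close>
    have inf: "\<not> (?R ^^ n) x k' \<or> k' \<notin> F" if "reach k1 x" for n x k'
      using that
    proof (induction n arbitrary: x)
      case 0
      have "\<exists>y. ?R x y"
      proof -
        have "reach x k"
          using 0 unfolding reach_def
        proof (induction rule: rtranclp_induct)
          case base
          then show ?case using \<open>reach k1 k\<close> by (simp add: reach_def)
        next
          case (step x y)
          from step(3) show ?case
          proof (cases rule: converse_rtranclpE)
            case base
            then have "y = k1" using step(2) det run_emit(1) by blast
            then show ?thesis using \<open>reach k1 k\<close> by (simp add: reach_def)
          next
            case (step y')
            then have "y' = y" using \<open>?R x y\<close> det by blast
            then show ?thesis using step by simp
          qed
        qed
        then show ?thesis unfolding reach_def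
          by (cases rule: converse_rtranclpE) (use run_emit(1) in blast)+
      qed
      then show ?case using fin by auto
    next
      case (Suc n)
      have "reach k1 y" if "?R x y" for y
        using Suc.prems that unfolding reach_def by (rule rtranclp.rtrancl_into_rtrancl)
      then have IH: "\<not> (?R ^^ n) y k' \<or> k' \<notin> F" if "?R x y" for y
        using Suc.IH[of y] that by blast
      show ?case
      proof (cases "(?R ^^ Suc n) x k'")
        case True
        then obtain y where "?R x y" "(?R ^^ n) y k'" by (rule relpowp_Suc_E2)
        then show ?thesis using IH by blast
      qed simp
    qed
    show False using fin_run[OF run_emit(2,4)] inf[of k1] by (auto simp: reach_def)
  qed
  have visk: "vis k" using run_emit(1) by (auto simp: vis_def)
  have knot: "k \<notin> set vs" using vs(3) nocycle by simp
  have hdvs: "hd vs \<in> set vs" "vs ! 0 = hd vs" using vs(2) by (cases vs; simp)+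
  \<comment> \<open>A visible configuration has no silent step, so silent steps from a given
    configuration can end in at most one visible configuration.\<close>
  have silent_unique: "y = y'" if "silent\<^sup>*\<^sup>* x y" "silent\<^sup>*\<^sup>* x y'" "vis y" "vis y'" for x y y'
  proof -
    have stuck: "\<not> silent y z" if "vis y" for y z
      using that fin det unfolding vis_def silent_def by blast
    from that(1,2) show ?thesis
    proof (induction rule: converse_rtranclp_induct)
      case base
      then show ?case using stuck[OF that(3)] by (metis converse_rtranclpE)
    next
      case (step x x1)
      from step(4) show ?case
      proof (cases rule: converse_rtranclpE)
        case base
        then show ?thesis using stuck[OF that(4)] step(1) by blast
      next
        case (step x2)
        then have "x2 = x1" using \<open>silent x x1\<close> det unfolding silent_def by blast
        then show ?thesis using step(2) \<open>silent\<^sup>*\<^sup>* x1 y' \<Longrightarrow> y = y'\<close> by simp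
      qed
    qed
  qed
  have silent_reach: "reach x y" if "silent\<^sup>*\<^sup>* x y" for x y
    using that unfolding reach_def silent_def by (rule rtranclp_mono[THEN predicate2D, rotated]) blast
  have "(\<exists>x'. step x (Some b) x' \<and> silent\<^sup>*\<^sup>* x' y) \<longleftrightarrow>
      (\<exists>i<length (b0 # z). (k # vs) ! i = x \<and> (k # vs) ! Suc i = y \<and> (b0 # z) ! i = b)"
    if xy: "x \<in> set (k # vs)" "y \<in> set (k # vs)" for x y b
  proof (cases "x = k")
    case True
    have "(\<exists>x'. step x (Some b) x' \<and> silent\<^sup>*\<^sup>* x' y) \<longleftrightarrow> b = b0 \<and> silent\<^sup>*\<^sup>* k1 y"
      using True det run_emit(1) by blast
    also have "\<dots> \<longleftrightarrow> b = b0 \<and> y = hd vs"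
      using silent_unique[of k1 y "hd vs"] vs(3,4) hdvs(1) xy(2) visk by auto
    also have "\<dots> \<longleftrightarrow> (\<exists>i<length (b0 # z). (k # vs) ! i = x \<and> (k # vs) ! Suc i = y \<and> (b0 # z) ! i = b)"
    proof -
      have "i = 0" if "i < length (b0 # z)" "(k # vs) ! i = k" for i
      proof (rule ccontr)
        assume "i \<noteq> 0"
        then show False using that knot vs(2) nth_mem[of "i - 1" vs] by (cases i) auto
      qed
      then have "i < length (b0 # z) \<and> (k # vs) ! i = k \<longleftrightarrow> i = 0" for i by auto
      then have "(\<exists>i<length (b0 # z). (k # vs) ! i = x \<and> (k # vs) ! Suc i = y \<and> (b0 # z) ! i = b) \<longleftrightarrow>
          (\<exists>i. i = 0 \<and> (k # vs) ! Suc i = y \<and> (b0 # z) ! i = b)"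
        unfolding True by blast
      then show ?thesis using hdvs(2) by auto
    qed
    finally show ?thesis .
  next
    case False
    then have x: "x \<in> set vs" using xy by simp
    show ?thesis
    proof (cases "y = k")
      case True
      have "\<not> (\<exists>x'. step x (Some b) x' \<and> silent\<^sup>*\<^sup>* x' y)"
      proof
        assume "\<exists>x'. step x (Some b) x' \<and> silent\<^sup>*\<^sup>* x' y"
        then obtain x' where "step x (Some b) x'" "reach x' k" using silent_reach True by blast
        moreover have "reach k1 x" using x vs(3) by simp
        ultimately have "reach k1 k" unfolding reach_def
          by (metis (mono_tags, lifting) rtranclp.rtrancl_into_rtrancl rtranclp_trans)
        then show False using nocycle by simp
      qed
      moreover have "(k # vs) ! Suc i \<noteq> k" if "i < length (b0 # z)" for i
        using that knot vs(2) nth_mem[of i vs] by auto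
      ultimately show ?thesis using True by auto
    next
      case False
      then have y: "y \<in> set vs" using xy by simp
      have "(\<exists>i<length (b0 # z). (k # vs) ! i = x \<and> (k # vs) ! Suc i = y \<and> (b0 # z) ! i = b) \<longleftrightarrow>
          (\<exists>i<length z. vs ! i = x \<and> vs ! Suc i = y \<and> z ! i = b)"
        using \<open>x \<noteq> k\<close> by (auto simp: less_Suc_eq_0_disj)
      then show ?thesis using ed[OF x y] by simp
    qed
  qed
  note edges = this
  have "set (k # vs) = {x. reach k x \<and> vis x}" using vs(3) rk visk by auto
  moreover have "distinct (k # vs)" "length (k # vs) = Suc (length (b0 # z))" "silent\<^sup>*\<^sup>* k (hd (k # vs))"
    using vs(1,2) knot by simp_all
  ultimately show ?case using edges by blast
qed

section \<open>Uniformization of two-way machines\<close>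

type_synonym ('s,'a,'b) rule = "'s \<times> 'a tsym \<times> 's \<times> 'b option \<times> int"

text \<open>Rules may depend on the position: a constant family is the machine itself, a varying one
  is a positional strategy for it. Emitting at most one letter per step makes each step contribute
  at most one edge to the output graph.\<close>

definition mstep :: "(nat \<Rightarrow> ('s,'a,'b) rule set) \<Rightarrow> 'a list \<Rightarrow> nat \<times> 's \<Rightarrow> 'b option \<Rightarrow> nat \<times> 's \<Rightarrow> bool" where
  "mstep D w = (\<lambda>(i, s) ob (j, t). i < length w + 2 \<and> j < length w + 2 \<and>
     (\<exists>e. (s, tape w i, t, ob, e) \<in> D i \<and> int j = int i + e))"

definition deterministic :: "('s,'a,'b) rule set \<Rightarrow> bool" where
  "deterministic D \<longleftrightarrow> (\<forall>s \<sigma> r r'. (s, \<sigma>, r) \<in> D \<longrightarrow> (s, \<sigma>, r') \<in> D \<longrightarrow> r = r')"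

lemma mstep_det:
  assumes "\<And>i. deterministic (D i)" "mstep D w k o1 k1" "mstep D w k o2 k2"
  shows "o1 = o2 \<and> k1 = k2"
proof -
  obtain i s where k: "k = (i, s)" by fastforce
  obtain e1 e2 where "(s, tape w i, snd k1, o1, e1) \<in> D i" "(s, tape w i, snd k2, o2, e2) \<in> D i"
    "int (fst k1) = int i + e1" "int (fst k2) = int i + e2"
    using assms(2,3) k by (auto simp: mstep_def split: prod.splits)
  moreover from this have "(snd k1, o1, e1) = (snd k2, o2, e2)"
    using assms(1)[of i] unfolding deterministic_def by blast
  ultimately show ?thesis by (auto simp: prod_eq_iff)
qed

lemma run_mono:
  assumes "run step k z k'" "\<And>x ob y. step x ob y \<Longrightarrow> step' x ob y"
  shows "run step' k z k'"
  using assms(1) by (induction rule: run.induct) (auto intro: run.intros assms(2))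

lemma ex_run_iff_reach: "(\<exists>z. run step k z k') \<longleftrightarrow> (\<lambda>x y. \<exists>ob. step x ob y)\<^sup>*\<^sup>* k k'"
proof
  assume "\<exists>z. run step k z k'"
  then obtain z where "run step k z k'" by blast
  then show "(\<lambda>x y. \<exists>ob. step x ob y)\<^sup>*\<^sup>* k k'"
    by (induction rule: run.induct) (auto intro: converse_rtranclp_into_rtranclp)
next
  assume "(\<lambda>x y. \<exists>ob. step x ob y)\<^sup>*\<^sup>* k k'"
  then show "\<exists>z. run step k z k'"
  proof (induction rule: converse_rtranclp_induct)
    case (step x y)
    then obtain ob z where "step x ob y" "run step y z k'" by blast
    then show ?case by (cases ob) (auto intro: run.intros)
  qed (auto intro: run.intros)
qed

text \<open>Positional strategies: choosing at every configuration a step towards the target that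
  decreases the distance makes the machine deterministic without losing acceptance.\<close>
lemma ex_strategy:
  assumes reach: "(\<lambda>x y. \<exists>ob. mstep (\<lambda>_. \<Delta>) w x ob y)\<^sup>*\<^sup>* k k'" "snd k' \<in> F"
  obtains D where "\<And>i. D i \<subseteq> \<Delta>" "\<And>i. deterministic (D i)"
    "\<exists>k'. snd k' \<in> F \<and> (\<lambda>x y. \<exists>ob. mstep D w x ob y)\<^sup>*\<^sup>* k k'"
proof -
  let ?R = "\<lambda>x y. \<exists>ob. mstep (\<lambda>_. \<Delta>) w x ob y"
  define good where "good n x \<longleftrightarrow> (\<exists>y. snd y \<in> F \<and> (?R ^^ n) x y)" for n x
  define dist where "dist x = (LEAST n. good n x)" for x
  have dec: "\<exists>s' ob e j. (snd x, tape w (fst x), s', ob, e) \<in> \<Delta> \<and> int j = int (fst x) + e \<and>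
      fst x < length w + 2 \<and> j < length w + 2 \<and> good n (j, s')" if g: "good (Suc n) x" for x n
  proof -
    obtain y where "snd y \<in> F" "(?R ^^ Suc n) x y" using g unfolding good_def by blast
    from this(2) obtain x1 where "?R x x1" "(?R ^^ n) x1 y" by (rule relpowp_Suc_E2)
    then have "?R x x1" "good n x1" using \<open>snd y \<in> F\<close> unfolding good_def by blast+
    then show ?thesis unfolding mstep_def by (cases x; cases x1) auto
  qed
  \<comment> \<open>The chosen step leads to a configuration from which \<open>F\<close> is
    reachable in one step less than the current distance; this is the measure of the induction
    below.\<close>
  define pick where "pick x = (SOME (s', ob, e). (snd x, tape w (fst x), s', ob, e) \<in> \<Delta> \<and>
     (\<exists>j. int j = int (fst x) + e \<and> fst x < length w + 2 \<and> j < length w + 2 \<and> good (dist x - 1) (j, s')))" for x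
  \<comment> \<open>Where no suitable step exists the choice is arbitrary, and the membership test
    discards it unless it happens to be a rule.\<close>
  define D where "D i = {(s, tape w i, pick (i, s)) | s. (s, tape w i, pick (i, s)) \<in> \<Delta>}" for i
  have "\<exists>k'. snd k' \<in> F \<and> (\<lambda>x y. \<exists>ob. mstep D w x ob y)\<^sup>*\<^sup>* x k'" if "good n x" for n x
    using that
  proof (induction n arbitrary: x rule: less_induct)
    case (less n)
    have gd: "good (dist x) x" and le: "dist x \<le> n"
      using less.prems unfolding dist_def by (auto intro: LeastI Least_le)
    show ?case
    proof (cases "dist x")
      case 0
      then have "snd x \<in> F" using gd by (auto simp: good_def)
      then show ?thesis by blast
    next
      case (Suc d)
      obtain s' ob e j where p: "pick x = (s', ob, e)" by (metis prod_cases3)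
      have "case pick x of (s', ob, e) \<Rightarrow> (snd x, tape w (fst x), s', ob, e) \<in> \<Delta> \<and>
         (\<exists>j. int j = int (fst x) + e \<and> fst x < length w + 2 \<and> j < length w + 2 \<and> good (dist x - 1) (j, s'))"
        unfolding pick_def by (rule someI_ex) (use dec[of d x] gd Suc in auto)
      then obtain j where j: "(snd x, tape w (fst x), s', ob, e) \<in> \<Delta>" "int j = int (fst x) + e"
        "fst x < length w + 2" "j < length w + 2" "good d (j, s')"
        using p Suc by auto
      then have "mstep D w x ob (j, s')"
        using p unfolding mstep_def D_def by (cases x) auto
      moreover obtain k' where "snd k' \<in> F" "(\<lambda>x y. \<exists>ob. mstep D w x ob y)\<^sup>*\<^sup>* (j, s') k'"
        using less.IH[OF _ j(5)] le Suc by auto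
      ultimately show ?thesis
        by (metis (mono_tags, lifting) converse_rtranclp_into_rtranclp)
    qed
  qed
  moreover have "\<exists>n. good n k"
    using rtranclp_imp_relpowp[OF reach(1)] reach(2) unfolding good_def by blast
  moreover have "D i \<subseteq> \<Delta>" "deterministic (D i)" for i by (auto simp: D_def deterministic_def)
  ultimately show thesis using that by blast
qed

text \<open>There is only one path from \<open>a\<close>; it ends in the stuck \<open>k\<close> and
  passes through \<open>x\<close>.\<close>

lemma det_reach_final:
  assumes det: "\<And>x y z. R x y \<Longrightarrow> R x z \<Longrightarrow> y = z" and "R\<^sup>*\<^sup>* a x" "R\<^sup>*\<^sup>* a k" "\<And>y. \<not> R k y"
  shows "R\<^sup>*\<^sup>* x k"
  using assms(2)
proof (induction rule: rtranclp_induct)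
  case (step x y)
  from step(3) show ?case
    by (cases rule: converse_rtranclpE) (use step(2) det assms(4) in blast)+
qed (rule assms(3))

lemma set_tape_word: "set (tape_word w) = {LEnd, REnd} \<union> Sym ` set w"
proof -
  have "tape_word w = LEnd # map Sym w @ [REnd]"
  proof (rule nth_equalityI)
    fix i assume "i < length (tape_word w)"
    then show "tape_word w ! i = (LEnd # map Sym w @ [REnd]) ! i"
      by (cases i) (auto simp: tape_def nth_append)
  qed simp
  then show ?thesis by simp
qed

text \<open>Among all annotations of the tape by strategies that lead to acceptance take the
  lexicographically least one.\<close>
theorem uniformization:
  fixes \<Delta> :: "('s,'a,'b) rule set"
  assumes sub: "\<Sigma>0 \<subseteq> \<Sigma>1" and fin: "finite \<Sigma>1" "finite \<Sigma>2" "finite \<Delta>" "finite F"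
    and \<Delta>: "\<And>s \<sigma> t ob e. (s, \<sigma>, t, ob, e) \<in> \<Delta> \<Longrightarrow> s \<notin> F \<and> e \<in> {-1, 0, 1} \<and> set_option ob \<subseteq> \<Sigma>2"
  obtains m where "\<And>w z. (w, z) \<in> m \<Longrightarrow> w \<in> lists \<Sigma>0 \<and> z \<in> lists \<Sigma>2 \<and>
      (\<exists>j t. t \<in> F \<and> run (mstep (\<lambda>_. \<Delta>) w) (0, q0) z (j, t))"
    "\<And>w z j t. w \<in> lists \<Sigma>0 \<Longrightarrow> t \<in> F \<Longrightarrow> run (mstep (\<lambda>_. \<Delta>) w) (0, q0) z (j, t) \<Longrightarrow> w \<in> Domain m"
    "MSO_ed \<Sigma>1 \<Sigma>2 m"
proof -
  define S where "S = insert q0 (F \<union> {s. \<exists>\<sigma> r. (s, \<sigma>, r) \<in> \<Delta>} \<union> {t. \<exists>s \<sigma> r. (s, \<sigma>, t, r) \<in> \<Delta>})"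
  have S: "finite S"
  proof -
    have "{s. \<exists>\<sigma> r. (s, \<sigma>, r) \<in> \<Delta>} = fst ` \<Delta>" "{t. \<exists>s \<sigma> r. (s, \<sigma>, t, r) \<in> \<Delta>} = (\<lambda>x. fst (snd (snd x))) ` \<Delta>"
      by force+
    then show ?thesis using fin by (simp add: S_def)
  qed
  have "finite {D. D \<subseteq> \<Delta> \<and> deterministic D}" using fin(3) by simp
  then obtain Ds where Ds: "set Ds = {D. D \<subseteq> \<Delta> \<and> deterministic D}" by (meson finite_list)
  \<comment> \<open>Strategies are numbered so that annotations can be ordered. The empty default
    lets every number decode to a deterministic subset of \<open>\<Delta>\<close>.\<close>
  define dec where "dec n = (if n < length Ds then Ds ! n else {})" for n
  have decD: "dec n \<subseteq> \<Delta>" "deterministic (dec n)" for n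
    using Ds nth_mem[of n Ds] by (auto simp: dec_def deterministic_def)
  have decS: "\<exists>n. D = dec n" if "D \<subseteq> \<Delta>" "deterministic D" for D
    using Ds that unfolding dec_def by (metis (mono_tags, lifting) in_set_conv_nth mem_Collect_eq)
  define step where "step w ls = mstep (\<lambda>i. dec (ls ! i)) w" for w ls
  define st where "st = (\<lambda>(\<sigma>, n). {(s, t, e). \<exists>ob. (s, \<sigma>, t, ob, e) \<in> dec n})"
  define ini where "ini = (\<lambda>(\<sigma> :: 'a tsym, n :: nat). if \<sigma> = LEnd then {q0} else {})"
  define acc where "acc W \<longleftrightarrow> (\<exists>i s j t. i < length W \<and> s \<in> ini (W ! i) \<and> j < length W \<and> t \<in> F \<and>
      (cstep st W)\<^sup>*\<^sup>* (i, s) (j, t))" for W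
  have stS: "st x \<subseteq> S \<times> S \<times> {-1, 0, 1}" for x
  proof
    fix p assume p: "p \<in> st x"
    obtain \<sigma> n s t e where x: "x = (\<sigma>, n)" "p = (s, t, e)" by (metis prod_cases3 surj_pair)
    then obtain ob where ob: "(s, \<sigma>, t, ob, e) \<in> \<Delta>" using p decD(1) by (auto simp: st_def)
    then have "s \<in> S" "t \<in> S" unfolding S_def by blast+
    then show "p \<in> S \<times> S \<times> {-1, 0, 1}" using x(2) \<Delta>[OF ob] by blast
  qed
  have iniS: "ini x \<subseteq> S" for x by (cases x) (simp add: ini_def S_def)
  have racc: "recog {W. acc W}"
    unfolding acc_def by (rule recog_reach[OF S stS iniS])
  \<comment> \<open>In a letter \<open>((\<sigma>, n), m)\<close>, \<open>n\<close> belongs to the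
    annotation under test and \<open>m\<close> to a competitor: the first map compares the two
    tracks, the second runs the competitor.\<close>
  define least where "least W \<longleftrightarrow> acc W \<and> \<not> (\<exists>ms. length ms = length W \<and>
      (lexless (map fst (map (\<lambda>((\<sigma>, n), m). (m, n)) (zip W ms))) (map snd (map (\<lambda>((\<sigma>, n), m). (m, n)) (zip W ms))) \<and>
       acc (map (\<lambda>((\<sigma>, n), m). (\<sigma>, m)) (zip W ms))))" for W
  have rleast: "recog {W. least W}"
    unfolding least_def
    by (intro recog_conj recog_Not recog_ex_annot racc)
      (use recog_vimage[OF recog_lexless] recog_vimage[OF racc] in simp_all)
  have least_iff: "least (zip U ls) \<longleftrightarrow> acc (zip U ls) \<and>
      \<not> (\<exists>ms. length ms = length U \<and> lexless ms ls \<and> acc (zip U ms))"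
    if len: "length ls = length U" for U ls
  proof -
    have eqs: "map fst (map (\<lambda>((\<sigma>, n), m). (m, n)) (zip (zip U ls) ms)) = ms"
      "map snd (map (\<lambda>((\<sigma>, n), m). (m, n)) (zip (zip U ls) ms)) = ls"
      "map (\<lambda>((\<sigma>, n), m). (\<sigma>, m)) (zip (zip U ls) ms) = zip U ms"
      if "length ms = length U" for ms
      by (rule nth_equalityI; simp add: len that)+
    have l: "length (zip U ls) = length U" using len by simp
    show ?thesis unfolding least_def l
      by (intro conj_cong refl arg_cong[where f = Not] ex_cong1) (simp_all only: eqs)
  qed
  have cstep_eq: "cstep st (zip (tape_word w) ls) = (\<lambda>x y. \<exists>ob. step w ls x ob y)"
    if "length ls = length w + 2" for w ls
    using that by (intro ext) (auto simp: cstep_def step_def mstep_def st_def)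
  have acc_iff: "acc (zip (tape_word w) ls) \<longleftrightarrow> (\<exists>k. snd k \<in> F \<and> (\<lambda>x y. \<exists>ob. step w ls x ob y)\<^sup>*\<^sup>* (0, q0) k)"
    if "length ls = length w + 2" for w ls
  proof -
    have "tape_word w ! i = LEnd \<longleftrightarrow> i = 0" if "i < length w + 2" for i
      using that by (simp add: tape_def)
    moreover have "fst k < length w + 2" if "(\<lambda>x y. \<exists>ob. step w ls x ob y)\<^sup>*\<^sup>* (0, q0) k" for k
      using that by (induction rule: rtranclp_induct) (auto simp: step_def mstep_def)
    ultimately show ?thesis unfolding acc_def cstep_eq[OF that] using that
      by (auto simp: ini_def split: if_splits) fastforce+
  qed
  define m where "m = {(w, z). w \<in> lists \<Sigma>0 \<and> (\<exists>ls j t. length ls = length w + 2 \<and>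
      least (zip (tape_word w) ls) \<and> t \<in> F \<and> run (step w ls) (0, q0) z (j, t))}"
  have least_unique: "ls = ls'" if "length ls = length U" "length ls' = length U" "least (zip U ls)" "least (zip U ls')" for U ls ls'
    using that lexless_total[of ls ls'] by (metis least_iff)
  have mono: "run (mstep (\<lambda>_. \<Delta>) w) k z k'" if "run (step w ls) k z k'" for w ls k z k'
    using that by (rule run_mono) (use decD(1) in \<open>auto simp: step_def mstep_def\<close>)
  have out\<Sigma>: "z \<in> lists \<Sigma>2" if "run (mstep (\<lambda>_. \<Delta>) w) k z k'" for w k z k'
    using that by (induction rule: run.induct) (use \<Delta> in \<open>fastforce simp: mstep_def split: prod.splits\<close>)+
  have 1: "w \<in> lists \<Sigma>0 \<and> z \<in> lists \<Sigma>2 \<and> (\<exists>j t. t \<in> F \<and> run (mstep (\<lambda>_. \<Delta>) w) (0, q0) z (j, t))"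
    if "(w, z) \<in> m" for w z
    using that mono out\<Sigma> unfolding m_def by blast
  have dom_iff: "w \<in> Domain m \<longleftrightarrow> (\<exists>ls. length ls = length w + 2 \<and> acc (zip (tape_word w) ls))"
    if w: "w \<in> lists \<Sigma>0" for w
  proof
    assume "w \<in> Domain m"
    then show "\<exists>ls. length ls = length w + 2 \<and> acc (zip (tape_word w) ls)"
      by (auto simp: m_def least_def)
  next
    assume "\<exists>ls. length ls = length w + 2 \<and> acc (zip (tape_word w) ls)"
    then obtain ls where "ls \<in> {ls. acc (zip (tape_word w) ls)}" "length ls = length w + 2" by auto
    then obtain ls' where min: "ls' \<in> {ls. acc (zip (tape_word w) ls)}" "length ls' = length w + 2"
      "\<And>ms. ms \<in> {ls. acc (zip (tape_word w) ls)} \<Longrightarrow> length ms = length w + 2 \<Longrightarrow> \<not> lexless ms ls'"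
      by (rule lexless_minimal) (rule that)
    then have ls': "acc (zip (tape_word w) ls')" "length ls' = length w + 2" by simp_all
    have "\<not> (\<exists>ms. length ms = length (tape_word w) \<and> lexless ms ls' \<and> acc (zip (tape_word w) ms))"
      using min(3) by auto
    then have "least (zip (tape_word w) ls')" using least_iff[of ls' "tape_word w"] ls' by simp
    moreover obtain k where "snd k \<in> F" "(\<lambda>x y. \<exists>ob. step w ls' x ob y)\<^sup>*\<^sup>* (0, q0) k"
      using acc_iff[OF ls'(2)] ls'(1) by blast
    moreover from this obtain z where "run (step w ls') (0, q0) z k" using ex_run_iff_reach by metis
    ultimately show "w \<in> Domain m" using w ls'(2) unfolding m_def by (cases k) auto
  qed
  have 2: "w \<in> Domain m" if w: "w \<in> lists \<Sigma>0" and t: "t \<in> F" and r: "run (mstep (\<lambda>_. \<Delta>) w) (0, q0) z (j, t)" for w z j t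
  proof -
    have "(\<lambda>x y. \<exists>ob. mstep (\<lambda>_. \<Delta>) w x ob y)\<^sup>*\<^sup>* (0, q0) (j, t)"
      using r ex_run_iff_reach by metis
    then obtain D where D: "\<And>i. D i \<subseteq> \<Delta>" "\<And>i. deterministic (D i)"
      "\<exists>k'. snd k' \<in> F \<and> (\<lambda>x y. \<exists>ob. mstep D w x ob y)\<^sup>*\<^sup>* (0, q0) k'"
      using ex_strategy[of \<Delta> w "(0, q0)" "(j, t)" F] t by auto
    then have "\<exists>n. D i = dec n" for i using decS by blast
    then obtain code where code: "\<And>i. D i = dec (code i)" by metis
    let ?ls = "map code [0..<length w + 2]"
    have "mstep D w = step w ?ls"
      unfolding step_def by (intro ext) (auto simp: mstep_def code simp del: upt_Suc)
    then have "acc (zip (tape_word w) ?ls)" using D(3) acc_iff[of ?ls w] by simp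
    then show ?thesis unfolding dom_iff[OF w] by (intro exI[of _ ?ls]) simp
  qed
  define h :: "('a tsym \<times> bool \<times> bool) \<times> nat \<Rightarrow> 'a tsym \<times> nat" where "h = (\<lambda>((\<sigma>, b1, b2), n). (\<sigma>, n))"
  \<comment> \<open>The node language looks for a reachable visible configuration at the mark. It
    asks for an emitting rule, since whether the move stays on the tape cannot be seen from one
    letter.\<close>
  define tgtN where "tgtN s = (\<lambda>((\<sigma>, b1, b2 :: bool), n).
    if b1 \<and> (s \<in> F \<or> (\<exists>t b e. (s, \<sigma>, t, Some b, e) \<in> dec n)) then {s} else {})" for s
  define reachN where "reachN s V \<longleftrightarrow> (\<exists>i x j t. i < length V \<and> x \<in> ini (h (V ! i)) \<and> j < length V \<and>
    t \<in> tgtN s (V ! j) \<and> (cstep (\<lambda>x. st (h x)) V)\<^sup>*\<^sup>* (i, x) (j, t))" for s V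
  define N where "N s = {U. \<exists>ns. length ns = length U \<and> (least (map h (zip U ns)) \<and> reachN s (zip U ns))}" for s
  define srcE where "srcE s = (\<lambda>((\<sigma> :: 'a tsym, b1, b2 :: bool), n :: nat).
    if b1 \<and> s \<in> S then {(s, False)} else {})" for s
  define tgtE where "tgtE s' = (\<lambda>((\<sigma> :: 'a tsym, b1 :: bool, b2), n :: nat). if b2 then {(s' :: 's, True)} else {})" for s'
  \<comment> \<open>The flag records whether the one emitting step has been taken: from
    \<open>(s, False)\<close> the letter \<open>b\<close> must be emitted at the first mark,
    afterwards only silent steps are allowed until the second mark.\<close>
  define stE where "stE s b = (\<lambda>((\<sigma>, b1, b2 :: bool), n).
    {((s, False), (y, True), e) | y e. b1 \<and> (s, \<sigma>, y, Some b, e) \<in> dec n} \<union>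
    {((x, True), (y, True), e) | x y e. (x, \<sigma>, y, None, e) \<in> dec n})" for s b
  define reachE where "reachE s s' b V \<longleftrightarrow> (\<exists>i x j t. i < length V \<and> x \<in> srcE s (V ! i) \<and> j < length V \<and>
    t \<in> tgtE s' (V ! j) \<and> (cstep (stE s b) V)\<^sup>*\<^sup>* (i, x) (j, t))" for s s' b V
  define E where "E s s' b = {U. \<exists>ns. length ns = length U \<and> (least (map h (zip U ns)) \<and> reachE s s' b (zip U ns))}" for s s' b
  have rleasth: "recog {V. least (map h V)}" using recog_vimage[OF rleast, of h] by simp
  have recN: "recog (N s)" for s
    unfolding N_def reachN_def
    by (intro recog_ex_annot recog_conj rleasth recog_reach[OF S]) (simp_all only: stS iniS)
  have decS2: "s \<in> S \<and> t \<in> S \<and> e \<in> {-1, 0, 1}" if r: "(s, \<sigma>, t, ob, e) \<in> dec n" for s \<sigma> t ob e n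
  proof -
    have "(s, \<sigma>, t, ob, e) \<in> \<Delta>" using r decD(1) by blast
    then show ?thesis using \<Delta> unfolding S_def by blast
  qed
  have stES: "stE s b x \<subseteq> (S \<times> UNIV) \<times> (S \<times> UNIV) \<times> {-1, 0, 1}" for s b x
  proof -
    obtain \<sigma> b1 b2 n where x: "x = ((\<sigma>, b1, b2), n)" by (metis prod.collapse)
    show ?thesis unfolding x using decS2 by (fastforce simp: stE_def)
  qed
  have srcES: "srcE s x \<subseteq> S \<times> UNIV" for s x by (auto simp: srcE_def split: prod.splits if_splits)
  have SB: "finite (S \<times> (UNIV :: bool set))" using S by simp
  have recE: "recog (E s s' b)" for s s' b
    unfolding E_def reachE_def
    by (intro recog_ex_annot recog_conj rleasth recog_reach[OF SB] stES srcES)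
  \<comment> \<open>Leastness is omitted for the domain: as soon as some annotation accepts, a least
    one exists.\<close>
  have recDom: "recog {U. (\<forall>x\<in>set U. x \<in> {LEnd, REnd} \<union> Sym ` \<Sigma>0) \<and>
      (\<exists>ls. length ls = length U \<and> acc (zip U ls))}"
    by (intro recog_conj recog_all_letter recog_ex_annot[OF racc])
  have hzip: "map h (zip (marked U i j) ns) = zip U ns" if "length ns = length U" for U i j ns
    using that by (auto intro!: nth_equalityI simp: h_def)
  have out: "\<exists>vs. distinct vs \<and> length vs = Suc (length z) \<and>
      set vs = {(i, s). i < length w + 2 \<and> s \<in> S \<and> marked (tape_word w) i i \<in> N s} \<and>
      (\<forall>i s j s' b. (i, s) \<in> set vs \<longrightarrow> (j, s') \<in> set vs \<longrightarrow> b \<in> \<Sigma>2 \<longrightarrow>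
         (marked (tape_word w) i j \<in> E s s' b \<longleftrightarrow>
           (\<exists>k<length z. vs ! k = (i, s) \<and> vs ! Suc k = (j, s') \<and> z ! k = b)))"
    if wz: "(w, z) \<in> m" for w z
  proof -
    obtain ls jf tf where ls: "length ls = length w + 2" "least (zip (tape_word w) ls)"
      and tf: "tf \<in> F" and rn: "run (step w ls) (0, q0) z (jf, tf)"
      using wz unfolding m_def by blast
    have uniq: "ns = ls" if "length ns = length w + 2" "least (zip (tape_word w) ns)" for ns
      using least_unique[of ns "tape_word w" ls] that ls by simp
    let ?R = "\<lambda>x y. \<exists>ob. step w ls x ob y"
    let ?sil = "\<lambda>x y. step w ls x None y"
    let ?F = "{k. snd k \<in> F}"
    let ?vis = "\<lambda>x. x \<in> ?F \<or> (\<exists>b y. step w ls x (Some b) y)"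
    have det: "o1 = o2 \<and> k1 = k2" if "step w ls k o1 k1" "step w ls k o2 k2" for k o1 k1 o2 k2
      using mstep_det[of "\<lambda>i. dec (ls ! i)"] decD(2) that unfolding step_def by blast
    have final: "\<not> step w ls k o1 k1" if "k \<in> ?F" for k o1 k1
      using that decD(1) \<Delta> by (fastforce simp: step_def mstep_def split: prod.splits)
    have "\<exists>vs. distinct vs \<and> length vs = Suc (length z) \<and> set vs = {x. ?R\<^sup>*\<^sup>* (0, q0) x \<and> ?vis x} \<and>
      ?sil\<^sup>*\<^sup>* (0, q0) (hd vs) \<and> (\<forall>x y b. x \<in> set vs \<longrightarrow> y \<in> set vs \<longrightarrow>
        ((\<exists>x'. step w ls x (Some b) x' \<and> ?sil\<^sup>*\<^sup>* x' y) \<longleftrightarrow> (\<exists>i<length z. vs ! i = x \<and> vs ! Suc i = y \<and> z ! i = b)))"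
    proof (rule run_visible[OF _ _ rn, of ?F])
      show "o1 = o2 \<and> k1 = k2" if "step w ls k o1 k1" "step w ls k o2 k2" for k o1 k1 o2 k2
        using that by (rule det)
      show "\<not> step w ls k o1 k1" if "k \<in> ?F" for k o1 k1 using that by (rule final)
      show "(jf, tf) \<in> ?F" using tf by simp
    qed
    then obtain vs where vs: "distinct vs" "length vs = Suc (length z)" "set vs = {x. ?R\<^sup>*\<^sup>* (0, q0) x \<and> ?vis x}"
      "\<And>x y b. x \<in> set vs \<Longrightarrow> y \<in> set vs \<Longrightarrow> (\<exists>x'. step w ls x (Some b) x' \<and> ?sil\<^sup>*\<^sup>* x' y) \<longleftrightarrow>
        (\<exists>i<length z. vs ! i = x \<and> vs ! Suc i = y \<and> z ! i = b)"
      by blast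
    have reach_bound: "fst k < length w + 2 \<and> snd k \<in> S" if "?R\<^sup>*\<^sup>* (0, q0) k" for k
      using that
    proof (induction rule: rtranclp_induct)
      case (step x y)
      then show ?case using decS2 by (fastforce simp: step_def mstep_def split: prod.splits)
    qed (simp add: S_def)
    \<comment> \<open>Uniqueness of the least annotation pays off here: the guess hidden in each
      node and edge language can only be \<open>ls\<close>.\<close>
    have annot: "(\<exists>ns. length ns = length (marked (tape_word w) i j) \<and>
        (least (map h (zip (marked (tape_word w) i j) ns)) \<and> P (zip (marked (tape_word w) i j) ns))) \<longleftrightarrow>
      P (zip (marked (tape_word w) i j) ls)" (is "?l \<longleftrightarrow> ?r") for i j P
    proof
      assume ?l
      then obtain ns where ns: "length ns = length w + 2" "least (map h (zip (marked (tape_word w) i j) ns))"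
        "P (zip (marked (tape_word w) i j) ns)" by auto
      then have "ns = ls" using hzip[of ns "tape_word w" i j] uniq by simp
      then show ?r using ns(3) by simp
    next
      assume ?r
      then show ?l using ls hzip[of ls "tape_word w" i j] by (intro exI[of _ ls]) simp
    qed
    have N_iff: "marked (tape_word w) i i \<in> N s \<longleftrightarrow> ?R\<^sup>*\<^sup>* (0, q0) (i, s) \<and> ?vis (i, s)"
      if i: "i < length w + 2" for i s
    proof -
      let ?V = "zip (marked (tape_word w) i i) ls"
      have "marked (tape_word w) i i \<in> N s \<longleftrightarrow> reachN s ?V"
        unfolding N_def mem_Collect_eq by (rule annot)
      also have "\<dots> \<longleftrightarrow> ?R\<^sup>*\<^sup>* (0, q0) (i, s) \<and> (s \<in> F \<or> (\<exists>t b e. (s, tape w i, t, Some b, e) \<in> dec (ls ! i)))"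
      proof -
        have C: "cstep (\<lambda>x. st (h x)) ?V = ?R"
          using ls(1) unfolding cstep_eq[OF ls(1), symmetric]
          by (intro ext) (auto simp: cstep_def h_def)
        have len: "length ?V = length w + 2" using ls(1) by simp
        have nthV: "?V ! k = ((tape w k, k = i, k = i), ls ! k)" if "k < length w + 2" for k
          using that ls(1) by simp
        have inV: "x \<in> ini (h (?V ! k)) \<longleftrightarrow> k = 0 \<and> x = q0" if "k < length w + 2" for k x
          unfolding nthV[OF that] by (simp add: ini_def h_def tape_def)
        have tgV: "x \<in> tgtN s (?V ! k) \<longleftrightarrow> k = i \<and> x = s \<and>
            (s \<in> F \<or> (\<exists>t b e. (s, tape w i, t, Some b, e) \<in> dec (ls ! i)))" if "k < length w + 2" for k x
          unfolding nthV[OF that] by (auto simp: tgtN_def)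
        show ?thesis (is "_ \<longleftrightarrow> ?r")
        proof
          assume "reachN s ?V"
          then obtain i' x j t where "i' < length w + 2" "x \<in> ini (h (?V ! i'))" "j < length w + 2"
            "t \<in> tgtN s (?V ! j)" "?R\<^sup>*\<^sup>* (i', x) (j, t)" unfolding reachN_def C len by blast
          then show ?r using inV[of i' x] tgV[of j t] by simp
        next
          assume r: ?r
          have "0 < length w + 2" "q0 \<in> ini (h (?V ! 0))" "s \<in> tgtN s (?V ! i)"
            using inV[of 0 q0] tgV[OF i, of s] r by simp_all
          then show "reachN s ?V" unfolding reachN_def C len using i r by blast
        qed
      qed
      also have "\<dots> \<longleftrightarrow> ?R\<^sup>*\<^sup>* (0, q0) (i, s) \<and> ?vis (i, s)"
      proof -
        \<comment> \<open>The emitting rule could point off the tape. But a reached configuration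
          lies on the accepting run, so it is final or has a step, and by determinism that step uses
          this rule.\<close>
        have "?vis (i, s)" if r: "?R\<^sup>*\<^sup>* (0, q0) (i, s)" "(s, tape w i, t, Some b, e) \<in> dec (ls ! i)" for t b e
        proof -
          have to_final: "?R\<^sup>*\<^sup>* (0, q0) (jf, tf)" using rn ex_run_iff_reach by metis
          have "?R\<^sup>*\<^sup>* (i, s) (jf, tf)"
          proof (rule det_reach_final[OF _ r(1) to_final])
            show "y = z" if "?R x y" "?R x z" for x y z using det that by blast
            show "\<not> ?R (jf, tf) y" for y using final[of "(jf, tf)"] tf by simp
          qed
          then show ?thesis
          proof (cases rule: converse_rtranclpE)
            case base
            then show ?thesis using tf by simp
          next
            case (step y)
            then obtain ob where ob: "step w ls (i, s) ob y" by blast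
            obtain j t' where y: "y = (j, t')" by fastforce
            from ob obtain e' where "(s, tape w i, t', ob, e') \<in> dec (ls ! i)"
              unfolding y by (auto simp: step_def mstep_def)
            then have "ob = Some b" using decD(2) r(2) unfolding deterministic_def by blast
            then show ?thesis using ob by blast
          qed
        qed
        moreover have "\<exists>t b e. (s, tape w i, t, Some b, e) \<in> dec (ls ! i)" if "step w ls (i, s) (Some b) y" for b y
          using that by (auto simp: step_def mstep_def split: prod.splits)
        ultimately show ?thesis unfolding mem_Collect_eq snd_conv by blast
      qed
      finally show ?thesis .
    qed
    have E_iff: "marked (tape_word w) i j \<in> E s s' b \<longleftrightarrow> (\<exists>x'. step w ls (i, s) (Some b) x' \<and> ?sil\<^sup>*\<^sup>* x' (j, s'))"
      if i: "i < length w + 2" "j < length w + 2" "s \<in> S" for i j s s' b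
    proof -
      let ?V = "zip (marked (tape_word w) i j) ls"
      let ?C = "cstep (stE s b) ?V"
      have "marked (tape_word w) i j \<in> E s s' b \<longleftrightarrow> reachE s s' b ?V"
        unfolding E_def mem_Collect_eq by (rule annot)
      also have "\<dots> \<longleftrightarrow> ?C\<^sup>*\<^sup>* (i, (s, False)) (j, (s', True))"
      proof -
        have len: "length ?V = length w + 2" using ls(1) by simp
        have nthV: "?V ! k = ((tape w k, k = i, k = j), ls ! k)" if "k < length w + 2" for k
          using that ls(1) by simp
        have inV: "x \<in> srcE s (?V ! k) \<longleftrightarrow> k = i \<and> x = (s, False)" if "k < length w + 2" for k x
          unfolding nthV[OF that] using i(3) by (simp add: srcE_def)
        have tgV: "x \<in> tgtE s' (?V ! k) \<longleftrightarrow> k = j \<and> x = (s', True)" if "k < length w + 2" for k x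
          unfolding nthV[OF that] by (simp add: tgtE_def)
        show ?thesis (is "_ \<longleftrightarrow> ?r")
        proof
          assume "reachE s s' b ?V"
          then obtain i' x j' t where "i' < length w + 2" "x \<in> srcE s (?V ! i')" "j' < length w + 2"
            "t \<in> tgtE s' (?V ! j')" "?C\<^sup>*\<^sup>* (i', x) (j', t)" unfolding reachE_def len by blast
          then show ?r using inV[of i' x] tgV[of j' t] by simp
        next
          assume r: ?r
          have "(s, False) \<in> srcE s (?V ! i)" "(s', True) \<in> tgtE s' (?V ! j)"
            using inV[OF i(1), of "(s, False)"] tgV[OF i(2), of "(s', True)"] by simp_all
          then show "reachE s s' b ?V" unfolding reachE_def len using i(1,2) r by blast
        qed
      qed
      also have "\<dots> \<longleftrightarrow> (\<exists>x'. step w ls (i, s) (Some b) x' \<and> ?sil\<^sup>*\<^sup>* x' (j, s'))"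
      proof -
        have C: "?C (p, (x, f)) (q, (y, g)) \<longleftrightarrow> g \<and> (if f then ?sil (p, x) (q, y)
            else p = i \<and> x = s \<and> step w ls (p, x) (Some b) (q, y))" for p x f q y g
          using ls(1) by (auto simp: cstep_def stE_def step_def mstep_def)
        have a: "snd (snd k) \<and> ?sil\<^sup>*\<^sup>* (p, x) (fst k, fst (snd k))" if "?C\<^sup>*\<^sup>* (p, (x, True)) k" for p x k
          using that
        proof (induction rule: rtranclp_induct)
          case (step k1 k2)
          obtain p1 x1 f1 p2 x2 f2 where k: "k1 = (p1, (x1, f1))" "k2 = (p2, (x2, f2))" by (metis prod_cases3)
          then have "f1" "?sil\<^sup>*\<^sup>* (p, x) (p1, x1)" using step(3) by auto
          moreover have "f2" "?sil (p1, x1) (p2, x2)" using step(2) \<open>f1\<close> unfolding k C by auto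
          ultimately show ?case using k by (auto intro: rtranclp.rtrancl_into_rtrancl)
        qed simp
        have b: "?C\<^sup>*\<^sup>* (fst k, (snd k, True)) (fst k', (snd k', True))" if "?sil\<^sup>*\<^sup>* k k'" for k k'
          using that
        proof (induction rule: rtranclp_induct)
          case (step k1 k2)
          then have "?C (fst k1, (snd k1, True)) (fst k2, (snd k2, True))" unfolding C by simp
          then show ?case using step(3) by (rule rtranclp.rtrancl_into_rtrancl[rotated])
        qed simp
        show ?thesis
        proof
          assume "?C\<^sup>*\<^sup>* (i, (s, False)) (j, (s', True))"
          then obtain k where k: "?C (i, (s, False)) k" "?C\<^sup>*\<^sup>* k (j, (s', True))"
            by (cases rule: converse_rtranclpE) auto
          obtain q y g where kk: "k = (q, (y, g))" by (metis prod_cases3)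
          have "g" "step w ls (i, s) (Some b) (q, y)" using k(1) unfolding kk C by auto
          then show "\<exists>x'. step w ls (i, s) (Some b) x' \<and> ?sil\<^sup>*\<^sup>* x' (j, s')"
            using a[of q y "(j, (s', True))"] k(2) kk by auto
        next
          assume "\<exists>x'. step w ls (i, s) (Some b) x' \<and> ?sil\<^sup>*\<^sup>* x' (j, s')"
          then obtain q y where "step w ls (i, s) (Some b) (q, y)" "?sil\<^sup>*\<^sup>* (q, y) (j, s')" by auto
          then have "?C (i, (s, False)) (q, (y, True))" "?C\<^sup>*\<^sup>* (q, (y, True)) (j, (s', True))"
            using b[of "(q, y)" "(j, s')"] unfolding C by auto
          then show "?C\<^sup>*\<^sup>* (i, (s, False)) (j, (s', True))" by (rule converse_rtranclp_into_rtranclp)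
        qed
      qed
      finally show ?thesis .
    qed
    have "set vs = {(i, s). i < length w + 2 \<and> s \<in> S \<and> marked (tape_word w) i i \<in> N s}"
      unfolding vs(3) using N_iff reach_bound by fastforce
    moreover from this have "marked (tape_word w) i j \<in> E s s' b \<longleftrightarrow>
        (\<exists>k<length z. vs ! k = (i, s) \<and> vs ! Suc k = (j, s') \<and> z ! k = b)"
      if "(i, s) \<in> set vs" "(j, s') \<in> set vs" for i s j s' b
      using E_iff[of i j s s' b] vs(4)[OF that, of b] that by auto
    ultimately show ?thesis using vs(1,2) by blast
  qed
  have "MSO_ed \<Sigma>1 \<Sigma>2 m"
  proof (rule MSO_ed_of_recog[OF fin(1,2) S _ recDom _ recN recE out])
    show "m \<subseteq> lists \<Sigma>1 \<times> lists \<Sigma>2" 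
    proof
      fix p assume "p \<in> m"
      then show "p \<in> lists \<Sigma>1 \<times> lists \<Sigma>2"
        using 1[of "fst p" "snd p"] lists_mono[OF sub] by (simp add: mem_Times_iff subset_iff)
    qed
    have "(\<forall>x\<in>set (tape_word w). x \<in> {LEnd, REnd} \<union> Sym ` \<Sigma>0) \<longleftrightarrow> w \<in> lists \<Sigma>0" for w
      unfolding set_tape_word by auto
    moreover have "w \<in> lists \<Sigma>0" if "w \<in> Domain m" for w using that 1 by blast
    ultimately show "w \<in> Domain m \<longleftrightarrow> tape_word w \<in> {U. (\<forall>x\<in>set U. x \<in> {LEnd, REnd} \<union> Sym ` \<Sigma>0) \<and>
      (\<exists>ls. length ls = length U \<and> acc (zip U ls))}" for w
      using dom_iff[of w] unfolding mem_Collect_eq length_tape_word by blast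
  qed
  with 1 2 show thesis by (rule that)
qed

section \<open>Reduction of 2gsm's to machines emitting single letters\<close>

definition gtrans :: "('a,'b) gsm \<Rightarrow> nat \<Rightarrow> 'a tsym \<Rightarrow> nat \<Rightarrow> 'b list \<Rightarrow> int \<Rightarrow> bool" where
  "gtrans M p \<tau> q a e \<longleftrightarrow> (\<exists>\<sigma> q1 a1 e1 q0 a0 e0. (p,\<sigma>,q1,a1,e1,q0,a0,e0) \<in> gdelta M \<and>
     (if \<tau> = \<sigma> then (q,a,e) = (q1,a1,e1) else (q,a,e) = (q0,a0,e0)))"

lemma gsm_step_iff:
  "gsm_step M w (p, i, z) (q, j, z') \<longleftrightarrow>
    (\<exists>a e. gtrans M p (tape w i) q a e \<and> z' = z @ a \<and> int j = int i + e \<and> j \<le> length w + 1)"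
  (is "?l \<longleftrightarrow> ?r")
proof
  assume ?l
  then show ?r by (cases rule: gsm_step.cases) (fastforce simp: gtrans_def)
next
  assume ?r
  then obtain a e where r: "gtrans M p (tape w i) q a e" "z' = z @ a" "int j = int i + e" "j \<le> length w + 1"
    by blast
  then have "j = nat (int i + e)" "0 \<le> int i + e" "int i + e \<le> int (length w) + 1" by linarith+
  then show ?l using r(1,2) unfolding gtrans_def by (auto intro: gsm_step.intros)
qed

lemma gtrans_wf:
  assumes "wf_gsm M" "gtrans M p \<tau> q a e"
  shows "p \<in> gstates M" "p \<noteq> gfinal M" "q \<in> gstates M" "a \<in> lists (gout M)" "e \<in> {-1, 0, 1}"
  using assms unfolding wf_gsm_def gtrans_def by (fastforce split: if_splits)+

lemma finite_gsm_outputs: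
  assumes "wf_gsm M"
  shows "finite {a. \<exists>p \<tau> q e. gtrans M p \<tau> q a e}"
proof -
  have "{a. \<exists>p \<tau> q e. gtrans M p \<tau> q a e} \<subseteq>
    (\<lambda>(p,\<sigma>,q1,a1,e1,q0,a0,e0). a1) ` gdelta M \<union> (\<lambda>(p,\<sigma>,q1,a1,e1,q0,a0,e0). a0) ` gdelta M"
    unfolding gtrans_def by (force split: if_splits)
  moreover have "finite (gdelta M)" using assms by (simp add: wf_gsm_def)
  ultimately show ?thesis by (meson finite_UnI finite_imageI finite_subset)
qed

lemma run_append: "run step k z k' \<Longrightarrow> run step k' z' k'' \<Longrightarrow> run step k (z @ z') k''"
  by (induction rule: run.induct) (auto intro: run.intros)

text \<open>The output words of a gsm are emitted letter by letter: a state carries the pending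
  output and the class of what has been written.\<close>
theorem gsm_uniformization:
  fixes M :: "('a,'b) gsm"
  assumes M: "wf_gsm M" and fin: "finite \<Sigma>1" "finite \<Sigma>2" and L: "recog L" "L \<subseteq> lists \<Sigma>2"
  obtains m where "m \<subseteq> gsm_rel M \<inter> lists \<Sigma>1 \<times> L"
    "Domain (gsm_rel M \<inter> lists \<Sigma>1 \<times> L) \<subseteq> Domain m" "MSO_ed \<Sigma>1 \<Sigma>2 m"
proof -
  obtain f :: "'b list \<Rightarrow> nat" where f: "fcong f" "saturates f L" using L(1) by (rule recogE)
  obtain mul where mul: "\<And>u v. f (u @ v) = mul (f u) (f v)"
    by (rule fcong_mult[OF f(1)]) (rule that)
  have finf: "finite (range f)" using f(1) by (simp add: fcong_def)
  \<comment> \<open>Only words over both alphabets can be in the relation to be uniformized; the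
    target \<open>MSO_ed\<close> still refers to all of \<open>\<Sigma>1\<close>.\<close>
  define \<Sigma>0 where "\<Sigma>0 = \<Sigma>1 \<inter> gin M"
  define T where "T = {LEnd, REnd} \<union> Sym ` \<Sigma>0"
  define out where "out = {a. \<exists>p \<tau> q e. gtrans M p \<tau> q a e}"
  \<comment> \<open>All suffixes of words occurring in instructions: the possible contents of the
    buffer of pending output.\<close>
  define B where "B = insert [] (\<Union>a\<in>out. (\<lambda>k. drop k a) ` {..length a})"
  \<comment> \<open>With an empty buffer a transition of \<open>M\<close> is taken silently and
    fills the buffer; otherwise its first letter is emitted in place and multiplied into the class.
    Letters outside \<open>\<Sigma>2\<close> block the computation, as \<open>L\<close> contains no
    word with such letters.\<close>
  define \<Delta> :: "(nat \<times> 'b list \<times> nat, 'a, 'b) rule set" where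
    "\<Delta> = {((p, [], c), \<tau>, (q, a, c), None, e) | p c \<tau> q a e.
          c \<in> range f \<and> \<tau> \<in> T \<and> gtrans M p \<tau> q a e} \<union>
         {((q, b # \<beta>, c), \<tau>, (q, \<beta>, mul c (f [b])), Some b, 0) | q b \<beta> c \<tau>.
          q \<in> gstates M \<and> b # \<beta> \<in> B \<and> b \<in> \<Sigma>2 \<and> c \<in> range f \<and> \<tau> \<in> T}"
  \<comment> \<open>Saturation turns membership of the complete output in \<open>L\<close> into a
    test of its class, and the buffer has to be empty.\<close>
  define F where "F = {(gfinal M, [] :: 'b list, c) | c. c \<in> f ` L}"
  have B: "finite B" using finite_gsm_outputs[OF M] by (simp add: B_def out_def)
  have suffix: "\<beta> \<in> B" if "b # \<beta> \<in> B" for b \<beta>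
  proof -
    have "b # \<beta> \<in> (\<Union>a\<in>out. (\<lambda>k. drop k a) ` {..length a})" using that by (simp add: B_def)
    then obtain a k where "a \<in> out" "b # \<beta> = drop k a" by blast
    then have "\<beta> = drop (Suc k) a" "Suc k \<le> length a"
      by (metis drop_Suc list.sel(3) tl_drop) (metis Suc_leI drop_eq_Nil2 \<open>b # \<beta> = drop k a\<close> leI list.discI)
    then have "\<beta> \<in> (\<lambda>k. drop k a) ` {..length a}" by blast
    then show ?thesis using \<open>a \<in> out\<close> unfolding B_def by blast
  qed
  have outB: "a \<in> B" if "gtrans M p \<tau> q a e" for p \<tau> q a e
  proof -
    have "a \<in> out" using that by (auto simp: out_def)
    then show ?thesis unfolding B_def by (auto intro!: bexI[of _ a] image_eqI[of _ _ 0])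
  qed
  have mulf: "mul c (f [b]) \<in> range f" if "c \<in> range f" for c b
  proof -
    from that obtain u where "c = f u" by blast
    then have "mul c (f [b]) = f (u @ [b])" by (simp add: mul)
    then show ?thesis by simp
  qed
  have "finite \<Delta>"
  proof -
    let ?Q = "gstates M \<times> B \<times> range f"
    have "\<Delta> \<subseteq> ?Q \<times> T \<times> ?Q \<times> insert None (Some ` \<Sigma>2) \<times> {-1, 0, 1}"
      using gtrans_wf[OF M] outB suffix mulf unfolding \<Delta>_def by (fastforce simp: B_def)
    moreover have "finite T" "finite (gstates M)" using fin M by (auto simp: T_def \<Sigma>0_def wf_gsm_def)
    ultimately show ?thesis using B finf fin(2) by (auto intro: finite_subset)
  qed
  moreover have "finite F"
    by (rule finite_subset[of _ "{gfinal M} \<times> {[]} \<times> range f"]) (use finf in \<open>auto simp: F_def\<close>)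
  moreover have "s \<notin> F \<and> e \<in> {-1, 0, 1} \<and> set_option ob \<subseteq> \<Sigma>2" if "(s, \<sigma>, t, ob, e) \<in> \<Delta>" for s \<sigma> t ob e
    using that gtrans_wf[OF M] unfolding \<Delta>_def F_def by fastforce
  moreover have "\<Sigma>0 \<subseteq> \<Sigma>1" by (simp add: \<Sigma>0_def)
  ultimately obtain m where m: "\<And>w z. (w, z) \<in> m \<Longrightarrow> w \<in> lists \<Sigma>0 \<and> z \<in> lists \<Sigma>2 \<and>
      (\<exists>j t. t \<in> F \<and> run (mstep (\<lambda>_. \<Delta>) w) (0, (ginit M, [], f [])) z (j, t))"
    "\<And>w z j t. w \<in> lists \<Sigma>0 \<Longrightarrow> t \<in> F \<Longrightarrow> run (mstep (\<lambda>_. \<Delta>) w) (0, (ginit M, [], f [])) z (j, t) \<Longrightarrow> w \<in> Domain m"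
    "MSO_ed \<Sigma>1 \<Sigma>2 m"
    using uniformization[of \<Sigma>0 \<Sigma>1 \<Sigma>2 \<Delta> F "(ginit M, [], f [])"] fin by metis
  \<comment> \<open>\<open>M\<close> writes a word at once, so its output is what has been emitted
    followed by the buffer, while the class describes the emitted part alone.\<close>
  have sound: "(gsm_step M w)\<^sup>*\<^sup>* (ginit M, 0, []) (fst (snd k'), fst k', y @ z @ fst (snd (snd k'))) \<and>
      snd (snd (snd k')) = f (y @ z)"
    if "run (mstep (\<lambda>_. \<Delta>) w) k z k'"
      "(gsm_step M w)\<^sup>*\<^sup>* (ginit M, 0, []) (fst (snd k), fst k, y @ fst (snd (snd k)))"
      "snd (snd (snd k)) = f y" for w k z k' y
    using that
  proof (induction arbitrary: y rule: run.induct)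
    case (run_silent k k1 z k2)
    obtain i p \<beta> c j q \<gamma> d where k: "k = (i, p, \<beta>, c)" "k1 = (j, q, \<gamma>, d)" by (metis prod_cases4)
    then obtain e where e: "gtrans M p (tape w i) q \<gamma> e" "\<beta> = []" "d = c" "int j = int i + e" "j < length w + 2"
      using run_silent(1) by (auto simp: mstep_def \<Delta>_def)
    then have "gsm_step M w (p, i, y) (q, j, y @ \<gamma>)" unfolding gsm_step_iff by auto
    then have "(gsm_step M w)\<^sup>*\<^sup>* (ginit M, 0, []) (q, j, y @ \<gamma>)"
      using run_silent.prems(1) k e(2) by (auto intro: rtranclp.rtrancl_into_rtrancl)
    then show ?case using run_silent.IH[of y] run_silent.prems(2) k e by simp
  next
    case (run_emit k b k1 z k2)
    obtain i p \<beta> c j q \<gamma> d where k: "k = (i, p, \<beta>, c)" "k1 = (j, q, \<gamma>, d)" by (metis prod_cases4)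
    then have e: "\<beta> = b # \<gamma>" "d = mul c (f [b])" "q = p" "j = i"
      using run_emit(1) by (auto simp: mstep_def \<Delta>_def)
    then show ?case using run_emit.IH[of "y @ [b]"] run_emit.prems k mul by simp
  qed simp
  have emit: "run (mstep (\<lambda>_. \<Delta>) w) (i, (q, a, f y)) a (i, (q, [], f (y @ a)))"
    if "a \<in> B" "a \<in> lists \<Sigma>2" "q \<in> gstates M" "i < length w + 2" "tape w i \<in> T" for w i q a y
    using that(1,2)
  proof (induction a arbitrary: y)
    case Nil
    then show ?case by (auto intro: run.intros)
  next
    case (Cons b a)
    have "mstep (\<lambda>_. \<Delta>) w (i, (q, b # a, f y)) (Some b) (i, (q, a, f (y @ [b])))"
      using Cons.prems that(3-5) mul by (auto simp: mstep_def \<Delta>_def)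
    moreover have "run (mstep (\<lambda>_. \<Delta>) w) (i, (q, a, f (y @ [b]))) a (i, (q, [], f ((y @ [b]) @ a)))"
      by (rule Cons.IH) (use Cons.prems suffix in auto)
    ultimately show ?case by (auto intro: run.intros)
  qed
  \<comment> \<open>The claim is conditional on the output so far because blocked letters cannot be
    simulated; it passes to earlier configurations since outputs only grow.\<close>
  have complete: "snd (snd k) \<in> lists \<Sigma>2 \<longrightarrow> fst (snd k) < length w + 2 \<and>
      run (mstep (\<lambda>_. \<Delta>) w) (0, (ginit M, [], f [])) (snd (snd k)) (fst (snd k), (fst k, [], f (snd (snd k))))"
    if "(gsm_step M w)\<^sup>*\<^sup>* (ginit M, 0, []) k" and w: "w \<in> lists \<Sigma>0" for w k
    using that(1)
  proof (induction rule: rtranclp_induct)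
    case (step k k1)
    obtain p i z q j z' where k: "k = (p, i, z)" "k1 = (q, j, z')" by (metis prod_cases3)
    then obtain a e where e: "gtrans M p (tape w i) q a e" "z' = z @ a" "int j = int i + e" "j \<le> length w + 1"
      using step(2) gsm_step_iff by metis
    show ?case
    proof
      assume "snd (snd k1) \<in> lists \<Sigma>2"
      then have z: "z \<in> lists \<Sigma>2" "a \<in> lists \<Sigma>2" using k e by auto
      then have IH: "i < length w + 2" "run (mstep (\<lambda>_. \<Delta>) w) (0, (ginit M, [], f [])) z (i, (p, [], f z))"
        using step(3) k by auto
      have tape: "tape w x \<in> T" if "x < length w + 2" for x
      proof -
        have "tape w x \<in> set (tape_word w)" using that nth_mem[of x "tape_word w"] by simp
        then show ?thesis using w unfolding set_tape_word T_def by auto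
      qed
      have "mstep (\<lambda>_. \<Delta>) w (i, (p, [], f z)) None (j, (q, a, f z))"
        using e IH(1) tape[OF IH(1)] by (auto simp: mstep_def \<Delta>_def)
      moreover have "run (mstep (\<lambda>_. \<Delta>) w) (j, (q, a, f z)) a (j, (q, [], f (z @ a)))"
        by (rule emit) (use e z outB tape gtrans_wf(3)[OF M e(1)] in auto)
      ultimately have "run (mstep (\<lambda>_. \<Delta>) w) (i, (p, [], f z)) a (j, (q, [], f (z @ a)))"
        by (rule run.run_silent)
      from run_append[OF IH(2) this]
      show "fst (snd k1) < length w + 2 \<and> run (mstep (\<lambda>_. \<Delta>) w) (0, (ginit M, [], f [])) (snd (snd k1))
          (fst (snd k1), (fst k1, [], f (snd (snd k1))))"
        using k e by simp
    qed
  qed (auto intro: run.intros)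
  have "m \<subseteq> gsm_rel M \<inter> lists \<Sigma>1 \<times> L"
  proof (intro subsetI)
    fix p assume "p \<in> m"
    then obtain w z j c where p: "p = (w, z)" "w \<in> lists \<Sigma>0" "z \<in> lists \<Sigma>2" "c \<in> f ` L"
      "run (mstep (\<lambda>_. \<Delta>) w) (0, (ginit M, [], f [])) z (j, (gfinal M, [], c))"
      using m(1)[of "fst p" "snd p"] by (cases p) (auto simp: F_def)
    have "(gsm_step M w)\<^sup>*\<^sup>* (ginit M, 0, []) (gfinal M, j, z)" "c = f z"
      using sound[OF p(5), of "[]"] by simp_all
    moreover have "z \<in> L" using calculation(2) p(4) saturatesD[OF f(2)] by blast
    ultimately show "p \<in> gsm_rel M \<inter> lists \<Sigma>1 \<times> L"
      using p(1,2) by (auto simp: gsm_rel_def \<Sigma>0_def)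
  qed
  moreover have "Domain (gsm_rel M \<inter> lists \<Sigma>1 \<times> L) \<subseteq> Domain m"
  proof
    fix w assume "w \<in> Domain (gsm_rel M \<inter> lists \<Sigma>1 \<times> L)"
    then obtain z i where z: "w \<in> lists \<Sigma>0" "z \<in> L" "(gsm_step M w)\<^sup>*\<^sup>* (ginit M, 0, []) (gfinal M, i, z)"
      by (auto simp: gsm_rel_def \<Sigma>0_def)
    then have "run (mstep (\<lambda>_. \<Delta>) w) (0, (ginit M, [], f [])) z (i, (gfinal M, [], f z))"
      using complete[OF z(3,1)] L(2) by auto
    moreover have "(gfinal M, [], f z) \<in> F" using z(2) by (auto simp: F_def)
    ultimately show "w \<in> Domain m" using m(2)[OF z(1)] by blast
  qed
  ultimately show thesis using m(3) by (rule that)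
qed

section \<open>From MSO definable transductions to two-way machines\<close>

type_synonym ('s,'a,'b) word_rule = "'s \<times> 'a tsym \<times> 's \<times> 'b list \<times> int"

definition rstep :: "('s,'a,'b) word_rule set \<Rightarrow> 'a list \<Rightarrow> 's \<times> nat \<times> 'b list \<Rightarrow> 's \<times> nat \<times> 'b list \<Rightarrow> bool" where
  "rstep \<Delta> w = (\<lambda>(s, i, z) (t, j, z'). \<exists>a e. (s, tape w i, t, a, e) \<in> \<Delta> \<and> z' = z @ a \<and>
     int j = int i + e \<and> j \<le> length w + 1)"

text \<open>An instruction of a 2gsm also acts when its test fails; this branch is sent to a trap state.\<close>
lemma NGSM_of_rules:
  fixes \<Delta> :: "('s,'a,'b) word_rule set"
  assumes fin: "finite \<Delta>" "finite \<Sigma>" "finite \<Gamma>"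
    and \<Delta>: "\<And>s \<sigma> t a e. (s, \<sigma>, t, a, e) \<in> \<Delta> \<Longrightarrow>
      s \<noteq> qf \<and> \<sigma> \<in> {LEnd, REnd} \<union> Sym ` \<Sigma> \<and> a \<in> lists \<Gamma> \<and> e \<in> {-1, 0, 1}"
  shows "{(w, z). w \<in> lists \<Sigma> \<and> (\<exists>i. (rstep \<Delta> w)\<^sup>*\<^sup>* (q0, 0, []) (qf, i, z))} \<in> NGSM"
proof -
  define S where "S = {q0, qf} \<union> fst ` \<Delta> \<union> (\<lambda>x. fst (snd (snd x))) ` \<Delta>"
  have "finite S" using fin by (simp add: S_def)
  then obtain code :: "'s \<Rightarrow> nat" where code: "inj_on code S"
    using finite_imp_inj_to_nat_seg by blast
  have SD: "s \<in> S \<and> t \<in> S" if "(s, \<sigma>, t, r) \<in> \<Delta>" for s \<sigma> t r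
    using that unfolding S_def by force
  have qS: "q0 \<in> S" "qf \<in> S" by (auto simp: S_def)
  have "\<exists>n. n \<notin> code ` S" using \<open>finite S\<close> ex_new_if_finite[of "code ` S"] by auto
  then obtain trap where trap: "trap \<notin> code ` S" by blast
  define M :: "('a,'b) gsm" where "M = \<lparr>gstates = insert trap (code ` S), gin = \<Sigma>, gout = \<Gamma>,
    gdelta = (\<lambda>(s, \<sigma>, t, a, e). (code s, \<sigma>, code t, a, e, trap, [], 0)) ` \<Delta>,
    ginit = code q0, gfinal = code qf\<rparr>"
  have "wf_gsm M"
  proof -
    have "code s \<noteq> code qf" if "(s, \<sigma>, r) \<in> \<Delta>" for s \<sigma> r
    proof -
      obtain t a e where r: "r = (t, a, e)" by (metis prod_cases3)
      then have "s \<in> S" "s \<noteq> qf" using SD[of s \<sigma> t "(a, e)"] \<Delta>[of s \<sigma> t a e] that by auto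
      then show ?thesis using code qS(2) by (auto simp: inj_on_def)
    qed
    then show ?thesis
      using fin \<open>finite S\<close> \<Delta> SD qS by (fastforce simp: wf_gsm_def M_def)
  qed
  have tr1: "gtrans M (code s) \<sigma> (code t) a e" if "(s, \<sigma>, t, a, e) \<in> \<Delta>" for s \<sigma> t a e
    unfolding gtrans_def M_def using that by (force simp: image_iff)
  have tr2: "q = trap \<or> (\<exists>t\<in>S. q = code t \<and> (s, \<sigma>, t, a, e) \<in> \<Delta>)" if sS: "s \<in> S" and gt: "gtrans M (code s) \<sigma> q a e" for s \<sigma> q a e
  proof -
    obtain \<sigma>' q1 a1 e1 q2 a2 e2 where g: "(code s, \<sigma>', q1, a1, e1, q2, a2, e2) \<in> gdelta M"
      "if \<sigma> = \<sigma>' then (q, a, e) = (q1, a1, e1) else (q, a, e) = (q2, a2, e2)"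
      using gt unfolding gtrans_def by blast
    then obtain s' t where st: "(s', \<sigma>', t, a1, e1) \<in> \<Delta>" "code s' = code s" "q1 = code t" "q2 = trap"
      by (auto simp: M_def)
    then have "s' = s" "t \<in> S" using code SD[OF st(1)] sS by (auto simp: inj_on_def)
    then show ?thesis using g(2) st by (auto split: if_splits)
  qed
  have tr3: "\<not> gtrans M trap \<sigma> q a e" for \<sigma> q a e
    using trap SD by (fastforce simp: gtrans_def M_def)
  have "gsm_rel M = {(w, z). w \<in> lists \<Sigma> \<and> (\<exists>i. (rstep \<Delta> w)\<^sup>*\<^sup>* (q0, 0, []) (qf, i, z))}"
  proof -
    have "(gsm_step M w)\<^sup>*\<^sup>* (code q0, 0, []) (code s, i, z)" if "(rstep \<Delta> w)\<^sup>*\<^sup>* (q0, 0, []) (s, i, z)" for w s i z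
    proof -
      have "(gsm_step M w)\<^sup>*\<^sup>* (code q0, 0, []) (code (fst k), snd k)" if "(rstep \<Delta> w)\<^sup>*\<^sup>* (q0, 0, []) k" for k
        using that
      proof (induction rule: rtranclp_induct)
        case (step k k')
        obtain s i z t j z' where k: "k = (s, i, z)" "k' = (t, j, z')" by (metis prod_cases3)
        then have "gsm_step M w (code s, i, z) (code t, j, z')"
          using step(2) tr1 unfolding gsm_step_iff rstep_def by fastforce
        then show ?case using step(3) k by (simp add: rtranclp.rtrancl_into_rtrancl)
      qed simp
      from this[OF that] show ?thesis by simp
    qed
    moreover have "(rstep \<Delta> w)\<^sup>*\<^sup>* (q0, 0, []) (qf, i, z)"
      if "(gsm_step M w)\<^sup>*\<^sup>* (code q0, 0, []) (code qf, i, z)" for w i z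
    proof -
      have "fst k = trap \<or> (\<exists>s\<in>S. fst k = code s \<and> (rstep \<Delta> w)\<^sup>*\<^sup>* (q0, 0, []) (s, snd k))"
        if "(gsm_step M w)\<^sup>*\<^sup>* (code q0, 0, []) k" for k
        using that
      proof (induction rule: rtranclp_induct)
        case (step k k')
        obtain p i z q j z' where k: "k = (p, i, z)" "k' = (q, j, z')" by (metis prod_cases3)
        then obtain a e where g: "gtrans M p (tape w i) q a e" "z' = z @ a" "int j = int i + e" "j \<le> length w + 1"
          using step(2) gsm_step_iff by metis
        then obtain s where s: "s \<in> S" "p = code s" "(rstep \<Delta> w)\<^sup>*\<^sup>* (q0, 0, []) (s, i, z)"
          using step(3) k tr3 by auto
        show ?case
        proof (cases "q = trap")
          case False
          then obtain t where t: "t \<in> S" "q = code t" "(s, tape w i, t, a, e) \<in> \<Delta>"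
            using tr2[OF s(1)] g(1) s(2) by blast
          then have "rstep \<Delta> w (s, i, z) (t, j, z')" using g by (auto simp: rstep_def)
          then have "(rstep \<Delta> w)\<^sup>*\<^sup>* (q0, 0, []) (t, j, z')" using s(3) by (rule rtranclp.rtrancl_into_rtrancl[rotated])
          then show ?thesis using t k by auto
        qed (simp add: k)
      qed (use qS in auto)
      from this[OF that] obtain s where "s \<in> S" "code qf = code s" "(rstep \<Delta> w)\<^sup>*\<^sup>* (q0, 0, []) (s, i, z)"
        using trap qS by auto
      then show ?thesis using code qS by (auto simp: inj_on_def)
    qed
    moreover have "gin M = \<Sigma>" "ginit M = code q0" "gfinal M = code qf" by (simp_all add: M_def)
    ultimately show ?thesis unfolding gsm_rel_def by (simp only:) blast
  qed
  then show ?thesis using \<open>wf_gsm M\<close> unfolding NGSM_def by blast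
qed

text \<open>A path \<open>vs\<close> spelling \<open>z\<close> through the output nodes of an MSO definable transduction,
  described by recognizable languages of tapes with marked positions.\<close>
definition path_rep :: "'a set \<Rightarrow> 'b set \<Rightarrow> ('a list \<times> 'b list) set \<Rightarrow> nat set \<Rightarrow> 'a option list set \<Rightarrow>
  (nat \<Rightarrow> ('a option \<times> bool \<times> bool) list set) \<Rightarrow> (nat \<Rightarrow> ('a option \<times> bool \<times> bool) list set) \<Rightarrow>
  (nat \<Rightarrow> nat \<Rightarrow> 'b \<Rightarrow> ('a option \<times> bool \<times> bool) list set) \<Rightarrow> bool" where
  "path_rep \<Sigma>1 \<Sigma>2 m C D S F E \<longleftrightarrow>
    (\<forall>w\<in>lists \<Sigma>1. w \<in> Domain m \<longleftrightarrow> node_word w \<in> D) \<and>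
    (\<forall>w z. (w, z) \<in> m \<longrightarrow> (\<exists>vs. distinct vs \<and> length vs = Suc (length z) \<and> set vs \<subseteq> {..length w} \<times> C \<and>
      (\<forall>u\<le>length w. \<forall>c\<in>C. marked (node_word w) u u \<in> S c \<longleftrightarrow> (u, c) = vs ! 0) \<and>
      (\<forall>u\<le>length w. \<forall>c\<in>C. marked (node_word w) u u \<in> F c \<longleftrightarrow> (u, c) = vs ! length z) \<and>
      (\<forall>u\<le>length w. \<forall>v\<le>length w. \<forall>c\<in>C. \<forall>d\<in>C. \<forall>\<gamma>\<in>\<Sigma>2. marked (node_word w) u v \<in> E c d \<gamma> \<longleftrightarrow>
         (\<exists>k<length z. (u, c) = vs ! k \<and> (v, d) = vs ! Suc k \<and> \<gamma> = z ! k))))"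

lemma sat1_sat2: "sat1 G \<phi> u \<longleftrightarrow> sat2 G \<phi> u u"
proof -
  have "(\<lambda>_. u)(1 := u) = (\<lambda>_ :: nat. u)" by auto
  then show ?thesis by (simp add: sat1_def sat2_def)
qed

text \<open>The path is the isomorphic image of \<open>ed z\<close>. Its ends are definable as the
  nodes without incoming and without outgoing edge, so the languages \<open>S\<close> and
  \<open>F\<close> come from quantifying over the other endpoint of an edge.\<close>

theorem MSO_ed_path_rep:
  fixes m :: "('a list \<times> 'b list) set"
  assumes fin: "finite \<Sigma>1" "finite \<Sigma>2" and m: "m \<subseteq> lists \<Sigma>1 \<times> lists \<Sigma>2" and mso: "MSO_ed \<Sigma>1 \<Sigma>2 m"
  obtains C D S F E where "finite C" "recog D" "\<And>c. recog (S c)" "\<And>c. recog (F c)" "\<And>c d \<gamma>. recog (E c d \<gamma>)"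
    "path_rep \<Sigma>1 \<Sigma>2 m C D S F E"
proof -
  obtain T :: "(unit, 'a, nat, unit, 'b) msot" where T: "wf_msot T" "tnlabs T = {()}" "telabs T = \<Sigma>2"
    and Tm: "\<And>w b. (w, b) \<in> m \<Longrightarrow> \<exists>H. apply_msot T (ed w) = Some H \<and> graph_iso H (ed b)"
    and To: "\<And>(G :: (nat, unit, 'a) graph) H. graph_over {()} \<Sigma>1 G \<Longrightarrow> apply_msot T G = Some H \<Longrightarrow>
          \<exists>(w,b) \<in> m. graph_iso G (ed w) \<and> graph_iso H (ed b)"
    using mso unfolding MSO_ed_def by fast
  define C where "C = tcopies T"
  have finC: "finite C" using T by (simp add: C_def wf_msot_def)
  have form: "\<exists>L. recog L \<and> (\<forall>w u v. u \<le> length w \<longrightarrow> v \<le> length w \<longrightarrow>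
      (sat2 (ed w) \<phi> u v \<longleftrightarrow> marked (node_word w) u v \<in> L))" for \<phi> :: "(unit, 'a) mso"
    using recog_formula[of \<phi>] by metis
  obtain L0 where L0: "recog L0" "\<And>w u v. u \<le> length w \<Longrightarrow> v \<le> length w \<Longrightarrow>
      sat2 (ed w) (tdom T) u v \<longleftrightarrow> marked (node_word w) u v \<in> L0" using form by metis
  have "\<forall>c. \<exists>L. recog L \<and> (\<forall>w u v. u \<le> length w \<longrightarrow> v \<le> length w \<longrightarrow>
      (sat2 (ed w) (tnode T c ()) u v \<longleftrightarrow> marked (node_word w) u v \<in> L))" using form by blast
  then obtain N where N: "\<And>c. recog (N c)" "\<And>c w u v. u \<le> length w \<Longrightarrow> v \<le> length w \<Longrightarrow>
      sat2 (ed w) (tnode T c ()) u v \<longleftrightarrow> marked (node_word w) u v \<in> N c" by metis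
  have "\<forall>c d \<gamma>. \<exists>L. recog L \<and> (\<forall>w u v. u \<le> length w \<longrightarrow> v \<le> length w \<longrightarrow>
      (sat2 (ed w) (tedge T c d \<gamma>) u v \<longleftrightarrow> marked (node_word w) u v \<in> L))" using form by blast
  then obtain E0 where E0: "\<And>c d \<gamma>. recog (E0 c d \<gamma>)" "\<And>c d \<gamma> w u v. u \<le> length w \<Longrightarrow> v \<le> length w \<Longrightarrow>
      sat2 (ed w) (tedge T c d \<gamma>) u v \<longleftrightarrow> marked (node_word w) u v \<in> E0 c d \<gamma>" by metis
  \<comment> \<open>A closed formula has the same value at every node and node words are nonempty,
    so quantifying over a dummy mark yields a language of plain words.\<close>
  define D where "D = {U. \<exists>j<length U. mark (\<lambda>a b. (a, b, b)) j U \<in> L0}"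
  \<comment> \<open>An edge formula counts only between existing output nodes, so the node formulas
    of both endpoints are built in.\<close>
  define E where "E c d \<gamma> = {U. U \<in> E0 c d \<gamma> \<and> map (\<lambda>(a, b1, b2). (a, b1, b1)) U \<in> N c \<and>
    map (\<lambda>(a, b1, b2). (a, b2, b2)) U \<in> N d}" for c d \<gamma>
  \<comment> \<open>To quantify over a predecessor, the new mark becomes the first one and the
    current node is kept under the second.\<close>
  define S where "S c = {U. U \<in> N c \<and> \<not> (\<exists>p\<in>C \<times> \<Sigma>2. \<exists>j<length U. mark (\<lambda>(a, b1, b2) b. (a, b, b1)) j U \<in>
    (case p of (d, \<gamma>) \<Rightarrow> E d c \<gamma>))}" for c
  define F where "F c = {U. U \<in> N c \<and> \<not> (\<exists>p\<in>C \<times> \<Sigma>2. \<exists>j<length U. mark (\<lambda>(a, b1, b2) b. (a, b1, b)) j U \<in>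
    (case p of (d, \<gamma>) \<Rightarrow> E c d \<gamma>))}" for c
  have finCS: "finite (C \<times> \<Sigma>2)" using finC fin by simp
  have recD: "recog D" unfolding D_def by (rule recog_ex_mark[OF L0(1)])
  have recE: "recog (E c d \<gamma>)" for c d \<gamma>
    unfolding E_def by (intro recog_conj recog_vimage N(1)) (simp add: E0(1))
  have recE': "recog (case p of (d, \<gamma>) \<Rightarrow> E d c \<gamma>)" "recog (case p of (d, \<gamma>) \<Rightarrow> E c d \<gamma>)" for c p
    using recE by (simp_all split: prod.split)
  have recS: "recog (S c)" "recog (F c)" for c
    unfolding S_def F_def by (intro recog_conj recog_Not recog_bex[OF finCS] recog_ex_mark recE'; simp add: N(1))+
  have dom: "apply_msot T (ed w) \<noteq> None \<longleftrightarrow> node_word w \<in> D" for w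
  proof -
    have cl: "fvN (tdom T) = {}" "fvS (tdom T) = {}" using T by (simp_all add: wf_msot_def)
    have "marked (node_word w) j j = mark (\<lambda>a b. (a, b, b)) j (node_word w)" for j
      by (auto simp: marked_def mark_def)
    then have "node_word w \<in> D \<longleftrightarrow> (\<exists>j\<le>length w. sat2 (ed w) (tdom T) j j)"
      using L0(2) by (auto simp: D_def less_Suc_eq_le)
    moreover have "sat2 (ed w) (tdom T) j j \<longleftrightarrow> sat (ed w) (\<lambda>_. undefined) (\<lambda>_. {}) (tdom T)" for j
      unfolding sat2_def by (rule sat_cong) (simp_all add: cl)
    ultimately show ?thesis by (auto simp: apply_msot_def)
  qed
  have "path_rep \<Sigma>1 \<Sigma>2 m C D S F E"
    unfolding path_rep_def
  proof (intro conjI ballI allI impI)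
    fix w assume w: "w \<in> lists \<Sigma>1"
    show "w \<in> Domain m \<longleftrightarrow> node_word w \<in> D"
    proof
      assume "w \<in> Domain m"
      then show "node_word w \<in> D" using Tm dom by fastforce
    next
      assume "node_word w \<in> D"
      then obtain H where "apply_msot T (ed w) = Some H" using dom by blast
      then obtain w' b where "(w', b) \<in> m" "graph_iso (ed w) (ed w')"
        using To[OF graph_over_ed[OF w]] by blast
      then show "w \<in> Domain m" using ed_iso_inj by blast
    qed
  next
    fix w z assume wz: "(w, z) \<in> m"
    then have z: "z \<in> lists \<Sigma>2" using m by auto
    obtain H where H: "apply_msot T (ed w) = Some H" "graph_iso H (ed z)" using Tm[OF wz] by blast
    obtain g where g: "iso_by g (ed z) H" using graph_iso_sym[OF H(2)] graph_iso_iff by blast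
    define vs where "vs = map g [0..<Suc (length z)]"
    have bij: "bij_betw g {0..length z} (verts H)" using g by (simp add: iso_by_def ed_def)
    have vs: "distinct vs" "length vs = Suc (length z)" "set vs = verts H"
      using bij by (auto simp: vs_def distinct_map bij_betw_def atLeastLessThanSuc_atLeastAtMost simp del: upt_Suc)
    have nth: "vs ! k = g k" if "k \<le> length z" for k using that by (simp add: vs_def del: upt_Suc)
    have vH: "(u, c) \<in> verts H \<longleftrightarrow> u \<le> length w \<and> c \<in> C \<and> marked (node_word w) u u \<in> N c" for u c
      unfolding apply_msot_verts[OF H(1) T(2)] sat1_sat2 using N(2)[of u w u c] by (auto simp: ed_def C_def)
    have eH: "((u, c), \<gamma>, (v, d)) \<in> edges H \<longleftrightarrow> (u, c) \<in> verts H \<and> (v, d) \<in> verts H \<and> \<gamma> \<in> \<Sigma>2 \<and>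
        marked (node_word w) u v \<in> E0 c d \<gamma>" for u c \<gamma> v d
      unfolding apply_msot_edges[OF H(1)] T(3) using E0(2)[of u w v c d \<gamma>] vH by auto
    have marks: "map (\<lambda>(a, b1, b2). (a, b1, b1)) (marked W u v) = marked W u u"
      "map (\<lambda>(a, b1, b2). (a, b2, b2)) (marked W u v) = marked W v v"
      "mark (\<lambda>(a, b1, b2) b. (a, b, b1)) j (marked W u u) = marked W j u"
      "mark (\<lambda>(a, b1, b2) b. (a, b1, b)) j (marked W u u) = marked W u j" for W :: "'a option list" and u v j
      by (auto intro!: nth_equalityI simp: mark_def)
    have Eiff: "marked (node_word w) u v \<in> E c d \<gamma> \<longleftrightarrow> ((u, c), \<gamma>, (v, d)) \<in> edges H"
      if "u \<le> length w" "v \<le> length w" "c \<in> C" "d \<in> C" "\<gamma> \<in> \<Sigma>2" for u v c d \<gamma>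
      unfolding eH vH using that by (auto simp: E_def marks)
    have eg: "(p, \<gamma>, q) \<in> edges H \<longleftrightarrow> (\<exists>k<length z. p = vs ! k \<and> q = vs ! Suc k \<and> \<gamma> = z ! k)" for p \<gamma> q
    proof
      assume e: "(p, \<gamma>, q) \<in> edges H"
      then have "p \<in> verts H" "q \<in> verts H" using eH by (cases p; cases q; auto)+
      then have "p \<in> g ` {0..length z}" "q \<in> g ` {0..length z}"
        using bij unfolding bij_betw_def by simp_all
      then obtain i j where ij: "i \<le> length z" "j \<le> length z" "p = g i" "q = g j" by auto
      then have "(i, \<gamma>, j) \<in> edges (ed z)" using g e by (simp add: iso_by_def ed_def)
      then show "\<exists>k<length z. p = vs ! k \<and> q = vs ! Suc k \<and> \<gamma> = z ! k"
        using ij nth by (auto simp: ed_def)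
    next
      assume "\<exists>k<length z. p = vs ! k \<and> q = vs ! Suc k \<and> \<gamma> = z ! k"
      then obtain k where k: "k < length z" "p = g k" "q = g (Suc k)" "\<gamma> = z ! k" using nth by auto
      then have "(k, \<gamma>, Suc k) \<in> edges (ed z)" by (auto simp: ed_def)
      moreover have "k \<in> verts (ed z)" "Suc k \<in> verts (ed z)" using k(1) by (simp_all add: ed_def)
      ultimately show "(p, \<gamma>, q) \<in> edges H" using g k(2,3) unfolding iso_by_def by blast
    qed
    have z\<Sigma>: "z ! k \<in> \<Sigma>2" if "k < length z" for k using z that by (auto simp: in_lists_conv_set)
    have inH: "vs ! k \<in> verts H" if "k \<le> length z" for k using vs that nth_mem[of k vs] by auto
    have inj: "vs ! i = vs ! j \<longleftrightarrow> i = j" if "i \<le> length z" "j \<le> length z" for i j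
      using vs(1,2) that by (simp add: nth_eq_iff_index_eq)
    have Siff: "marked (node_word w) u u \<in> S c \<longleftrightarrow> (u, c) = vs ! 0" if uc: "u \<le> length w" "c \<in> C" for u c
    proof -
      have "marked (node_word w) u u \<in> S c \<longleftrightarrow> (u, c) \<in> verts H \<and>
          \<not> (\<exists>d\<in>C. \<exists>\<gamma>\<in>\<Sigma>2. \<exists>j\<le>length w. ((j, d), \<gamma>, (u, c)) \<in> edges H)"
        unfolding S_def using uc by (auto simp: vH marks Eiff less_Suc_eq_le)
      also have "\<dots> \<longleftrightarrow> (u, c) \<in> verts H \<and> \<not> (\<exists>k<length z. (u, c) = vs ! Suc k)"
      proof -
        have "(\<exists>d\<in>C. \<exists>\<gamma>\<in>\<Sigma>2. \<exists>j\<le>length w. ((j, d), \<gamma>, (u, c)) \<in> edges H) \<longleftrightarrow> (\<exists>p \<gamma>. (p, \<gamma>, (u, c)) \<in> edges H)"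
          using eH vH by auto
        also have "\<dots> \<longleftrightarrow> (\<exists>k<length z. (u, c) = vs ! Suc k)" unfolding eg by blast
        finally show ?thesis by simp
      qed
      also have "\<dots> \<longleftrightarrow> (u, c) = vs ! 0"
      proof
        assume a: "(u, c) \<in> verts H \<and> \<not> (\<exists>k<length z. (u, c) = vs ! Suc k)"
        then obtain k where "k \<le> length z" "(u, c) = vs ! k"
          using vs(2,3) by (metis in_set_conv_nth less_Suc_eq_le)
        then show "(u, c) = vs ! 0" using a by (cases k) (simp, metis Suc_le_lessD)
      next
        assume "(u, c) = vs ! 0"
        then show "(u, c) \<in> verts H \<and> \<not> (\<exists>k<length z. (u, c) = vs ! Suc k)"
          using inH[of 0] inj[of 0] by auto
      qed
      finally show ?thesis .
    qed
    have Fiff: "marked (node_word w) u u \<in> F c \<longleftrightarrow> (u, c) = vs ! length z" if uc: "u \<le> length w" "c \<in> C" for u c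
    proof -
      have "marked (node_word w) u u \<in> F c \<longleftrightarrow> (u, c) \<in> verts H \<and>
          \<not> (\<exists>d\<in>C. \<exists>\<gamma>\<in>\<Sigma>2. \<exists>j\<le>length w. ((u, c), \<gamma>, (j, d)) \<in> edges H)"
        unfolding F_def using uc by (auto simp: vH marks Eiff less_Suc_eq_le)
      also have "\<dots> \<longleftrightarrow> (u, c) \<in> verts H \<and> \<not> (\<exists>k<length z. (u, c) = vs ! k)"
      proof -
        have "(\<exists>d\<in>C. \<exists>\<gamma>\<in>\<Sigma>2. \<exists>j\<le>length w. ((u, c), \<gamma>, (j, d)) \<in> edges H) \<longleftrightarrow> (\<exists>p \<gamma>. ((u, c), \<gamma>, p) \<in> edges H)"
          using eH vH by auto
        also have "\<dots> \<longleftrightarrow> (\<exists>k<length z. (u, c) = vs ! k)" unfolding eg by blast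
        finally show ?thesis by simp
      qed
      also have "\<dots> \<longleftrightarrow> (u, c) = vs ! length z"
      proof
        assume a: "(u, c) \<in> verts H \<and> \<not> (\<exists>k<length z. (u, c) = vs ! k)"
        then obtain k where "k \<le> length z" "(u, c) = vs ! k"
          using vs(2,3) by (metis in_set_conv_nth less_Suc_eq_le)
        then show "(u, c) = vs ! length z" using a le_neq_implies_less[of k "length z"] by metis
      next
        assume "(u, c) = vs ! length z"
        then show "(u, c) \<in> verts H \<and> \<not> (\<exists>k<length z. (u, c) = vs ! k)"
          using inH[of "length z"] inj[of "length z"] by auto
      qed
      finally show ?thesis .
    qed
    have "set vs \<subseteq> {..length w} \<times> C" using vs(3) vH by auto
    then show "\<exists>vs. distinct vs \<and> length vs = Suc (length z) \<and> set vs \<subseteq> {..length w} \<times> C \<and>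
      (\<forall>u\<le>length w. \<forall>c\<in>C. marked (node_word w) u u \<in> S c \<longleftrightarrow> (u, c) = vs ! 0) \<and>
      (\<forall>u\<le>length w. \<forall>c\<in>C. marked (node_word w) u u \<in> F c \<longleftrightarrow> (u, c) = vs ! length z) \<and>
      (\<forall>u\<le>length w. \<forall>v\<le>length w. \<forall>c\<in>C. \<forall>d\<in>C. \<forall>\<gamma>\<in>\<Sigma>2. marked (node_word w) u v \<in> E c d \<gamma> \<longleftrightarrow>
         (\<exists>k<length z. (u, c) = vs ! k \<and> (v, d) = vs ! Suc k \<and> \<gamma> = z ! k))"
      using vs(1,2) Siff Fiff Eiff eg by (intro exI[of _ vs]) simp
  qed
  then show thesis using that finC recD recS recE by blast
qed

section \<open>Factorization of words at their marked positions\<close>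

definition unmarked :: "'a option list \<Rightarrow> ('a option \<times> bool \<times> bool) list" where
  "unmarked = map (\<lambda>a. (a, False, False))"

lemma unmarked_simps [simp]: "length (unmarked W) = length W" "k < length W \<Longrightarrow> unmarked W ! k = (W ! k, False, False)"
  by (simp_all add: unmarked_def)

lemma nth_middle_append:
  "(A @ [x] @ B) ! i = (if i < length A then A ! i else if i = length A then x else B ! (i - Suc (length A)))"
proof (cases "i \<le> length A")
  case False
  then obtain n where "i = Suc (length A + n)" by (metis less_imp_Suc_add linorder_not_le)
  then show ?thesis by (simp add: nth_append)
qed (auto simp: nth_append)

lemma map_fst_unmarked [simp]: "map fst (unmarked W) = W"
  by (simp add: unmarked_def comp_def)

text \<open>The form in which machines test membership: they know a class, not the word.\<close>

lemma saturates_image: "saturates f L \<Longrightarrow> f U \<in> f ` L \<longleftrightarrow> U \<in> L"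
  unfolding saturates_def by blast

lemma marked_same:
  assumes "u < length W"
  shows "marked W u u = unmarked (take u W) @ [(W ! u, True, True)] @ unmarked (drop (Suc u) W)"
  by (rule nth_equalityI) (use assms in \<open>simp_all add: nth_middle_append del: append.simps\<close>)

text \<open>A second mark at \<open>length W\<close> lies outside the word, so
  \<open>marked W u (length W)\<close> carries the first mark only. Its prefix up to
  \<open>v\<close> is what a walk from \<open>u\<close> to the right has accumulated on arrival at
  \<open>v\<close>.\<close>

lemma marked_less:
  assumes "u < v" "v < length W"
  shows "marked W u v = take v (marked W u (length W)) @ [(W ! v, False, True)] @ unmarked (drop (Suc v) W)"
  by (rule nth_equalityI) (use assms in \<open>simp_all add: nth_middle_append del: append.simps\<close>)

lemma marked_greater:
  assumes "v < u" "u < length W"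
  shows "marked W u v = unmarked (take v W) @ [(W ! v, False, True)] @ drop (Suc v) (marked W u (length W))"
  by (rule nth_equalityI) (use assms in \<open>simp_all add: nth_middle_append del: append.simps\<close>)

lemma take_Suc_marked:
  "i < length W \<Longrightarrow> take (Suc i) (marked W u (length W)) = take i (marked W u (length W)) @ [(W ! i, i = u, False)]"
  by (simp add: take_Suc_conv_app_nth)

lemma drop_marked:
  "i < length W \<Longrightarrow> drop i (marked W u (length W)) = (W ! i, i = u, False) # drop (Suc i) (marked W u (length W))"
  by (simp add: Cons_nth_drop_Suc[symmetric])

lemma take_marked_before: "i \<le> u \<Longrightarrow> u < length W \<Longrightarrow> take i (marked W u (length W)) = unmarked (take i W)"
  by (rule nth_equalityI) auto

lemma drop_marked_after: "u < length W \<Longrightarrow> drop (Suc u) (marked W u (length W)) = unmarked (drop (Suc u) W)"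
  by (rule nth_equalityI) auto

text \<open>A travelling state holds the source copy, the guessed target copy, the guessed label and
  a class. The class covers everything strictly to the left of the head when walking right, and
  strictly to the right of it when walking left; the marked source is always included.\<close>

datatype 'b walk = Seek | At nat | Rightw nat nat 'b nat | Leftw nat nat 'b nat | Done

text \<open>The walking machine reads nodes annotated with the classes \<open>l\<close> and \<open>r\<close> of the parts of the
  word to their left and right. To follow an edge it guesses direction, target copy and label,
  and accumulates the class of the part of the word it traverses.\<close>
locale walker =
  fixes f :: "('a option \<times> bool \<times> bool) list \<Rightarrow> nat" and mul :: "nat \<Rightarrow> nat \<Rightarrow> nat"
    and C :: "nat set" and \<Sigma>1 :: "'a set" and \<Sigma>2 :: "'b set"
    and D :: "'a option list set"
    and S F :: "nat \<Rightarrow> ('a option \<times> bool \<times> bool) list set"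
    and E :: "nat \<Rightarrow> nat \<Rightarrow> 'b \<Rightarrow> ('a option \<times> bool \<times> bool) list set"
    and m :: "('a list \<times> 'b list) set"
  assumes fc: "fcong f" and mul: "\<And>u v. f (u @ v) = mul (f u) (f v)"
    and finC: "finite C" and fin1: "finite \<Sigma>1" and fin2: "finite \<Sigma>2"
    and satD: "saturates f {U. map fst U \<in> D}"
    and satS: "\<And>c. c \<in> C \<Longrightarrow> saturates f (S c)" and satF: "\<And>c. c \<in> C \<Longrightarrow> saturates f (F c)"
    and satE: "\<And>c d \<gamma>. c \<in> C \<Longrightarrow> d \<in> C \<Longrightarrow> \<gamma> \<in> \<Sigma>2 \<Longrightarrow> saturates f (E c d \<gamma>)"
    and m: "m \<subseteq> lists \<Sigma>1 \<times> lists \<Sigma>2"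
    and rep: "path_rep \<Sigma>1 \<Sigma>2 m C D S F E"
begin

definition letters :: "('a option \<times> nat \<times> nat) set" where
  "letters = insert None (Some ` \<Sigma>1) \<times> range f \<times> range f"

lemma finite_range: "finite (range f)"
  using fc by (simp add: fcong_def)

lemma finite_letters: "finite letters"
  using finite_range fin1 by (simp add: letters_def)

text \<open>Intermediate words of a composition are words over numbers, so annotated letters have to
  be coded.\<close>

definition code :: "'a option \<times> nat \<times> nat \<Rightarrow> nat" where
  "code = (SOME h. inj_on h letters)"

lemma code_inj: "inj_on code letters"
proof -
  have "\<exists>h :: _ \<Rightarrow> nat. inj_on h letters"
    using finite_imp_inj_to_nat_seg[OF finite_letters] by blast
  then show ?thesis unfolding code_def by (rule someI_ex)
qed

lemma code_eq: "x \<in> letters \<Longrightarrow> y \<in> letters \<Longrightarrow> code x = code y \<longleftrightarrow> x = y"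
  using code_inj by (auto simp: inj_on_def)

definition lclass :: "'a list \<Rightarrow> nat \<Rightarrow> nat" where
  "lclass w u = f (unmarked (take u (node_word w)))"

definition rclass :: "'a list \<Rightarrow> nat \<Rightarrow> nat" where
  "rclass w u = f (unmarked (drop (Suc u) (node_word w)))"

definition letter :: "'a list \<Rightarrow> nat \<Rightarrow> 'a option \<times> nat \<times> nat" where
  "letter w u = (node_word w ! u, lclass w u, rclass w u)"

definition ann :: "'a list \<Rightarrow> nat list" where
  "ann w = map (\<lambda>u. code (letter w u)) [0..<Suc (length w)]"

lemma length_ann [simp]: "length (ann w) = Suc (length w)"
  by (simp add: ann_def)

lemma letter_in: "w \<in> lists \<Sigma>1 \<Longrightarrow> u \<le> length w \<Longrightarrow> letter w u \<in> letters"
  by (auto simp: letter_def letters_def lclass_def rclass_def nth_node_word in_lists_conv_set)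

lemma mulR: "k \<in> range f \<Longrightarrow> mul k (f U) \<in> range f" "k \<in> range f \<Longrightarrow> mul (f U) k \<in> range f"
  using mul by (metis imageE rangeI)+

lemma lclass_Suc: "u \<le> length w \<Longrightarrow> lclass w (Suc u) = mul (lclass w u) (f [(node_word w ! u, False, False)])"
  by (simp add: lclass_def mul[symmetric] take_Suc_conv_app_nth unmarked_def)

text \<open>In contrast to \<open>rclass\<close>, node \<open>u\<close> itself is included: this is
  the value the annotating machine must have guessed when it is about to read node
  \<open>u\<close>.\<close>

definition sclass :: "'a list \<Rightarrow> nat \<Rightarrow> nat" where
  "sclass w u = f (unmarked (drop u (node_word w)))"

lemma sclass_rclass: "u \<le> length w \<Longrightarrow> sclass w u = mul (f [(node_word w ! u, False, False)]) (rclass w u)"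
  by (simp add: sclass_def rclass_def mul[symmetric] Cons_nth_drop_Suc[symmetric] unmarked_def)

lemma rclass_sclass: "rclass w u = sclass w (Suc u)"
  by (simp add: sclass_def rclass_def)

lemma class_in: "lclass w u \<in> range f" "rclass w u \<in> range f" "sclass w u \<in> range f"
  by (simp_all add: lclass_def rclass_def sclass_def)

section \<open>The annotating machine\<close>

text \<open>The annotating machine guesses the class of the rest of the word and verifies the guess
  letter by letter.\<close>
definition annotate_rules :: "(nat \<times> nat \<times> nat, 'a, nat) word_rule set" where
  "annotate_rules =
     {((0, 0, 0), LEnd, (1, f [], \<rho>), [], 1) | \<rho>. \<rho> \<in> range f} \<union>
     {((1, l, mul (f [(Some a, False, False)]) r), Sym a, (1, mul l (f [(Some a, False, False)]), r),
        [code (Some a, l, r)], 1) | l r a. l \<in> range f \<and> r \<in> range f \<and> a \<in> \<Sigma>1} \<union>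
     {((1, l, f [(None, False, False)]), REnd, (2, 0, 0), [code (None, l, f [])], 0) | l.
        l \<in> range f \<and> mul l (f [(None, False, False)]) \<in> f ` {U. map fst U \<in> D}}"

lemma annotate_rel:
  "{(w, z). w \<in> lists \<Sigma>1 \<and> (\<exists>i. (rstep annotate_rules w)\<^sup>*\<^sup>* ((0, 0, 0), 0, []) ((2, 0, 0), i, z))}
    = {(w, ann w) | w. w \<in> lists \<Sigma>1 \<and> node_word w \<in> D}"
proof (intro set_eqI iffI)
  fix p assume "p \<in> {(w, z). w \<in> lists \<Sigma>1 \<and> (\<exists>i. (rstep annotate_rules w)\<^sup>*\<^sup>* ((0, 0, 0), 0, []) ((2, 0, 0), i, z))}"
  then obtain w z i where p: "p = (w, z)" "w \<in> lists \<Sigma>1"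
    "(rstep annotate_rules w)\<^sup>*\<^sup>* ((0, 0, 0), 0, []) ((2, 0, 0), i, z)" by auto
  \<comment> \<open>A guess may be wrong, so the annotation is claimed correct only under the
    hypothesis that the current guess is the true class. A correct new guess implies that the
    previous one was correct, and at the right end marker the rule itself enforces
    correctness.\<close>
  define inv where "inv = (\<lambda>((t :: nat, l, \<rho>), i, z). (t = 0 \<longrightarrow> i = 0 \<and> z = []) \<and>
     (t = 1 \<longrightarrow> (\<exists>u\<le>length w. i = Suc u \<and> l = lclass w u \<and> (\<rho> = sclass w u \<longrightarrow> z = take u (ann w)))) \<and>
     (t = 2 \<longrightarrow> z = ann w \<and> node_word w \<in> D))"
  have "inv k" if "(rstep annotate_rules w)\<^sup>*\<^sup>* ((0, 0, 0), 0, []) k" for k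
    using that
  proof (induction rule: rtranclp_induct)
    case base
    then show ?case by (simp add: inv_def)
  next
    case (step k k')
    obtain s i z t j z' where k: "k = (s, i, z)" "k' = (t, j, z')" by (metis prod_cases3)
    then obtain a e where r: "(s, tape w i, t, a, e) \<in> annotate_rules" "z' = z @ a" "int j = int i + e" "j \<le> length w + 1"
      using step(2) by (auto simp: rstep_def)
    from r(1) consider (1) \<rho> where "s = (0, 0, 0)" "t = (1, f [], \<rho>)" "a = []" "e = 1"
      | (2) l r' b where "s = (1, l, mul (f [(Some b, False, False)]) r')" "tape w i = Sym b"
          "t = (1, mul l (f [(Some b, False, False)]), r')" "a = [code (Some b, l, r')]" "e = 1"
      | (3) l where "s = (1, l, f [(None, False, False)])" "tape w i = REnd" "t = (2, 0, 0)"
          "a = [code (None, l, f [])]" "e = 0" "mul l (f [(None, False, False)]) \<in> f ` {U. map fst U \<in> D}"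
      unfolding annotate_rules_def by blast
    then show ?case
    proof cases
      case 1
      then show ?thesis using step(3) r k by (simp add: inv_def lclass_def unmarked_def)
    next
      case 2
      then obtain u where u: "u \<le> length w" "i = Suc u" "l = lclass w u"
        "mul (f [(Some b, False, False)]) r' = sclass w u \<longrightarrow> z = take u (ann w)"
        using step(3) k by (auto simp: inv_def)
      have ul: "u < length w" and b: "node_word w ! u = Some b"
        using 2(2) u(1,2) by (auto simp: tape_def nth_node_word split: if_splits)
      have "z' = take (Suc u) (ann w)" if r': "r' = sclass w (Suc u)"
      proof -
        have "z = take u (ann w)" using u(4) sclass_rclass[OF u(1)] r' b by (simp add: rclass_sclass)
        then show ?thesis using r(2) 2(4) u ul b r'
          by (simp add: take_Suc_conv_app_nth ann_def letter_def rclass_sclass del: upt_Suc)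
      qed
      moreover have "mul l (f [(Some b, False, False)]) = lclass w (Suc u)"
        using lclass_Suc[OF u(1)] u(3) b by simp
      moreover have "j = Suc (Suc u)" using r(3) 2(5) u(2) by simp
      ultimately show ?thesis using 2(3) k(2) ul by (auto simp: inv_def intro!: exI[of _ "Suc u"])
    next
      case 3
      then obtain u where u: "u \<le> length w" "i = Suc u" "l = lclass w u"
        "f [(None, False, False)] = sclass w u \<longrightarrow> z = take u (ann w)"
        using step(3) k by (auto simp: inv_def)
      have ul: "u = length w" using 3(2) u(1,2) by (auto simp: tape_def split: if_splits)
      have nw: "node_word w ! u = None" "drop u (node_word w) = [None]" "drop (Suc u) (node_word w) = []"
        using ul by (simp_all add: node_word_def nth_append)
      then have "z = take u (ann w)" using u(4) by (simp add: sclass_def unmarked_def)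
      moreover have "ann w ! u = code (None, l, f [])"
        using u(1,3) nw by (simp add: ann_def letter_def rclass_def unmarked_def del: upt_Suc)
      moreover have "take (Suc u) (ann w) = take u (ann w) @ [ann w ! u]"
        by (rule take_Suc_conv_app_nth) (use ul in simp)
      ultimately have "z' = take (Suc u) (ann w)" using r(2) 3(4) by simp
      then have "z' = ann w" using ul by simp
      moreover have "mul l (f [(None, False, False)]) = f (unmarked (node_word w))"
        using lclass_Suc[OF u(1)] u(3) nw ul by (simp add: lclass_def)
      then have "node_word w \<in> D"
        using 3(6) saturates_image[OF satD, of "unmarked (node_word w)"] by simp
      ultimately show ?thesis using 3 k by (simp add: inv_def)
    qed
  qed
  from this[OF p(3)] show "p \<in> {(w, ann w) | w. w \<in> lists \<Sigma>1 \<and> node_word w \<in> D}"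
    using p by (simp add: inv_def)
next
  fix p assume "p \<in> {(w, ann w) | w. w \<in> lists \<Sigma>1 \<and> node_word w \<in> D}"
  then obtain w where p: "p = (w, ann w)" "w \<in> lists \<Sigma>1" "node_word w \<in> D" by auto
  have "(rstep annotate_rules w)\<^sup>*\<^sup>* ((0, 0, 0), 0, []) ((1, lclass w u, sclass w u), Suc u, take u (ann w))"
    if "u \<le> length w" for u
    using that
  proof (induction u)
    case 0
    have "rstep annotate_rules w ((0, 0, 0), 0, []) ((1, lclass w 0, sclass w 0), Suc 0, [])"
      unfolding rstep_def annotate_rules_def using class_in by (auto simp: tape_def lclass_def unmarked_def)
    then show ?case by auto
  next
    case (Suc u)
    then have u: "u < length w" by simp
    have b: "node_word w ! u = Some (w ! u)" "tape w (Suc u) = Sym (w ! u)" "w ! u \<in> \<Sigma>1"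
      using u p(2) by (auto simp: nth_node_word tape_def in_lists_conv_set)
    have "((1, lclass w u, sclass w u), tape w (Suc u), (1, lclass w (Suc u), sclass w (Suc u)), [code (letter w u)], 1)
        \<in> annotate_rules"
      using lclass_Suc[of u w] sclass_rclass[of u w] u b class_in
      unfolding annotate_rules_def letter_def rclass_sclass by auto
    moreover have "take (Suc u) (ann w) = take u (ann w) @ [code (letter w u)]"
      using u by (simp add: take_Suc_conv_app_nth ann_def del: upt_Suc)
    ultimately have "rstep annotate_rules w ((1, lclass w u, sclass w u), Suc u, take u (ann w))
        ((1, lclass w (Suc u), sclass w (Suc u)), Suc (Suc u), take (Suc u) (ann w))"
      using u unfolding rstep_def by auto
    then show ?case using Suc.IH u by (simp add: rtranclp.rtrancl_into_rtrancl)
  qed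
  from this[of "length w"] have run: "(rstep annotate_rules w)\<^sup>*\<^sup>* ((0, 0, 0), 0, [])
      ((1, lclass w (length w), sclass w (length w)), Suc (length w), take (length w) (ann w))" by simp
  have nw: "node_word w ! length w = None" "drop (length w) (node_word w) = [None]" "drop (Suc (length w)) (node_word w) = []"
    by (simp_all add: node_word_def nth_append)
  have "mul (lclass w (length w)) (f [(None, False, False)]) = f (unmarked (node_word w))"
    using lclass_Suc[of "length w" w] nw by (simp add: lclass_def)
  moreover have "unmarked (node_word w) \<in> {U. map fst U \<in> D}"
    using p(3) by (simp add: unmarked_def comp_def)
  ultimately have "((1, lclass w (length w), sclass w (length w)), tape w (Suc (length w)), (2, 0, 0), [code (letter w (length w))], 0)
      \<in> annotate_rules"
    using class_in nw unfolding annotate_rules_def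
    \<comment> \<open>The last node is written while scanning the right end marker, since a word has
      one node more than letters.\<close>
    by (auto simp: tape_def sclass_def letter_def rclass_def unmarked_def)
  moreover have "ann w = take (length w) (ann w) @ [code (letter w (length w))]"
    by (simp add: ann_def)
  ultimately have "rstep annotate_rules w ((1, lclass w (length w), sclass w (length w)), Suc (length w), take (length w) (ann w))
      ((2, 0, 0), Suc (length w), ann w)"
    unfolding rstep_def by auto
  with run have "(rstep annotate_rules w)\<^sup>*\<^sup>* ((0, 0, 0), 0, []) ((2, 0, 0), Suc (length w), ann w)"
    by (rule rtranclp.rtrancl_into_rtrancl)
  then show "p \<in> {(w, z). w \<in> lists \<Sigma>1 \<and> (\<exists>i. (rstep annotate_rules w)\<^sup>*\<^sup>* ((0, 0, 0), 0, []) ((2, 0, 0), i, z))}"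
    using p by auto
qed

lemma annotate_NGSM: "{(w, ann w) | w. w \<in> lists \<Sigma>1 \<and> node_word w \<in> D} \<in> NGSM"
  unfolding annotate_rel[symmetric]
proof (rule NGSM_of_rules[of _ _ "code ` letters"])
  show "finite annotate_rules"
  proof -
    let ?Q = "{0, 1, 2} \<times> insert 0 (range f) \<times> insert 0 (range f)"
    let ?T = "{LEnd, REnd} \<union> Sym ` \<Sigma>1"
    have "annotate_rules \<subseteq> ?Q \<times> ?T \<times> ?Q \<times> insert [] ((\<lambda>x. [code x]) ` letters) \<times> {0, 1}"
      unfolding annotate_rules_def
      by (intro Un_least subsetI; elim CollectE exE conjE; simp add: mulR letters_def)
    then show ?thesis
      by (rule finite_subset) (use finite_range finite_letters fin1 in auto)
  qed
  show "s \<noteq> (2, 0, 0) \<and> \<sigma> \<in> {LEnd, REnd} \<union> Sym ` \<Sigma>1 \<and> a \<in> lists (code ` letters) \<and> e \<in> {- 1, 0, 1}"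
    if "(s, \<sigma>, t, a, e) \<in> annotate_rules" for s \<sigma> t a e
    using that by (auto simp: annotate_rules_def letters_def)
qed (use fin1 finite_letters in auto)

text \<open>The guesses made on leaving a node are verified on arrival, where the annotation
  supplies the class of the side that has not been traversed. The edge test is membership of the
  resulting class in the image of \<open>E c d \<gamma>\<close> under \<open>f\<close>. Conditions
  such as \<open>k \<in> range f\<close> keep the set of rules finite.\<close>

inductive wstep :: "'b walk \<Rightarrow> 'a option \<times> nat \<times> nat \<Rightarrow> 'b walk \<Rightarrow> 'b list \<Rightarrow> int \<Rightarrow> bool" where
  seek: "wstep Seek x Seek [] 1"
| start: "c \<in> C \<Longrightarrow> mul l (mul (f [(a, True, True)]) r) \<in> f ` S c \<Longrightarrow> wstep Seek (a, l, r) (At c) [] 0"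
| stop: "c \<in> C \<Longrightarrow> mul l (mul (f [(a, True, True)]) r) \<in> f ` F c \<Longrightarrow> wstep (At c) (a, l, r) Done [] 0"
| stay: "c \<in> C \<Longrightarrow> d \<in> C \<Longrightarrow> \<gamma> \<in> \<Sigma>2 \<Longrightarrow> mul l (mul (f [(a, True, True)]) r) \<in> f ` E c d \<gamma> \<Longrightarrow>
    wstep (At c) (a, l, r) (At d) [\<gamma>] 0"
| right: "c \<in> C \<Longrightarrow> d \<in> C \<Longrightarrow> \<gamma> \<in> \<Sigma>2 \<Longrightarrow> l \<in> range f \<Longrightarrow>
    wstep (At c) (a, l, r) (Rightw c d \<gamma> (mul l (f [(a, True, False)]))) [] 1"
| left: "c \<in> C \<Longrightarrow> d \<in> C \<Longrightarrow> \<gamma> \<in> \<Sigma>2 \<Longrightarrow> r \<in> range f \<Longrightarrow>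
    wstep (At c) (a, l, r) (Leftw c d \<gamma> (mul (f [(a, True, False)]) r)) [] (-1)"
| right_go: "c \<in> C \<Longrightarrow> d \<in> C \<Longrightarrow> \<gamma> \<in> \<Sigma>2 \<Longrightarrow> k \<in> range f \<Longrightarrow>
    wstep (Rightw c d \<gamma> k) (a, l, r) (Rightw c d \<gamma> (mul k (f [(a, False, False)]))) [] 1"
| left_go: "c \<in> C \<Longrightarrow> d \<in> C \<Longrightarrow> \<gamma> \<in> \<Sigma>2 \<Longrightarrow> k \<in> range f \<Longrightarrow>
    wstep (Leftw c d \<gamma> k) (a, l, r) (Leftw c d \<gamma> (mul (f [(a, False, False)]) k)) [] (-1)"
| right_stop: "c \<in> C \<Longrightarrow> d \<in> C \<Longrightarrow> \<gamma> \<in> \<Sigma>2 \<Longrightarrow> k \<in> range f \<Longrightarrow>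
    mul k (mul (f [(a, False, True)]) r) \<in> f ` E c d \<gamma> \<Longrightarrow>
    wstep (Rightw c d \<gamma> k) (a, l, r) (At d) [\<gamma>] 0"
| left_stop: "c \<in> C \<Longrightarrow> d \<in> C \<Longrightarrow> \<gamma> \<in> \<Sigma>2 \<Longrightarrow> k \<in> range f \<Longrightarrow>
    mul l (mul (f [(a, False, True)]) k) \<in> f ` E c d \<gamma> \<Longrightarrow>
    wstep (Leftw c d \<gamma> k) (a, l, r) (At d) [\<gamma>] 0"

definition walk_rules :: "('b walk, nat, 'b) word_rule set" where
  "walk_rules = insert (Seek, LEnd, Seek, [], 1)
     {(s, Sym (code x), t, a, e) | s x t a e. x \<in> letters \<and> wstep s x t a e}"

definition walk_rel :: "(nat list \<times> 'b list) set" where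
  "walk_rel = {(v, z). v \<in> lists (code ` letters) \<and> (\<exists>i. (rstep walk_rules v)\<^sup>*\<^sup>* (Seek, 0, []) (Done, i, z))}"

lemma walk_NGSM: "walk_rel \<in> NGSM"
  unfolding walk_rel_def
proof (rule NGSM_of_rules[of _ _ \<Sigma>2])
  define RS where "RS = (\<lambda>(c, d, \<gamma>, k). Rightw c d \<gamma> k) ` (C \<times> C \<times> \<Sigma>2 \<times> range f)"
  define LS where "LS = (\<lambda>(c, d, \<gamma>, k). Leftw c d \<gamma> k) ` (C \<times> C \<times> \<Sigma>2 \<times> range f)"
  have RS: "Rightw c d \<gamma> k \<in> RS" if "c \<in> C" "d \<in> C" "\<gamma> \<in> \<Sigma>2" "k \<in> range f" for c d \<gamma> k
    unfolding RS_def by (rule image_eqI[of _ _ "(c, d, \<gamma>, k)"]) (use that in simp_all)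
  have LS: "Leftw c d \<gamma> k \<in> LS" if "c \<in> C" "d \<in> C" "\<gamma> \<in> \<Sigma>2" "k \<in> range f" for c d \<gamma> k
    unfolding LS_def by (rule image_eqI[of _ _ "(c, d, \<gamma>, k)"]) (use that in simp_all)
  have "finite RS" "finite LS" using finC fin2 finite_range by (simp_all add: RS_def LS_def)
  let ?Q = "{Seek, Done} \<union> At ` C \<union> RS \<union> LS"
  have w: "s \<in> ?Q \<and> t \<in> ?Q \<and> a \<in> insert [] ((\<lambda>\<gamma>. [\<gamma>]) ` \<Sigma>2) \<and> e \<in> {-1, 0, 1} \<and> s \<noteq> Done"
    if "wstep s x t a e" for s x t a e
    using that by (induction rule: wstep.induct) (simp_all add: RS LS mulR)
  show "finite walk_rules"
  proof (rule finite_subset)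
    show "walk_rules \<subseteq> ?Q \<times> insert LEnd (Sym ` code ` letters) \<times> ?Q \<times> insert [] ((\<lambda>\<gamma>. [\<gamma>]) ` \<Sigma>2) \<times> {-1, 0, 1}"
    proof
      fix p assume "p \<in> walk_rules"
      then consider "p = (Seek, LEnd, Seek, [], 1)"
        | s x t a e where "p = (s, Sym (code x), t, a, e)" "x \<in> letters" "wstep s x t a e"
        unfolding walk_rules_def by blast
      then show "p \<in> ?Q \<times> insert LEnd (Sym ` code ` letters) \<times> ?Q \<times> insert [] ((\<lambda>\<gamma>. [\<gamma>]) ` \<Sigma>2) \<times> {-1, 0, 1}"
      proof cases
        case 2
        then show ?thesis using w[OF 2(3)] by blast
      qed simp
    qed
    show "finite (?Q \<times> insert LEnd (Sym ` code ` letters) \<times> ?Q \<times> insert [] ((\<lambda>\<gamma>. [\<gamma>]) ` \<Sigma>2) \<times> {-1, 0, 1 :: int})"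
      using finC fin2 finite_letters \<open>finite RS\<close> \<open>finite LS\<close> by simp
  qed
  show "s \<noteq> Done \<and> \<sigma> \<in> {LEnd, REnd} \<union> Sym ` (code ` letters) \<and> a \<in> lists \<Sigma>2 \<and> e \<in> {- 1, 0, 1}"
    if "(s, \<sigma>, t, a, e) \<in> walk_rules" for s \<sigma> t a e
  proof -
    from that consider "s = Seek" "\<sigma> = LEnd" "a = []" "e = 1"
      | x where "\<sigma> = Sym (code x)" "x \<in> letters" "wstep s x t a e"
      unfolding walk_rules_def by blast
    then show ?thesis
    proof cases
      case 2
      then show ?thesis using w[OF 2(3)] by auto
    qed simp
  qed
qed (use finite_letters fin2 in auto)

lemma tape_ann:
  "u \<le> length w \<Longrightarrow> tape (ann w) (Suc u) = Sym (code (letter w u))"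
  by (simp add: tape_def ann_def del: upt_Suc)

lemma walk_rules_letter:
  assumes "x \<in> letters"
  shows "(s, Sym (code x), t, a, e) \<in> walk_rules \<longleftrightarrow> wstep s x t a e"
proof
  assume "(s, Sym (code x), t, a, e) \<in> walk_rules"
  then obtain y where "code x = code y" "y \<in> letters" "wstep s y t a e"
    unfolding walk_rules_def by blast
  then show "wstep s x t a e" using code_eq[OF assms] by simp
next
  assume "wstep s x t a e"
  then show "(s, Sym (code x), t, a, e) \<in> walk_rules" unfolding walk_rules_def using assms by blast
qed

lemma walk_step:
  assumes "w \<in> lists \<Sigma>1" "u \<le> length w"
  shows "rstep walk_rules (ann w) (s, Suc u, y) (t, j, y') \<longleftrightarrow>
    (\<exists>a e. wstep s (letter w u) t a e \<and> y' = y @ a \<and> int j = int (Suc u) + e \<and> j \<le> length w + 2)"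
proof -
  show ?thesis
    using assms(2) by (simp add: rstep_def tape_ann walk_rules_letter[OF letter_in[OF assms]])
qed

lemma class_marked_same:
  "u \<le> length w \<Longrightarrow> mul (lclass w u) (mul (f [(node_word w ! u, True, True)]) (rclass w u)) = f (marked (node_word w) u u)"
  by (simp add: marked_same mul[symmetric] lclass_def rclass_def)

lemma class_marked_less:
  "u < v \<Longrightarrow> v \<le> length w \<Longrightarrow>
    mul (f (take v (marked (node_word w) u (Suc (length w))))) (mul (f [(node_word w ! v, False, True)]) (rclass w v))
    = f (marked (node_word w) u v)"
  using marked_less[of u v "node_word w"] by (simp add: mul[symmetric] rclass_def)

lemma class_marked_greater:
  "v < u \<Longrightarrow> u \<le> length w \<Longrightarrow>
    mul (lclass w v) (mul (f [(node_word w ! v, False, True)]) (f (drop (Suc v) (marked (node_word w) u (Suc (length w))))))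
    = f (marked (node_word w) u v)"
  using marked_greater[of v u "node_word w"] by (simp add: mul[symmetric] lclass_def)

lemma class_take_Suc:
  "v \<le> length w \<Longrightarrow> f (take (Suc v) (marked (node_word w) u (Suc (length w)))) =
    mul (f (take v (marked (node_word w) u (Suc (length w))))) (f [(node_word w ! v, v = u, False)])"
  using take_Suc_marked[of v "node_word w" u] by (simp add: mul[symmetric])

lemma class_drop:
  "v \<le> length w \<Longrightarrow> f (drop v (marked (node_word w) u (Suc (length w)))) =
    mul (f [(node_word w ! v, v = u, False)]) (f (drop (Suc v) (marked (node_word w) u (Suc (length w)))))"
  using drop_marked[of v "node_word w" u] by (simp add: mul[symmetric])

lemma class_take: "u \<le> length w \<Longrightarrow> f (take u (marked (node_word w) u (Suc (length w)))) = lclass w u"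
  using take_marked_before[of u u "node_word w"] by (simp add: lclass_def)

lemma class_drop_after: "u \<le> length w \<Longrightarrow> f (drop (Suc u) (marked (node_word w) u (Suc (length w)))) = rclass w u"
  using drop_marked_after[of u "node_word w"] by (simp add: rclass_def)

text \<open>Guessing is harmless: every accepted arrival certifies an edge, and the edges form a
  single simple path, so the emitted letters are forced. A walk that is never accepted ends at an
  end marker, where no rule applies to a travelling state.\<close>

lemma walk_path:
  assumes wz: "(w, z) \<in> m"
  shows "(\<exists>i. (rstep walk_rules (ann w))\<^sup>*\<^sup>* (Seek, 0, []) (Done, i, z')) \<longleftrightarrow> z' = z"
proof -
  have w: "w \<in> lists \<Sigma>1" and z: "z \<in> lists \<Sigma>2" using wz m by auto
  obtain vs where vs: "distinct vs" "length vs = Suc (length z)" "set vs \<subseteq> {..length w} \<times> C"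
    and vS': "\<forall>u\<le>length w. \<forall>c\<in>C. marked (node_word w) u u \<in> S c \<longleftrightarrow> (u, c) = vs ! 0"
    and vF': "\<forall>u\<le>length w. \<forall>c\<in>C. marked (node_word w) u u \<in> F c \<longleftrightarrow> (u, c) = vs ! length z"
    and vE': "\<forall>u\<le>length w. \<forall>v\<le>length w. \<forall>c\<in>C. \<forall>d\<in>C. \<forall>\<gamma>\<in>\<Sigma>2. marked (node_word w) u v \<in> E c d \<gamma> \<longleftrightarrow>
         (\<exists>k<length z. (u, c) = vs ! k \<and> (v, d) = vs ! Suc k \<and> \<gamma> = z ! k)"
    using rep[unfolded path_rep_def, THEN conjunct2, THEN spec, THEN spec, THEN mp, OF wz]
    by (elim exE conjE) (rule that)
  have vS: "marked (node_word w) u u \<in> S c \<longleftrightarrow> (u, c) = vs ! 0" if "u \<le> length w" "c \<in> C" for u c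
    using vS' that by blast
  have vF: "marked (node_word w) u u \<in> F c \<longleftrightarrow> (u, c) = vs ! length z" if "u \<le> length w" "c \<in> C" for u c
    using vF' that by blast
  have vE: "marked (node_word w) u v \<in> E c d \<gamma> \<longleftrightarrow> (\<exists>k<length z. (u, c) = vs ! k \<and> (v, d) = vs ! Suc k \<and> \<gamma> = z ! k)"
    if "u \<le> length w" "v \<le> length w" "c \<in> C" "d \<in> C" "\<gamma> \<in> \<Sigma>2" for u v c d \<gamma>
    using vE' that by blast
  let ?n = "length w"
  let ?M = "\<lambda>u. marked (node_word w) u (Suc ?n)"
  have nodeC: "u \<le> ?n \<and> c \<in> C" if "k \<le> length z" "vs ! k = (u, c)" for k u c
    using vs(2,3) that nth_mem[of k vs] by auto
  have inj: "i = j" if "i \<le> length z" "j \<le> length z" "vs ! i = vs ! j" for i j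
    using vs(1,2) that by (simp add: nth_eq_iff_index_eq)
  have accE: "f (marked (node_word w) u v) \<in> f ` E c d \<gamma> \<longleftrightarrow>
      (\<exists>k<length z. (u, c) = vs ! k \<and> (v, d) = vs ! Suc k \<and> \<gamma> = z ! k)"
    if "u \<le> ?n" "v \<le> ?n" "c \<in> C" "d \<in> C" "\<gamma> \<in> \<Sigma>2" for u v c d \<gamma>
    using saturates_image[OF satE[OF that(3-5)]] vE[OF that] by simp
  \<comment> \<open>Nodes on the path are distinct, so an edge leaving \<open>vs ! k\<close> can
    only be the edge number \<open>k\<close>.\<close>
  have next_node: "\<exists>k'\<le>length z. vs ! k' = (v, d) \<and> take k z @ [\<gamma>] = take k' z"
    if k: "k \<le> length z" "vs ! k = (u, c)" and acc: "f (marked (node_word w) u v) \<in> f ` E c d \<gamma>"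
      "v \<le> ?n" "d \<in> C" "\<gamma> \<in> \<Sigma>2" for u v c d \<gamma> k
  proof -
    obtain k' where k': "k' < length z" "(u, c) = vs ! k'" "(v, d) = vs ! Suc k'" "\<gamma> = z ! k'"
      using accE[of u v c d \<gamma>] nodeC[OF k] acc by blast
    then have "k' = k" using inj[of k' k] k by simp
    then show ?thesis using k' by (intro exI[of _ "Suc k"]) (simp add: take_Suc_conv_app_nth)
  qed
  show ?thesis
  proof
    assume "\<exists>i. (rstep walk_rules (ann w))\<^sup>*\<^sup>* (Seek, 0, []) (Done, i, z')"
    then obtain i0 where run: "(rstep walk_rules (ann w))\<^sup>*\<^sup>* (Seek, 0, []) (Done, i0, z')" by blast
    \<comment> \<open>Position \<open>i\<close> scans node \<open>i - 1\<close>. Hence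
      \<open>Rightw\<close> at position \<open>Suc v\<close> has the class of the nodes before
      \<open>v\<close>, and \<open>Leftw\<close> at position \<open>i\<close> that of the nodes from
      \<open>i\<close> on. The latter is stated by position because a walk to the left may end at
      position 0, where there is no node.\<close>
    define inv where "inv s i y = (case s of Seek \<Rightarrow> y = []
      | At c \<Rightarrow> \<exists>u k. i = Suc u \<and> k \<le> length z \<and> vs ! k = (u, c) \<and> y = take k z
      | Rightw c d \<gamma> q \<Rightarrow> \<exists>u v k. u < v \<and> i = Suc v \<and> k \<le> length z \<and> vs ! k = (u, c) \<and> y = take k z
          \<and> q = f (take v (?M u))
      | Leftw c d \<gamma> q \<Rightarrow> \<exists>u k. i \<le> u \<and> k \<le> length z \<and> vs ! k = (u, c) \<and> y = take k z
          \<and> q = f (drop i (?M u))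
      | Done \<Rightarrow> y = z)" for s :: "'b walk" and i y
    have at_inv: "inv (At c) (Suc u) (take k z)" if "k \<le> length z" "vs ! k = (u, c)" for u c k
      using that by (auto simp: inv_def)
    have right_inv: "inv (Rightw c d \<gamma> (f (take v (?M u)))) (Suc v) (take k z)"
      if "k \<le> length z" "vs ! k = (u, c)" "u < v" for u v c d \<gamma> k
      using that unfolding inv_def walk.case by blast
    have left_inv: "inv (Leftw c d \<gamma> (f (drop v (?M u)))) v (take k z)"
      if "k \<le> length z" "vs ! k = (u, c)" "v \<le> u" for u v c d \<gamma> k
      using that unfolding inv_def walk.case by blast
    have "fst (snd k) \<le> ?n + 2 \<and> inv (fst k) (fst (snd k)) (snd (snd k))" if "(rstep walk_rules (ann w))\<^sup>*\<^sup>* (Seek, 0, []) k" for k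
      using that
    proof (induction rule: rtranclp_induct)
      case base
      then show ?case by (simp add: inv_def)
    next
      case (step k k')
      obtain s i y t j y' where k: "k = (s, i, y)" "k' = (t, j, y')" by (metis prod_cases3)
      have IH: "inv s i y" and i: "i \<le> ?n + 2" using step(3) k by simp_all
      obtain a e where r: "(s, tape (ann w) i, t, a, e) \<in> walk_rules" "y' = y @ a" "int j = int i + e" "j \<le> ?n + 2"
        using step(2) k by (auto simp: rstep_def)
      show ?case
      proof (cases i)
        case 0
        then have "s = Seek" "t = Seek" "a = []" using r(1) by (auto simp: walk_rules_def tape_def)
        then show ?thesis using IH r(2,4) k by (simp add: inv_def)
      next
        case (Suc v)
        have v: "v \<le> ?n" using r(1) Suc i by (auto simp: walk_rules_def tape_def split: if_splits)
        have st: "wstep s (letter w v) t a e"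
          using r(1) unfolding Suc tape_ann[OF v] walk_rules_letter[OF letter_in[OF w v]] .
        note same = class_marked_same[OF v]
        have "inv t j y'"
          using st
        proof (cases rule: wstep.cases)
          case seek
          then show ?thesis using IH r(2) by (simp add: inv_def)
        next
          case (start c l b rr)
          then have "marked (node_word w) v v \<in> S c"
            using same saturates_image[OF satS[OF start(6)]] by (simp add: letter_def)
          then have "vs ! 0 = (v, c)" using vS[OF v start(6)] by simp
          moreover have "y' = take 0 z" "j = Suc v" using start(1,4,5) IH r(2,3) Suc by (simp_all add: inv_def)
          ultimately show ?thesis using start(3) at_inv[of 0] by simp
        next
          case (stop c l b rr)
          then have "marked (node_word w) v v \<in> F c"
            using same saturates_image[OF satF[OF stop(6)]] by (simp add: letter_def)
          then have last: "vs ! length z = (v, c)" using vF[OF v] stop by simp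
          obtain k where "k \<le> length z" "vs ! k = (v, c)" "y = take k z"
            using IH stop(1) Suc by (auto simp: inv_def)
          then show ?thesis using last inj[of k "length z"] stop r(2) by (simp add: inv_def)
        next
          case (stay c d \<gamma> l b rr)
          then have acc: "f (marked (node_word w) v v) \<in> f ` E c d \<gamma>"
            using same by (simp add: letter_def)
          obtain k where "k \<le> length z" "vs ! k = (v, c)" "y = take k z"
            using IH stay(1) Suc by (auto simp: inv_def)
          moreover from this obtain k' where "k' \<le> length z" "vs ! k' = (v, d)" "take k z @ [\<gamma>] = take k' z"
            using next_node[OF _ _ acc v] stay(7,8) by blast
          moreover have "j = Suc v" using r(3) stay(5) Suc by simp
          ultimately show ?thesis using r(2) stay(3,4) at_inv[of k' v d] by simp
        next
          case (right c d \<gamma> l b rr)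
          obtain k where k: "k \<le> length z" "vs ! k = (v, c)" "y = take k z"
            using IH right(1) Suc by (auto simp: inv_def)
          have "mul l (f [(b, True, False)]) = f (take (Suc v) (?M v))"
            using class_take_Suc[OF v, of v] class_take[OF v] right(2) by (simp add: letter_def)
          moreover have "j = Suc (Suc v)" using r(3) right Suc by simp
          ultimately show ?thesis using right_inv[OF k(1,2), of "Suc v" d \<gamma>] right(3,4) k(3) r(2) by simp
        next
          case (left c d \<gamma> rr b l)
          obtain k where k: "k \<le> length z" "vs ! k = (v, c)" "y = take k z"
            using IH left(1) Suc by (auto simp: inv_def)
          have "mul (f [(b, True, False)]) rr = f (drop v (?M v))"
            using class_drop[OF v, of v] class_drop_after[OF v] left(2) by (simp add: letter_def)
          moreover have "j = v" using r(3) left Suc by simp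
          ultimately show ?thesis using left_inv[OF k(1,2), of v d \<gamma>] left(3,4) k(3) r(2) by simp
        next
          case (right_go c d \<gamma> q b l rr)
          obtain u k where k: "u < v" "k \<le> length z" "vs ! k = (u, c)" "y = take k z" "q = f (take v (?M u))"
            using IH right_go(1) Suc by (auto simp: inv_def)
          have "mul q (f [(b, False, False)]) = f (take (Suc v) (?M u))"
            using class_take_Suc[OF v, of u] k(1,5) right_go(2) by (simp add: letter_def)
          moreover have "j = Suc (Suc v)" using r(3) right_go Suc by simp
          ultimately show ?thesis
            using right_inv[OF k(2,3) less_SucI[OF k(1)], of d \<gamma>] right_go(3,4) k(4) r(2) by simp
        next
          case (left_go c d \<gamma> q b l rr)
          obtain u k where k: "Suc v \<le> u" "k \<le> length z" "vs ! k = (u, c)" "y = take k z" "q = f (drop (Suc v) (?M u))"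
            using IH left_go(1) Suc by (auto simp: inv_def)
          have "mul (f [(b, False, False)]) q = f (drop v (?M u))"
            using class_drop[OF v, of u] k(1,5) left_go(2) by (simp add: letter_def)
          moreover have "j = v" using r(3) left_go Suc by simp
          ultimately show ?thesis
            using left_inv[OF k(2,3) Suc_leD[OF k(1)], of d \<gamma>] left_go(3,4) k(4) r(2) by simp
        next
          case (right_stop c d \<gamma> q b rr l)
          obtain u k where k: "u < v" "k \<le> length z" "vs ! k = (u, c)" "y = take k z" "q = f (take v (?M u))"
            using IH right_stop(1) Suc by (auto simp: inv_def)
          have acc: "f (marked (node_word w) u v) \<in> f ` E c d \<gamma>"
            using class_marked_less[OF k(1) v] right_stop k(5) by (simp add: letter_def)
          obtain k' where "k' \<le> length z" "vs ! k' = (v, d)" "take k z @ [\<gamma>] = take k' z"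
            using next_node[OF k(2,3) acc v] right_stop(7,8) by blast
          moreover have "j = Suc v" using r(3) right_stop(5) Suc by simp
          ultimately show ?thesis using r(2) right_stop(3,4) k(4) at_inv[of k' v d] by simp
        next
          case (left_stop c d \<gamma> q l b rr)
          obtain u k where k: "Suc v \<le> u" "k \<le> length z" "vs ! k = (u, c)" "y = take k z" "q = f (drop (Suc v) (?M u))"
            using IH left_stop(1) Suc by (auto simp: inv_def)
          have "u \<le> ?n" using nodeC[OF k(2,3)] by simp
          then have acc: "f (marked (node_word w) u v) \<in> f ` E c d \<gamma>"
            using class_marked_greater[of v u w] left_stop k(1,5) by (simp add: letter_def)
          obtain k' where "k' \<le> length z" "vs ! k' = (v, d)" "take k z @ [\<gamma>] = take k' z"
            using next_node[OF k(2,3) acc v] left_stop(7,8) by blast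
          moreover have "j = Suc v" using r(3) left_stop(5) Suc by simp
          ultimately show ?thesis using r(2) left_stop(3,4) k(4) at_inv[of k' v d] by simp
        qed
        then show ?thesis using k r(4) by simp
      qed
    qed
    from this[OF run] show "z' = z" by (simp add: inv_def)
  next
    assume z': "z' = z"
    let ?R = "(rstep walk_rules (ann w))\<^sup>*\<^sup>*"
    have step_to: "?R k0 (t, j, y @ a)"
      if "?R k0 (s, Suc u, y)" "u \<le> ?n" "wstep s (letter w u) t a e" "int j = int (Suc u) + e" "j \<le> ?n + 2"
      for k0 s u y t a e j
      using that(1) by (rule rtranclp.rtrancl_into_rtrancl) (use walk_step[OF w that(2)] that(3-5) in blast)
    have seek: "?R (Seek, 0, []) (Seek, Suc u, [])" if "u \<le> ?n" for u
      using that
    proof (induction u)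
      case 0
      have "rstep walk_rules (ann w) (Seek, 0, []) (Seek, Suc 0, [])"
        by (simp add: rstep_def walk_rules_def tape_def)
      then show ?case by simp
    next
      case (Suc u)
      then show ?case
        using step_to[of "(Seek, 0, [])" Seek u "[]" Seek "[]" 1 "Suc (Suc u)"] wstep.seek by simp
    qed
    have right_walk: "?R (At c, Suc u, y) (Rightw c d \<gamma> (f (take v (?M u))), Suc v, y)"
      if "u \<le> ?n" "c \<in> C" "d \<in> C" "\<gamma> \<in> \<Sigma>2" "u < v" "v \<le> ?n" for u v c d \<gamma> y
      using that(5,6)
    proof (induction v)
      case (Suc v)
      have v: "v \<le> ?n" using Suc.prems by simp
      show ?case
      proof (cases "u = v")
        case True
        have "wstep (At c) (letter w v) (Rightw c d \<gamma> (f (take (Suc v) (?M u)))) [] 1"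
          unfolding class_take_Suc[OF v] letter_def using wstep.right[OF that(2-4) class_in(1)] class_take[OF v] True by simp
        then show ?thesis using step_to[of "(At c, Suc u, y)" "At c" v y _ "[]" 1 "Suc (Suc v)"] True Suc.prems by simp
      next
        case False
        then have IH: "?R (At c, Suc u, y) (Rightw c d \<gamma> (f (take v (?M u))), Suc v, y)" using Suc by simp
        have "wstep (Rightw c d \<gamma> (f (take v (?M u)))) (letter w v) (Rightw c d \<gamma> (f (take (Suc v) (?M u)))) [] 1"
          unfolding class_take_Suc[OF v] letter_def using wstep.right_go[OF that(2-4), of "f (take v (?M u))"] False by simp
        then show ?thesis using step_to[OF IH v, of _ "[]" 1 "Suc (Suc v)"] Suc.prems by simp
      qed
    qed simp
    \<comment> \<open>\<open>v\<close> is a tape position here: the head is about to scan node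
      \<open>v - 1\<close>, and the accumulated class begins with node \<open>v\<close>. The
      induction therefore runs downwards from \<open>u\<close>.\<close>
    have left_walk: "?R (At c, Suc u, y) (Leftw c d \<gamma> (f (drop v (?M u))), v, y)"
      if "u \<le> ?n" "c \<in> C" "d \<in> C" "\<gamma> \<in> \<Sigma>2" "v \<le> u" for u v c d \<gamma> y
      using that(5)
    proof (induction v rule: inc_induct)
      case base
      have "wstep (At c) (letter w u) (Leftw c d \<gamma> (f (drop u (?M u)))) [] (-1)"
        unfolding class_drop[OF that(1)] letter_def
        using wstep.left[OF that(2-4) class_in(2)] class_drop_after[OF that(1)] by simp
      then show ?case using step_to[of "(At c, Suc u, y)" "At c" u y _ "[]" "-1" u] that(1) by simp
    next
      case (step v)
      then have v: "v \<le> ?n" using that(1) by simp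
      have "wstep (Leftw c d \<gamma> (f (drop (Suc v) (?M u)))) (letter w v) (Leftw c d \<gamma> (f (drop v (?M u)))) [] (-1)"
        unfolding class_drop[OF v] letter_def using wstep.left_go[OF that(2-4)] step(2) by simp
      then show ?case using step_to[OF step(3) v, of _ "[]" "-1" v] v by simp
    qed
    have at: "\<exists>u c. vs ! k = (u, c) \<and> ?R (Seek, 0, []) (At c, Suc u, take k z)" if "k \<le> length z" for k
      using that
    proof (induction k)
      case 0
      obtain u c where uc: "vs ! 0 = (u, c)" by fastforce
      then have u: "u \<le> ?n" "c \<in> C" using nodeC[of 0] by auto
      have "wstep Seek (letter w u) (At c) [] 0"
        unfolding letter_def using vS[OF u] uc u(2) by (intro wstep.start) (simp_all add: class_marked_same[OF u(1)])
      then show ?case using step_to[OF seek[OF u(1)] u(1), of "At c" "[]" 0 "Suc u"] u uc by auto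
    next
      case (Suc k)
      then obtain u c where uc: "vs ! k = (u, c)" "?R (Seek, 0, []) (At c, Suc u, take k z)" by auto
      obtain v d where vd: "vs ! Suc k = (v, d)" by fastforce
      have u: "u \<le> ?n" "c \<in> C" and v: "v \<le> ?n" "d \<in> C"
        using nodeC[of k] nodeC[of "Suc k"] uc(1) vd Suc.prems by auto
      define \<gamma> where "\<gamma> = z ! k"
      have g: "\<gamma> \<in> \<Sigma>2" using z Suc.prems by (auto simp: \<gamma>_def in_lists_conv_set)
      have acc: "f (marked (node_word w) u v) \<in> f ` E c d \<gamma>"
        using accE[OF u(1) v(1) u(2) v(2) g] uc(1) vd Suc.prems \<gamma>_def by (metis Suc_le_lessD)
      have "?R (At c, Suc u, take k z) (At d, Suc v, take k z @ [\<gamma>])"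
      proof -
        consider "u = v" | "u < v" | "v < u" by linarith
        then show ?thesis
        proof cases
          case 1
          have "wstep (At c) (letter w u) (At d) [\<gamma>] 0"
            unfolding letter_def
            by (rule wstep.stay[OF u(2) v(2) g]) (use acc class_marked_same[OF u(1)] 1 in simp)
          then show ?thesis using step_to[of "(At c, Suc u, take k z)" "At c" u "take k z" _ "[\<gamma>]" 0 "Suc v"] u(1) 1 by simp
        next
          case 2
          have "wstep (Rightw c d \<gamma> (f (take v (?M u)))) (letter w v) (At d) [\<gamma>] 0"
            unfolding letter_def
            by (rule wstep.right_stop[OF u(2) v(2) g]) (use acc class_marked_less[OF 2 v(1)] in simp_all)
          then show ?thesis
            using step_to[OF right_walk[OF u v(2) g 2 v(1)] v(1), of "At d" "[\<gamma>]" 0 "Suc v"] v(1) by simp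
        next
          case 3
          have "wstep (Leftw c d \<gamma> (f (drop (Suc v) (?M u)))) (letter w v) (At d) [\<gamma>] 0"
            unfolding letter_def
            by (rule wstep.left_stop[OF u(2) v(2) g]) (use acc class_marked_greater[OF 3 u(1)] in simp_all)
          then show ?thesis
            using step_to[OF left_walk[OF u v(2) g Suc_leI[OF 3]] v(1), of "At d" "[\<gamma>]" 0 "Suc v"] v(1) by simp
        qed
      qed
      moreover have "take (Suc k) z = take k z @ [\<gamma>]" using Suc.prems by (simp add: \<gamma>_def take_Suc_conv_app_nth)
      ultimately show ?case using uc(2) vd by auto
    qed
    obtain u c where uc: "vs ! length z = (u, c)" "?R (Seek, 0, []) (At c, Suc u, z)" using at[of "length z"] by auto
    then have u: "u \<le> ?n" "c \<in> C" using nodeC[of "length z"] by auto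
    have "wstep (At c) (letter w u) Done [] 0"
      unfolding letter_def using vF[OF u] uc(1) u(2) by (intro wstep.stop) (simp_all add: class_marked_same[OF u(1)])
    then have "?R (Seek, 0, []) (Done, Suc u, z)"
      using step_to[OF uc(2) u(1), of Done "[]" 0 "Suc u"] u(1) by simp
    then show "\<exists>i. ?R (Seek, 0, []) (Done, i, z')" using z' by blast
  qed
qed

lemma rep_dom: "w \<in> lists \<Sigma>1 \<Longrightarrow> w \<in> Domain m \<longleftrightarrow> node_word w \<in> D"
  using rep[unfolded path_rep_def, THEN conjunct1] by (rule bspec)

text \<open>The first machine produces the annotation only on the domain of \<open>m\<close>; on
  annotated words of the domain the walk reproduces \<open>m\<close> by
  \<open>walk_path\<close>.\<close>

theorem m_eq_composition: "m = {(w, ann w) | w. w \<in> lists \<Sigma>1 \<and> node_word w \<in> D} O walk_rel"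
proof (intro set_eqI iffI)
  fix p assume p: "p \<in> m"
  obtain w z where wz: "p = (w, z)" by fastforce
  have w: "w \<in> lists \<Sigma>1" using p wz m by auto
  moreover have "node_word w \<in> D" using rep_dom[OF w] p wz by blast
  moreover have "ann w \<in> lists (code ` letters)" using letter_in[OF w] by (auto simp: ann_def simp del: upt_Suc)
  then have "(ann w, z) \<in> walk_rel" using walk_path[of w z z] p wz by (simp add: walk_rel_def)
  ultimately show "p \<in> {(w, ann w) | w. w \<in> lists \<Sigma>1 \<and> node_word w \<in> D} O walk_rel" using wz by blast
next
  fix p assume "p \<in> {(w, ann w) | w. w \<in> lists \<Sigma>1 \<and> node_word w \<in> D} O walk_rel"
  then obtain w z' where p: "p = (w, z')" "w \<in> lists \<Sigma>1" "node_word w \<in> D" "(ann w, z') \<in> walk_rel" by auto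
  then obtain z where z: "(w, z) \<in> m" using rep_dom by blast
  then show "p \<in> m" using walk_path[OF z, of z'] p by (auto simp: walk_rel_def)
qed

end

text \<open>Two machines are enough. One congruence must serve all languages simultaneously, which
  is possible because only the finitely many copies in \<open>C\<close> and labels in
  \<open>\<Sigma>2\<close> occur.\<close>

theorem MSO_ed_NGSMpow:
  fixes m :: "('a list \<times> 'b list) set"
  assumes fin: "finite \<Sigma>1" "finite \<Sigma>2" and m: "m \<subseteq> lists \<Sigma>1 \<times> lists \<Sigma>2" and mso: "MSO_ed \<Sigma>1 \<Sigma>2 m"
  shows "m \<in> NGSMpow 2"
proof -
  obtain C D S F E where rep: "finite C" "recog D" "\<And>c. recog (S c)" "\<And>c. recog (F c)" "\<And>c d \<gamma>. recog (E c d \<gamma>)"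
    "path_rep \<Sigma>1 \<Sigma>2 m C D S F E"
    by (rule MSO_ed_path_rep[OF fin m mso]) (rule that)
  let ?I = "insert {U. map fst U \<in> D} (S ` C \<union> F ` C \<union> (\<lambda>(c, d, \<gamma>). E c d \<gamma>) ` (C \<times> C \<times> \<Sigma>2))"
  have "\<exists>f :: _ \<Rightarrow> nat. fcong f \<and> (\<forall>L\<in>?I. saturates f L)"
  proof (rule recog_common[of ?I "\<lambda>L. L"])
    show "finite ?I" using rep(1) fin by simp
    show "recog L" if "L \<in> ?I" for L using that rep(3-5) recog_vimage[OF rep(2)] by auto
  next
    fix f :: "_ \<Rightarrow> nat" assume a: "fcong f" "\<And>L. L \<in> ?I \<Longrightarrow> saturates f L"
    show "\<exists>f :: _ \<Rightarrow> nat. fcong f \<and> (\<forall>L\<in>?I. saturates f L)"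
      by (intro exI[of _ f] conjI ballI) (rule a(1), rule a(2))
  qed
  then obtain f :: "_ \<Rightarrow> nat" where f: "fcong f" "\<And>L. L \<in> ?I \<Longrightarrow> saturates f L" by blast
  obtain mul where mul: "\<And>u v. f (u @ v) = mul (f u) (f v)" by (rule fcong_mult[OF f(1)]) (rule that)
  interpret walker f mul C \<Sigma>1 \<Sigma>2 D S F E m
  proof
    show "saturates f {U. map fst U \<in> D}" by (rule f(2)) blast
    show "saturates f (S c)" "saturates f (F c)" if "c \<in> C" for c by (rule f(2); use that in blast)+
    show "saturates f (E c d \<gamma>)" if "c \<in> C" "d \<in> C" "\<gamma> \<in> \<Sigma>2" for c d \<gamma>
    proof (rule f(2))
      have "E c d \<gamma> \<in> (\<lambda>(c, d, \<gamma>). E c d \<gamma>) ` (C \<times> C \<times> \<Sigma>2)"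
        by (rule image_eqI[of _ _ "(c, d, \<gamma>)"]) (use that in simp_all)
      then show "E c d \<gamma> \<in> ?I" by blast
    qed
  qed (rule f(1) mul rep(1,6) fin m)+
  \<comment> \<open>For exponent 2 the chain of intermediate machines has length 0 and is the
    identity.\<close>
  have "m = {(w, ann w) | w. w \<in> lists \<Sigma>1 \<and> node_word w \<in> D} O Id O walk_rel"
    using m_eq_composition by simp
  then show ?thesis unfolding NGSMpow_def using annotate_NGSM walk_NGSM by auto
qed

section \<open>Compositions of nondeterministic machines\<close>

text \<open>Quantifying over both alphabets is what the induction over a composition needs: the rest
  of the composition is later uniformized over the output alphabet of the machine in front of
  it.\<close>

definition unifiable :: "('a list \<times> 'b list) set \<Rightarrow> bool" where
  "unifiable R \<longleftrightarrow> (\<forall>\<Sigma>1 \<Sigma>2. finite \<Sigma>1 \<longrightarrow> finite \<Sigma>2 \<longrightarrow> (\<exists>m. m \<subseteq> R \<inter> lists \<Sigma>1 \<times> lists \<Sigma>2 \<and>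
     Domain (R \<inter> lists \<Sigma>1 \<times> lists \<Sigma>2) \<subseteq> Domain m \<and> MSO_ed \<Sigma>1 \<Sigma>2 m))"

lemma recog_lists: "recog (lists \<Sigma>)"
proof -
  have "lists \<Sigma> = {z. \<forall>x\<in>set z. x \<in> \<Sigma>}" by auto
  then show ?thesis by (simp add: recog_all_letter)
qed

lemma NGSM_unifiable:
  fixes R :: "('a list \<times> 'b list) set"
  assumes "R \<in> NGSM"
  shows "unifiable R"
proof -
  obtain M where M: "wf_gsm M" "R = gsm_rel M" using assms by (auto simp: NGSM_def)
  show ?thesis unfolding unifiable_def
  proof (intro allI impI)
    fix \<Sigma>1 :: "'a set" and \<Sigma>2 :: "'b set" assume "finite \<Sigma>1" "finite \<Sigma>2"
    then obtain m where "m \<subseteq> gsm_rel M \<inter> lists \<Sigma>1 \<times> lists \<Sigma>2"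
      "Domain (gsm_rel M \<inter> lists \<Sigma>1 \<times> lists \<Sigma>2) \<subseteq> Domain m" "MSO_ed \<Sigma>1 \<Sigma>2 m"
      by (rule gsm_uniformization[OF M(1) _ _ recog_lists subset_refl])
    then show "\<exists>m. m \<subseteq> R \<inter> lists \<Sigma>1 \<times> lists \<Sigma>2 \<and>
     Domain (R \<inter> lists \<Sigma>1 \<times> lists \<Sigma>2) \<subseteq> Domain m \<and> MSO_ed \<Sigma>1 \<Sigma>2 m" using M(2) by blast
  qed
qed

text \<open>Serves to strip the final \<open>None\<close> of a node word.\<close>

lemma recog_right_quotient:
  assumes "recog L"
  shows "recog {u. u @ v \<in> L}"
proof -
  obtain f :: "_ \<Rightarrow> nat" where f: "fcong f" "saturates f L" using assms by (rule recogE)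
  from f(1) show ?thesis
  proof (rule recogI, intro saturatesI)
    fix u u' assume "f u = f u'"
    then have "f (u @ v) = f (u' @ v)" by (rule fcong_append[OF f(1)]) (rule refl)
    from saturatesD[OF f(2) this] show "u \<in> {u. u @ v \<in> L} \<longleftrightarrow> u' \<in> {u. u @ v \<in> L}" by simp
  qed
qed

text \<open>The passage from MSO to regular languages, applied to the domain formula. It makes the
  domain of a uniformizer available as the output restriction \<open>L\<close> of the machine in
  front.\<close>

lemma recog_Domain:
  assumes "finite \<Sigma>1" "finite \<Sigma>2" "m \<subseteq> lists \<Sigma>1 \<times> lists \<Sigma>2" "MSO_ed \<Sigma>1 \<Sigma>2 m"
  shows "recog (Domain m)"
proof -
  obtain C D S F E where D: "recog D" and rep: "path_rep \<Sigma>1 \<Sigma>2 m C D S F E"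
    by (rule MSO_ed_path_rep[OF assms]) (rule that)
  have "w \<in> Domain m \<longleftrightarrow> (\<forall>x\<in>set w. x \<in> \<Sigma>1) \<and> map Some w \<in> {U. U @ [None] \<in> D}" for w
    using rep[unfolded path_rep_def, THEN conjunct1] assms(3) by (auto simp: node_word_def)
  then have "Domain m = {w. (\<forall>x\<in>set w. x \<in> \<Sigma>1) \<and> map Some w \<in> {U. U @ [None] \<in> D}}" by blast
  then show ?thesis
    by (simp only:) (intro recog_conj recog_all_letter recog_vimage recog_right_quotient D)
qed

lemma gsm_rel_output:
  assumes "wf_gsm M" "(w, z) \<in> gsm_rel M"
  shows "z \<in> lists (gout M)"
proof -
  obtain i where "(gsm_step M w)\<^sup>*\<^sup>* (ginit M, 0, []) (gfinal M, i, z)"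
    using assms(2) by (auto simp: gsm_rel_def)
  moreover have "snd (snd k) \<in> lists (gout M)" if "(gsm_step M w)\<^sup>*\<^sup>* (ginit M, 0, []) k" for k
    using that
  proof (induction rule: rtranclp_induct)
    case (step k k')
    obtain p i y q j y' where k: "k = (p, i, y)" "k' = (q, j, y')" by (metis prod_cases3)
    then obtain a e where "gtrans M p (tape w i) q a e" "y' = y @ a"
      using step(2) gsm_step_iff by metis
    then show ?case using gtrans_wf(4)[OF assms(1)] step(3) k by simp
  qed simp
  ultimately show ?thesis by fastforce
qed

text \<open>The second relation is uniformized first, and the output of the first machine is then
  restricted to the domain of the uniformizer.\<close>
lemma NGSM_comp_unifiable:
  fixes R :: "('a list \<times> 'b list) set" and S :: "('b list \<times> 'c list) set"
  assumes R: "R \<in> NGSM" and S: "unifiable S"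
  shows "unifiable (R O S)"
proof -
  obtain M where M: "wf_gsm M" "R = gsm_rel M" using R by (auto simp: NGSM_def)
  have finM: "finite (gout M)" using M(1) by (simp add: wf_gsm_def)
  show ?thesis unfolding unifiable_def
  proof (intro allI impI)
    fix \<Sigma>1 :: "'a set" and \<Sigma>2 :: "'c set" assume fin: "finite \<Sigma>1" "finite \<Sigma>2"
    obtain m2 where m2: "m2 \<subseteq> S \<inter> lists (gout M) \<times> lists \<Sigma>2"
      "Domain (S \<inter> lists (gout M) \<times> lists \<Sigma>2) \<subseteq> Domain m2" "MSO_ed (gout M) \<Sigma>2 m2"
      using S[unfolded unifiable_def, rule_format, OF finM fin(2)] by (elim exE conjE) (rule that)
    have "recog (Domain m2)" by (rule recog_Domain[OF finM fin(2) _ m2(3)]) (use m2(1) in blast)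
    moreover have "Domain m2 \<subseteq> lists (gout M)" using m2(1) by blast
    ultimately obtain m1 where m1: "m1 \<subseteq> gsm_rel M \<inter> lists \<Sigma>1 \<times> Domain m2"
      "Domain (gsm_rel M \<inter> lists \<Sigma>1 \<times> Domain m2) \<subseteq> Domain m1" "MSO_ed \<Sigma>1 (gout M) m1"
      by (rule gsm_uniformization[OF M(1) fin(1) finM])
    have "m1 \<subseteq> lists \<Sigma>1 \<times> lists (gout M)" using m1(1) \<open>Domain m2 \<subseteq> lists (gout M)\<close> by blast
    then have "MSO_ed \<Sigma>1 \<Sigma>2 (m1 O m2)" by (rule MSO_ed_comp[OF m1(3) m2(3)])
    moreover have "m1 O m2 \<subseteq> (R O S) \<inter> lists \<Sigma>1 \<times> lists \<Sigma>2" using m1(1) m2(1) M(2) by blast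
    moreover have "Domain ((R O S) \<inter> lists \<Sigma>1 \<times> lists \<Sigma>2) \<subseteq> Domain (m1 O m2)"
    proof
      fix w assume "w \<in> Domain ((R O S) \<inter> lists \<Sigma>1 \<times> lists \<Sigma>2)"
      then obtain b z where b: "w \<in> lists \<Sigma>1" "(w, b) \<in> gsm_rel M" "(b, z) \<in> S" "z \<in> lists \<Sigma>2"
        using M(2) by auto
      then have "b \<in> Domain m2" using gsm_rel_output[OF M(1) b(2)] m2(2) by blast
      then have "w \<in> Domain m1" using m1(2) b by blast
      then show "w \<in> Domain (m1 O m2)" using m1(1) by blast
    qed
    ultimately show "\<exists>m. m \<subseteq> (R O S) \<inter> lists \<Sigma>1 \<times> lists \<Sigma>2 \<and>
      Domain ((R O S) \<inter> lists \<Sigma>1 \<times> lists \<Sigma>2) \<subseteq> Domain m \<and> MSO_ed \<Sigma>1 \<Sigma>2 m" by blast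
  qed
qed

lemma nat_chain_unifiable: "C \<in> nat_chain n \<Longrightarrow> B \<in> NGSM \<Longrightarrow> unifiable (C O B)"
proof (induction n arbitrary: C)
  case 0
  then show ?case by (simp add: NGSM_unifiable)
next
  case (Suc n)
  then obtain R S where C: "C = R O S" "R \<in> NGSM" "S \<in> nat_chain n" by auto
  have "unifiable (R O (S O B))"
    by (rule NGSM_comp_unifiable[OF C(2)]) (rule Suc.IH[OF C(3) Suc.prems(2)])
  then show ?case using C(1) by (simp add: O_assoc)
qed

lemma NGSMpow_unifiable:
  assumes "m \<in> NGSMpow k"
  shows "unifiable m"
proof (cases "k = 1")
  case True
  then show ?thesis using assms NGSM_unifiable by (simp add: NGSMpow_def)
next
  case False
  then obtain A C B where "m = A O C O B" "A \<in> NGSM" "C \<in> nat_chain (k - 2)" "B \<in> NGSM"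
    using assms by (auto simp: NGSMpow_def split: if_splits)
  then show ?thesis using NGSM_comp_unifiable[of A "C O B"] nat_chain_unifiable[of C "k - 2" B] by simp
qed

theorem theorem6p11:
  fixes \<Sigma>1 :: "'a set" and \<Sigma>2 :: "'b set" and m :: "('a list \<times> 'b list) set"
  assumes "finite \<Sigma>1" and "finite \<Sigma>2"
    and "m \<subseteq> lists \<Sigma>1 \<times> lists \<Sigma>2"
  shows "MSO_ed \<Sigma>1 \<Sigma>2 m \<longleftrightarrow> (m \<in> (\<Union>k\<in>{1..}. NGSMpow k) \<and> functional m)"
proof
  assume "MSO_ed \<Sigma>1 \<Sigma>2 m"
  then have "m \<in> NGSMpow 2" "functional m"
    using MSO_ed_NGSMpow[OF assms] MSO_ed_functional by blast+
  moreover have "(2 :: nat) \<in> {1..}" by simp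
  ultimately show "m \<in> (\<Union>k\<in>{1..}. NGSMpow k) \<and> functional m" by blast
next
  assume m: "m \<in> (\<Union>k\<in>{1..}. NGSMpow k) \<and> functional m"
  then have "unifiable m" using NGSMpow_unifiable by blast
  obtain m' where m': "m' \<subseteq> m \<inter> lists \<Sigma>1 \<times> lists \<Sigma>2"
    "Domain (m \<inter> lists \<Sigma>1 \<times> lists \<Sigma>2) \<subseteq> Domain m'" "MSO_ed \<Sigma>1 \<Sigma>2 m'"
    using \<open>unifiable m\<close>[unfolded unifiable_def, rule_format, OF assms(1,2)] by (elim exE conjE) (rule that)
  \<comment> \<open>A functional relation offers one output per input, so choosing one for each
    element of the domain recovers all of it.\<close>
  have "m \<subseteq> m'"
  proof
    fix p assume "p \<in> m"
    then obtain w z where p: "p = (w, z)" "(w, z) \<in> m" by (cases p) simp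
    then have "w \<in> Domain m'" using m'(2) assms(3) by blast
    then obtain z' where "(w, z') \<in> m'" by blast
    then have "z' = z" using m'(1) p(2) m unfolding functional_def by blast
    then show "p \<in> m'" using p(1) \<open>(w, z') \<in> m'\<close> by simp
  qed
  then have "m = m'" using m'(1) by blast
  then show "MSO_ed \<Sigma>1 \<Sigma>2 m" using m'(3) by simp
qed

end
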